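(* Let $u,v,w$ be fixed permutations. Then the function $$N\longmapsto c_{N\ast u,\;N\ast v}^{\,N\ast w}$$ of the positive integer $N$ is eventually polynomial; that is, there is a polynomial $P$ such that $c_{N\ast u,N\ast v}^{N\ast w}=P(N)$ for all sufficiently large $N$.
   Context: $\mathbb N=\{0,1,2,\dots\}$. A permutation $w\in S_m$ is identified with the permutations obtained from it by appending fixed points. The Lehmer code of $w\in S_m$ is $\mathrm{code}(w)=(\mathrm{code}(w)_1,\dots,\mathrm{code}(w)_m)$ with $\mathrm{code}(w)_i=\#\{j>i: w(j)<w(i)\}$; appending fixed points appends trailing zeroes to the code, and codes are considered up to trailing zeroes. Every finite sequence $\gamma=(\gamma_1,\dots,\gamma_h)\in\mathbb N^h$ becomes, after appending $t$ zeroes with $\gamma_i\le h+t-i$ for all $i$, the Lehmer code of a unique permutation in $S_{h+t}$; increasing $t$ only appends fixed points. This permutation is denoted $\mathrm{code}^{-1}(\gamma)$. For a positive integer $N$ and a permutation $u$, the code-stretched permutation is $N\ast u:=\mathrm{code}^{-1}(N\,\mathrm{code}(u))$. Schubert polynomials $\mathfrak S_w$: for the longest element $w_0\in S_m$, $\mathfrak S_{w_0}=x_1^{m-1}x_2^{m-2}\cdots x_{m-1}$, and $\mathfrak S_{ws_i}=\partial_i\mathfrak S_w$ whenever $w(i)>w(i+1)$, where $\partial_i f=(f-s_if)/(x_i-x_{i+1})$ and $s_i$ exchanges $x_i$ and $x_{i+1}$. They do not change when fixed points are appended to $w$, and they form a basis of $\mathbb Z[x_1,x_2,\dots]$. The Schubert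 structure constants $c_{u,v}^w$ are defined by $\mathfrak S_u\mathfrak S_v=\sum_w c_{u,v}^w\mathfrak S_w$. *)

theory Defs
  imports
    "HOL-Combinatorics.Permutations"
    "HOL-Library.Poly_Mapping"
    "HOL-Computational_Algebra.Polynomial"
begin

text \<open>
  A permutation is a function on \<^typ>\<open>nat\<close> that permutes \<open>{1..m}\<close> for some \<open>m\<close>. Such a function
  is the identity outside \<open>{1..m}\<close>, so appending fixed points does not change it. Positions and
  values start at 1; the index 0 is fixed by every permutation and has code entry 0.
\<close>

definition perms :: "(nat \<Rightarrow> nat) set" where
  "perms = {w. \<exists>m. w permutes {1..m}}"

text \<open>Codes up to trailing zeroes are sequences with finite support.\<close>

definition lehmer_code :: "(nat \<Rightarrow> nat) \<Rightarrow> nat \<Rightarrow> nat" where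
  "lehmer_code w i = card {j. j > i \<and> w j < w i}"

definition code_inv :: "(nat \<Rightarrow> nat) \<Rightarrow> nat \<Rightarrow> nat" where
  "code_inv \<gamma> = (THE w. w \<in> perms \<and> lehmer_code w = \<gamma>)"

definition stretch :: "nat \<Rightarrow> (nat \<Rightarrow> nat) \<Rightarrow> nat \<Rightarrow> nat"  (infixr \<open>\<^bold>*\<close> 75) where
  "N \<^bold>* u = code_inv (\<lambda>i. N * lehmer_code u i)"

text \<open>Integer polynomials in the variables \<open>x\<^sub>i\<close>, as finitely supported maps from exponent vectors
  to coefficients. Only the variables with \<open>i \<ge> 1\<close> occur in Schubert polynomials.\<close>

type_synonym zpoly = "(nat \<Rightarrow>\<^sub>0 nat) \<Rightarrow>\<^sub>0 int"

definition Var :: "nat \<Rightarrow> zpoly" where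
  "Var i = Poly_Mapping.single (Poly_Mapping.single i 1) 1"

text \<open>The coefficient of \<open>e\<close> in \<open>s\<^sub>i f\<close> is the coefficient in \<open>f\<close> of \<open>e\<close> with the exponents of
  \<open>x\<^sub>i\<close> and \<open>x\<^sub>i\<^sub>+\<^sub>1\<close> exchanged.\<close>

definition swap_vars :: "nat \<Rightarrow> zpoly \<Rightarrow> zpoly" where
  "swap_vars i f = Poly_Mapping.map_key (Poly_Mapping.map_key (Transposition.transpose i (i + 1))) f"

text \<open>The quotient is exact, and unique because the polynomial ring is a domain.\<close>

definition divided_diff :: "nat \<Rightarrow> zpoly \<Rightarrow> zpoly" where
  "divided_diff i f = (THE g. g * (Var i - Var (i + 1)) = f - swap_vars i f)"

definition longest :: "nat \<Rightarrow> nat \<Rightarrow> nat" where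
  "longest m i = (if i \<in> {1..m} then m + 1 - i else i)"

text \<open>The values of \<open>\<SS>\<^sub>w\<close> obtained by descending from the longest elements of all the groups
  \<open>S\<^sub>m\<close>. Uniqueness of the value covers both independence of the chosen descents and stability
  under appending fixed points. The descent condition forces \<open>i \<ge> 1\<close>, and \<open>i < m\<close> if \<open>w\<close>
  permutes \<open>{1..m}\<close>.\<close>

inductive schubert_value :: "(nat \<Rightarrow> nat) \<Rightarrow> zpoly \<Rightarrow> bool" where
  longest: "schubert_value (longest m) (\<Prod>i = 1..m. Var i ^ (m - i))"
| descent: "schubert_value (w \<circ> Transposition.transpose i (i + 1)) (divided_diff i f)"
    if "schubert_value w f" and "w i > w (i + 1)"

definition schubert :: "(nat \<Rightarrow> nat) \<Rightarrow> zpoly" where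
  "schubert w = (THE f. schubert_value w f)"

text \<open>The coefficient function of the expansion in the Schubert basis; it vanishes on functions
  that are not permutations.\<close>

definition schubert_const :: "(nat \<Rightarrow> nat) \<Rightarrow> (nat \<Rightarrow> nat) \<Rightarrow> (nat \<Rightarrow> nat) \<Rightarrow> int" where
  "schubert_const u v = (THE c. finite {w. c w \<noteq> 0} \<and> {w. c w \<noteq> 0} \<subseteq> perms \<and>
      schubert u * schubert v = (\<Sum>w | c w \<noteq> 0. of_int (c w) * schubert w))"

end

theory Submission
  imports Defs
begin

text \<open>
  If \<open>\<gamma>\<close> is a code with \<open>\<gamma>\<^sub>i \<le> \<gamma>\<^sub>i\<^sub>+\<^sub>1\<close>, then its Schubert polynomial is \<open>\<partial>\<^sub>i\<close> of the one for
  \<open>(\<dots>, \<gamma>\<^sub>i\<^sub>+\<^sub>1 + 1, \<gamma>\<^sub>i, \<dots>)\<close>. Along codes whose entries are affine in \<open>N\<close>, boundedly many such steps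
  lead to a dominant code, whose Schubert polynomial is a monomial. Dually, the coefficient of
  \<open>\<SS>\<^sub>w\<close> in \<open>f\<close> is reduced by divided differences to a weakly increasing code \<open>(\<gamma>\<^sub>1, \<dots>, \<gamma>\<^sub>n)\<close>,
  for which it is the coefficient of \<open>x\<^sup>\<gamma>\<close> in \<open>f \<Prod>\<^sub>i\<^sub><\<^sub>j (1 - x\<^sub>i / x\<^sub>j)\<close>. Everything therefore stays among
  families of polynomials that are, up to a denominator built from the \<open>x\<^sub>i\<close>, \<open>x\<^sub>i\<^sup>N\<close> and \<open>x\<^sub>i - x\<^sub>j\<close>,
  finite sums \<open>\<Sum> a(N) x\<^sup>N\<^sup>\<mu>\<^sup>+\<^sup>\<delta>\<close> with \<open>a\<close> eventually polynomial. Extracting the coefficient of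
  \<open>x\<^sub>n\<^sup>k\<close> with \<open>k\<close> affine in \<open>N\<close> preserves this class: dividing by \<open>x\<^sub>n - x\<^sub>j\<close> amounts to
  evaluating truncations at \<open>x\<^sub>n = x\<^sub>j\<close>. After all variables are eliminated, an eventually
  polynomial sequence remains.
\<close>

section \<open>Integer polynomials and substitution homomorphisms\<close>

text \<open>The length of a stretched permutation grows with N, so the number of divided differences
  could grow too. Counting only pairs among the first n positions gives the bound n * n for all N,
  and since two affine sequences compare the same way for all large N, one choice of i serves a
  whole family. The real obstacle is extracting a coefficient whose index grows with N. If (X - a) F
  = G, then the part of G of degree at most k, evaluated at X = a, is -a^(k+1) times the coefficient
  of X^k in F. This is why powers x^N are both generators and denominators, and why evaluation at X
  = a must preserve the class. There X - a may itself be a denominator; differentiating it away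
  costs integer factors, which are cleared only at the end, when rational polynomials are
  allowed.\<close>

locale unital_hom =
  fixes h :: "'a::comm_ring_1 \<Rightarrow> 'b::comm_ring_1"
  assumes one [simp]: "h 1 = 1"
    and add [simp]: "h (x + y) = h x + h y"
    and mult [simp]: "h (x * y) = h x * h y"
begin

lemma zero [simp]: "h 0 = 0"
  using add[of 0 0] by simp

lemma uminus [simp]: "h (- x) = - h x"
  using add[of x "- x"] by (simp add: eq_neg_iff_add_eq_0 add.commute)

lemma diff [simp]: "h (x - y) = h x - h y"
  using add[of x "- y"] by simp

lemma power [simp]: "h (x ^ n) = h x ^ n"
  by (induction n) auto

lemma of_nat [simp]: "h (of_nat n) = of_nat n"
  by (induction n) auto

lemma of_int [simp]: "h (of_int z) = of_int z"
  by (cases z) auto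

lemma sum [simp]: "h (sum f A) = (\<Sum>a\<in>A. h (f a))"
  by (induction A rule: infinite_finite_induct) auto

lemma prod [simp]: "h (prod f A) = (\<Prod>a\<in>A. h (f a))"
  by (induction A rule: infinite_finite_induct) auto

end

lemma poly_mapping_single_induct [case_names single add]:
  assumes single: "\<And>k v. P (Poly_Mapping.single k v)"
    and add: "\<And>f g. P f \<Longrightarrow> P g \<Longrightarrow> P (f + g)"
  shows "P f"
proof (induction f rule: Poly_Mapping.update_induct)
  case const
  show ?case using single[of undefined 0] by simp
next
  case (update f a b)
  have "Poly_Mapping.update a b f = f + Poly_Mapping.single a b"
    using update(1)
    by (intro poly_mapping_eqI)
      (auto simp: lookup_update lookup_add lookup_single in_keys_iff when_def)
  then show ?case using add update(3) single by simp
qed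

lemma of_int_eq_single: "of_int c = (Poly_Mapping.single 0 c :: zpoly)"
  using single_of_int[where 'b = int and k = c, symmetric] by simp

lemma Var_power: "Var i ^ n = Poly_Mapping.single (Poly_Mapping.single i n) 1"
  by (induction n) (simp_all add: Var_def mult_single single_add[symmetric])

lemma zpoly_induct [case_names int Var add mult]:
  fixes f :: zpoly
  assumes int: "\<And>c. P (of_int c)"
    and Var: "\<And>i. P (Var i)"
    and add: "\<And>f g. P f \<Longrightarrow> P g \<Longrightarrow> P (f + g)"
    and mult: "\<And>f g. P f \<Longrightarrow> P g \<Longrightarrow> P (f * g)"
  shows "P f"
proof (induction f rule: poly_mapping_single_induct)
  case (single e c)
  have "P (Poly_Mapping.single e 1)"
  proof (induction e rule: poly_mapping_single_induct)
    case (single i n)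
    have "P (Var i ^ n)"
      using int[of 1] by (induction n) (auto intro: Var mult)
    then show ?case by (simp add: Var_power)
  next
    case (add e e')
    then show ?case using mult[OF add] by (simp add: mult_single)
  qed
  from mult[OF int[of c] this] show ?case
    by (simp add: of_int_eq_single mult_single)
qed (rule add)

definition monom_subst :: "(nat \<Rightarrow> 'a::comm_ring_1) \<Rightarrow> (nat \<Rightarrow>\<^sub>0 nat) \<Rightarrow> 'a" where
  "monom_subst \<theta> e = (\<Prod>i\<in>Poly_Mapping.keys e. \<theta> i ^ Poly_Mapping.lookup e i)"

text \<open>Evaluation by the universal property of the polynomial ring. The target is an arbitrary
  commutative ring because later instances land in \<open>int\<close>, in \<open>zpoly\<close>
  itself and in \<open>zpoly poly\<close>.\<close>

definition subst :: "(nat \<Rightarrow> 'a::comm_ring_1) \<Rightarrow> zpoly \<Rightarrow> 'a" where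
  "subst \<theta> f = (\<Sum>e\<in>Poly_Mapping.keys f. of_int (Poly_Mapping.lookup f e) * monom_subst \<theta> e)"

lemma monom_subst_superset:
  assumes "finite A" "Poly_Mapping.keys e \<subseteq> A"
  shows "monom_subst \<theta> e = (\<Prod>i\<in>A. \<theta> i ^ Poly_Mapping.lookup e i)"
  unfolding monom_subst_def using assms
  by (intro prod.mono_neutral_left) (auto simp: in_keys_iff)

lemma monom_subst_add: "monom_subst \<theta> (e + e') = monom_subst \<theta> e * monom_subst \<theta> e'"
proof -
  let ?A = "Poly_Mapping.keys e \<union> Poly_Mapping.keys e'"
  have "Poly_Mapping.keys (e + e') \<subseteq> ?A"
    by (rule Poly_Mapping.keys_add)
  then show ?thesis
    by (simp add: monom_subst_superset[where A = ?A] lookup_add power_add prod.distrib)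
qed

lemma subst_superset:
  assumes "finite A" "Poly_Mapping.keys f \<subseteq> A"
  shows "subst \<theta> f = (\<Sum>e\<in>A. of_int (Poly_Mapping.lookup f e) * monom_subst \<theta> e)"
  unfolding subst_def using assms
  by (intro sum.mono_neutral_left) (auto simp: in_keys_iff)

lemma subst_add: "subst \<theta> (f + g) = subst \<theta> f + subst \<theta> g"
proof -
  let ?A = "Poly_Mapping.keys f \<union> Poly_Mapping.keys g"
  have "Poly_Mapping.keys (f + g) \<subseteq> ?A"
    by (rule Poly_Mapping.keys_add)
  then show ?thesis
    by (simp add: subst_superset[where A = ?A] lookup_add distrib_right sum.distrib)
qed

lemma subst_single: "subst \<theta> (Poly_Mapping.single e c) = of_int c * monom_subst \<theta> e"
  by (simp add: subst_superset[where A = "{e}"])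

lemma subst_mult: "subst \<theta> (f * g) = subst \<theta> f * subst \<theta> g"
proof (induction f rule: poly_mapping_single_induct)
  case (single e c)
  show ?case
    by (induction g rule: poly_mapping_single_induct)
      (simp_all add: mult_single subst_single monom_subst_add distrib_left distrib_right subst_add mult_ac)
qed (simp add: distrib_right subst_add)

interpretation subst: unital_hom "subst \<theta>" for \<theta> :: "nat \<Rightarrow> 'a::comm_ring_1"
proof
  have "subst \<theta> 1 = subst \<theta> (Poly_Mapping.single 0 1)" by simp
  then show "subst \<theta> 1 = 1"
    unfolding subst_single by (simp add: monom_subst_def)
qed (rule subst_add subst_mult)+

lemma subst_Var [simp]: "subst \<theta> (Var i) = \<theta> i"
  by (simp add: Var_def subst_single monom_subst_def)

lemma Var_eq_iff [simp]: "Var i = Var j \<longleftrightarrow> i = j"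
proof
  assume "Var i = Var j"
  then have "subst int (Var i) = subst int (Var j)" by simp
  then show "i = j" by simp
qed simp

abbreviation adj :: "nat \<Rightarrow> nat \<Rightarrow> nat" where
  "adj i \<equiv> Transposition.transpose i (Suc i)"

text \<open>\<open>swap_vars\<close> reindexes exponent vectors; a transposition is its own inverse,
  so this agrees with renaming the variables. Being an evaluation makes it a ring
  homomorphism.\<close>

lemma swap_vars_eq_subst: "swap_vars i f = subst (\<lambda>j. Var (adj i j)) f"
proof -
  let ?t = "adj i"
  let ?m = "Poly_Mapping.map_key ?t :: (nat \<Rightarrow>\<^sub>0 nat) \<Rightarrow> _"
  have t: "inj ?t" by simp
  have invol: "?m (?m e) = e" for e
    using map_key_compose[OF t t, of e] by (simp add: id_def map_key_id)
  have inj: "inj ?m"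
    by (rule inj_on_inverseI[of _ ?m]) (rule invol)
  have add: "swap_vars i (f + g) = swap_vars i f + swap_vars i g" for f g
    unfolding swap_vars_def by (simp add: map_key_plus[OF inj])
  have monom: "Poly_Mapping.single (?m e) 1 = monom_subst (\<lambda>j. Var (?t j)) e" for e
  proof (induction e rule: poly_mapping_single_induct)
    case (single j n)
    have "?m (Poly_Mapping.single j n) = Poly_Mapping.single (?t j) n"
      using map_key_single[OF t, of "?t j" n] by simp
    then show ?case
      by (simp add: monom_subst_superset[where A = "{j}"] Var_power)
  next
    case (add e e')
    then show ?case
      by (simp add: monom_subst_add map_key_plus[OF t] mult_single flip: add)
  qed
  show ?thesis
  proof (induction f rule: poly_mapping_single_induct)
    case (single e c)
    have "swap_vars i (Poly_Mapping.single e c) = Poly_Mapping.single (?m e) c"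
      unfolding swap_vars_def using map_key_single[OF inj, of "?m e" c] by (simp add: invol)
    also have "\<dots> = of_int c * Poly_Mapping.single (?m e) 1"
      by (simp add: of_int_eq_single mult_single)
    finally show ?case
      by (simp add: subst_single monom)
  qed (simp add: add subst_add)
qed

interpretation swap_vars: unital_hom "swap_vars i"
  by standard (simp_all add: swap_vars_eq_subst)

lemma swap_vars_Var [simp]: "swap_vars i (Var j) = Var (adj i j)"
  by (simp add: swap_vars_eq_subst)

lemma swap_vars_swap_vars [simp]: "swap_vars i (swap_vars i f) = f"
  by (induction f rule: zpoly_induct) simp_all

lemma swap_vars_commute:
  assumes "i \<noteq> Suc j" "j \<noteq> Suc i"
  shows "swap_vars i (swap_vars j f) = swap_vars j (swap_vars i f)"
  using assms
  by (induction f rule: zpoly_induct) (auto simp: Transposition.transpose_def)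

lemma swap_vars_braid:
  "swap_vars i (swap_vars (Suc i) (swap_vars i f)) =
    swap_vars (Suc i) (swap_vars i (swap_vars (Suc i) f))"
  by (induction f rule: zpoly_induct) (auto simp: Transposition.transpose_def)

section \<open>Divided differences\<close>

lemma Var_diff_neq_0: "i \<noteq> j \<Longrightarrow> Var i - Var j \<noteq> 0"
  by simp

text \<open>The twisted Leibniz rule does the work: quotients a for f and b for g combine to a * g +
  s_i f * b for f * g, so only constants and single variables are divided by hand.\<close>

lemma divided_diff_exists: "\<exists>g. g * (Var i - Var (Suc i)) = f - swap_vars i f"
proof (induction f rule: zpoly_induct)
  case (int c)
  show ?case by (intro exI[of _ 0]) simp
next
  case (Var j)
  show ?case
  proof (cases "j = i \<or> j = Suc i")
    case True
    then show ?thesis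
      by (auto intro: exI[of _ 1] exI[of _ "-1"])
  qed (auto intro!: exI[of _ 0])
next
  case (add f g)
  then obtain a b where "a * (Var i - Var (Suc i)) = f - swap_vars i f"
    "b * (Var i - Var (Suc i)) = g - swap_vars i g" by blast
  then show ?case by (intro exI[of _ "a + b"]) (simp add: distrib_right)
next
  case (mult f g)
  then obtain a b where "a * (Var i - Var (Suc i)) = f - swap_vars i f"
    "b * (Var i - Var (Suc i)) = g - swap_vars i g" by blast
  note ab = this
  have "(a * g + swap_vars i f * b) * (Var i - Var (Suc i)) =
      (a * (Var i - Var (Suc i))) * g + swap_vars i f * (b * (Var i - Var (Suc i)))"
    by (simp add: algebra_simps)
  also have "\<dots> = f * g - swap_vars i (f * g)"
    unfolding ab by (simp add: algebra_simps)
  finally have "(a * g + swap_vars i f * b) * (Var i - Var (Suc i)) = f * g - swap_vars i (f * g)" .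
  then show ?case ..
qed

lemma divided_diff_mult: "divided_diff i f * (Var i - Var (Suc i)) = f - swap_vars i f"
proof -
  have "\<exists>!g. g * (Var i - Var (Suc i)) = f - swap_vars i f"
    using divided_diff_exists[of i f] Var_diff_neq_0[of i "Suc i"]
    by (metis mult_right_cancel n_not_Suc_n)
  from theI'[OF this] show ?thesis unfolding divided_diff_def by simp
qed

lemma divided_diff_unique:
  "g * (Var i - Var (Suc i)) = f - swap_vars i f \<Longrightarrow> divided_diff i f = g"
  using divided_diff_mult[of i f] Var_diff_neq_0[of i "Suc i"]
  by (metis mult_right_cancel n_not_Suc_n)

lemma divided_diff_add [simp]: "divided_diff i (f + g) = divided_diff i f + divided_diff i g"
  by (rule divided_diff_unique) (simp add: distrib_right divided_diff_mult)

lemma divided_diff_leibniz: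
  "divided_diff i (f * g) = divided_diff i f * g + swap_vars i f * divided_diff i g"
proof (rule divided_diff_unique)
  have "(divided_diff i f * g + swap_vars i f * divided_diff i g) * (Var i - Var (Suc i)) =
      (divided_diff i f * (Var i - Var (Suc i))) * g +
      swap_vars i f * (divided_diff i g * (Var i - Var (Suc i)))"
    by (simp add: algebra_simps)
  also have "\<dots> = f * g - swap_vars i (f * g)"
    unfolding divided_diff_mult by (simp add: algebra_simps)
  finally show "(divided_diff i f * g + swap_vars i f * divided_diff i g) * (Var i - Var (Suc i)) =
      f * g - swap_vars i (f * g)" .
qed

lemma divided_diff_eq_0: "swap_vars i f = f \<Longrightarrow> divided_diff i f = 0"
  by (rule divided_diff_unique) simp

lemma divided_diff_0 [simp]: "divided_diff i 0 = 0"
  by (rule divided_diff_eq_0) simp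

lemma divided_diff_of_int [simp]: "divided_diff i (of_int c) = 0"
  by (rule divided_diff_eq_0) simp

lemma divided_diff_Var:
  "divided_diff i (Var j) = (if j = i then 1 else if j = Suc i then -1 else 0)"
  by (rule divided_diff_unique) auto

lemma divided_diff_mult_symmetric_left:
  "swap_vars i f = f \<Longrightarrow> divided_diff i (f * g) = f * divided_diff i g"
  by (simp add: divided_diff_leibniz divided_diff_eq_0)

lemma divided_diff_mult_symmetric_right:
  "swap_vars i g = g \<Longrightarrow> divided_diff i (f * g) = divided_diff i f * g"
  by (simp add: divided_diff_leibniz divided_diff_eq_0)

lemma swap_vars_divided_diff [simp]: "swap_vars i (divided_diff i f) = divided_diff i f"
proof -
  have "swap_vars i (divided_diff i f * (Var i - Var (Suc i))) = swap_vars i (f - swap_vars i f)"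
    by (simp only: divided_diff_mult)
  then have "swap_vars i (divided_diff i f) * (Var (Suc i) - Var i) = swap_vars i f - f"
    by simp
  then have "swap_vars i (divided_diff i f) * (Var i - Var (Suc i)) = f - swap_vars i f"
    by (simp add: algebra_simps)
  from divided_diff_unique[OF this] show ?thesis ..
qed

lemma swap_vars_divided_diff_far:
  assumes "i \<noteq> j" "i \<noteq> Suc j" "j \<noteq> Suc i"
  shows "swap_vars i (divided_diff j f) = divided_diff j (swap_vars i f)"
proof -
  have "swap_vars i (divided_diff j f * (Var j - Var (Suc j))) = swap_vars i (f - swap_vars j f)"
    by (simp only: divided_diff_mult)
  then have "swap_vars i (divided_diff j f) * (Var j - Var (Suc j)) =
      swap_vars i f - swap_vars j (swap_vars i f)"
    using assms by (simp add: swap_vars_commute)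
  from divided_diff_unique[OF this] show ?thesis ..
qed

lemma divided_diff_commute:
  assumes "i \<noteq> j" "i \<noteq> Suc j" "j \<noteq> Suc i"
  shows "divided_diff i (divided_diff j f) = divided_diff j (divided_diff i f)"
proof (rule divided_diff_unique)
  let ?a = "Var i - Var (Suc i)" and ?b = "Var j - Var (Suc j)"
  let ?d = "divided_diff j (divided_diff i f)"
  have "(?d * ?a) * ?b = (?d * ?b) * ?a"
    by (simp only: mult_ac)
  also have "\<dots> = divided_diff i f * ?a - swap_vars j (divided_diff i f) * ?a"
    by (simp only: divided_diff_mult left_diff_distrib)
  also have "\<dots> = (f - swap_vars i f) - (swap_vars j f - swap_vars i (swap_vars j f))"
    using assms by (simp add: divided_diff_mult swap_vars_divided_diff_far)
  also have "\<dots> = (divided_diff j f - swap_vars i (divided_diff j f)) * ?b"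
    using assms by (simp add: left_diff_distrib divided_diff_mult swap_vars_divided_diff_far swap_vars_commute)
  finally show "?d * ?a = divided_diff j f - swap_vars i (divided_diff j f)"
    using Var_diff_neq_0[of j "Suc j"] by (metis mult_right_cancel n_not_Suc_n)
qed

text \<open>Multiplied by the Vandermonde product of the three variables, both sides become the
  alternating sum \<open>?A\<close> of f over their six permutations, and the product can be
  cancelled.\<close>

lemma divided_diff_braid:
  "divided_diff i (divided_diff (Suc i) (divided_diff i f)) =
    divided_diff (Suc i) (divided_diff i (divided_diff (Suc i) f))"
proof -
  define j where "j = Suc i"
  define x y z where xyz: "x = Var i" "y = Var j" "z = Var (Suc j)"
  have x: "swap_vars i x = y" "swap_vars j x = x"
    and y: "swap_vars i y = x" "swap_vars j y = z"
    and z: "swap_vars i z = z" "swap_vars j z = y"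
    unfolding xyz j_def by (auto simp: Transposition.transpose_def)
  have di: "divided_diff i g * (x - y) = g - swap_vars i g"
    and dj: "divided_diff j g * (y - z) = g - swap_vars j g" for g
    using divided_diff_mult[of i g] divided_diff_mult[of j g] unfolding xyz j_def by simp_all
  have sdi: "swap_vars j (divided_diff i g) * (x - z) = swap_vars j g - swap_vars j (swap_vars i g)"
    and sdj: "swap_vars i (divided_diff j g) * (x - z) = swap_vars i g - swap_vars i (swap_vars j g)"
    for g
    using arg_cong[OF di[of g], of "swap_vars j"] arg_cong[OF dj[of g], of "swap_vars i"]
    by (simp_all add: x y z)
  have ssdi: "swap_vars i (swap_vars j (divided_diff i g)) * (y - z) =
      swap_vars i (swap_vars j g) - swap_vars i (swap_vars j (swap_vars i g))"
    and ssdj: "swap_vars j (swap_vars i (divided_diff j g)) * (x - y) =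
      swap_vars j (swap_vars i g) - swap_vars j (swap_vars i (swap_vars j g))" for g
    using arg_cong[OF sdi[of g], of "swap_vars i"] arg_cong[OF sdj[of g], of "swap_vars j"]
    by (simp_all add: x y z)
  let ?V = "(x - y) * (y - z) * (x - z)"
  let ?A = "f - swap_vars i f - swap_vars j f + swap_vars j (swap_vars i f) +
    swap_vars i (swap_vars j f) - swap_vars i (swap_vars j (swap_vars i f))"
  have "divided_diff i (divided_diff j (divided_diff i f)) * ?V =
      (divided_diff j (divided_diff i f) * (y - z)) * (x - z) -
      (swap_vars i (divided_diff j (divided_diff i f)) * (x - z)) * (y - z)"
    using di[of "divided_diff j (divided_diff i f)"] by algebra
  also have "\<dots> = (divided_diff i f - swap_vars j (divided_diff i f)) * (x - z) -
      (divided_diff i f - swap_vars i (swap_vars j (divided_diff i f))) * (y - z)"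
    unfolding dj sdj by simp
  also have "\<dots> = divided_diff i f * (x - y) - swap_vars j (divided_diff i f) * (x - z) +
      swap_vars i (swap_vars j (divided_diff i f)) * (y - z)"
    by algebra
  also have "\<dots> = ?A"
    unfolding di sdi ssdi by simp
  finally have 1: "divided_diff i (divided_diff j (divided_diff i f)) * ?V = ?A" .
  have "divided_diff j (divided_diff i (divided_diff j f)) * ?V =
      (divided_diff i (divided_diff j f) * (x - y)) * (x - z) -
      (swap_vars j (divided_diff i (divided_diff j f)) * (x - z)) * (x - y)"
    using dj[of "divided_diff i (divided_diff j f)"] by algebra
  also have "\<dots> = (divided_diff j f - swap_vars i (divided_diff j f)) * (x - z) -
      (divided_diff j f - swap_vars j (swap_vars i (divided_diff j f))) * (x - y)"
    unfolding di sdi by simp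
  also have "\<dots> = divided_diff j f * (y - z) - swap_vars i (divided_diff j f) * (x - z) +
      swap_vars j (swap_vars i (divided_diff j f)) * (x - y)"
    by algebra
  also have "\<dots> = ?A"
    unfolding dj sdj ssdj using swap_vars_braid[of i f] by (simp add: j_def)
  finally have 2: "divided_diff j (divided_diff i (divided_diff j f)) * ?V = ?A" .
  have "?V \<noteq> 0"
    unfolding xyz j_def by (simp add: Var_diff_neq_0)
  then show ?thesis
    using 1 2 unfolding j_def[symmetric] by (metis mult_right_cancel)
qed

section \<open>Polynomials in finitely many variables\<close>

inductive_set polys :: "nat \<Rightarrow> zpoly set" for n :: nat where
  of_int [intro, simp]: "of_int c \<in> polys n"
| Var: "1 \<le> i \<Longrightarrow> i \<le> n \<Longrightarrow> Var i \<in> polys n"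
| add [intro]: "f \<in> polys n \<Longrightarrow> g \<in> polys n \<Longrightarrow> f + g \<in> polys n"
| mult [intro]: "f \<in> polys n \<Longrightarrow> g \<in> polys n \<Longrightarrow> f * g \<in> polys n"

lemma polys_0 [simp]: "0 \<in> polys n" and polys_1 [simp]: "1 \<in> polys n"
  using polys.of_int[of 0 n] polys.of_int[of 1 n] by simp_all

lemma polys_uminus: "f \<in> polys n \<Longrightarrow> - f \<in> polys n"
  using polys.mult[OF polys.of_int[of "-1"], of f n] by simp

lemma polys_diff [intro]: "f \<in> polys n \<Longrightarrow> g \<in> polys n \<Longrightarrow> f - g \<in> polys n"
  using polys.add[OF _ polys_uminus, of f n g] by simp

lemma polys_power [intro]: "f \<in> polys n \<Longrightarrow> f ^ k \<in> polys n"
  by (induction k) auto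

lemma polys_sum: "(\<And>a. a \<in> A \<Longrightarrow> f a \<in> polys n) \<Longrightarrow> sum f A \<in> polys n"
  by (induction A rule: infinite_finite_induct) auto

lemma polys_prod: "(\<And>a. a \<in> A \<Longrightarrow> f a \<in> polys n) \<Longrightarrow> prod f A \<in> polys n"
  by (induction A rule: infinite_finite_induct) auto

lemma polys_mono:
  assumes "m \<le> n" "f \<in> polys m"
  shows "f \<in> polys n"
  using assms(2,1) by (induction rule: polys.induct) (auto intro!: polys.Var)

lemma polys_zero_variables: "f \<in> polys 0 \<Longrightarrow> \<exists>c. f = of_int c"
  by (induction rule: polys.induct)
    (auto simp flip: of_int_add of_int_mult)

lemma swap_vars_in_polys: "f \<in> polys n \<Longrightarrow> 1 \<le> i \<Longrightarrow> i < n \<Longrightarrow> swap_vars i f \<in> polys n"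
  by (induction rule: polys.induct) (auto intro!: polys.Var simp: Transposition.transpose_def)

lemma swap_vars_polys: "f \<in> polys n \<Longrightarrow> n < i \<Longrightarrow> swap_vars i f = f"
  by (induction rule: polys.induct) auto

lemma divided_diff_in_polys: "f \<in> polys n \<Longrightarrow> 1 \<le> i \<Longrightarrow> i < n \<Longrightarrow> divided_diff i f \<in> polys n"
proof (induction rule: polys.induct)
  case (Var j)
  show ?case using polys.of_int[of "-1" n] by (simp add: divided_diff_Var)
qed (auto simp del: One_nat_def simp: divided_diff_leibniz intro!: swap_vars_in_polys)

text \<open>The swapped polynomial has x_{n+2} in place of x_{n+1}, so setting x_{n+1} to 0 fixes
  it. By symmetry it is f, whose image under this substitution lies in
  \<open>polys n\<close>.\<close>

lemma polys_drop_variable: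
  assumes f: "f \<in> polys (Suc n)" and sym: "swap_vars (Suc n) f = f"
  shows "f \<in> polys n"
proof -
  let ?h = "subst (\<lambda>j. if j = Suc n then 0 else Var j)"
  from f have "?h (swap_vars (Suc n) f) = swap_vars (Suc n) f"
    by (induction rule: polys.induct) (auto simp: Transposition.transpose_def)
  moreover from f have "?h f \<in> polys n"
    by (induction rule: polys.induct) (auto intro: polys.Var)
  ultimately show ?thesis using sym by simp
qed

section \<open>Homogeneous polynomials and constant terms\<close>

inductive homogeneous :: "nat \<Rightarrow> zpoly \<Rightarrow> bool" where
  zero: "homogeneous d 0"
| of_int: "homogeneous 0 (of_int c)"
| Var: "homogeneous (Suc 0) (Var i)"
| add: "homogeneous d f \<Longrightarrow> homogeneous d g \<Longrightarrow> homogeneous d (f + g)"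
| mult: "homogeneous d f \<Longrightarrow> homogeneous d' g \<Longrightarrow> homogeneous (d + d') (f * g)"

lemma homogeneous_power: "homogeneous d f \<Longrightarrow> homogeneous (k * d) (f ^ k)"
  using homogeneous.of_int[of 1] by (induction k) (auto intro: homogeneous.mult)

lemma homogeneous_prod:
  "finite A \<Longrightarrow> (\<And>a. a \<in> A \<Longrightarrow> homogeneous (d a) (f a)) \<Longrightarrow> homogeneous (sum d A) (prod f A)"
  by (induction A rule: finite_induct)
    (use homogeneous.of_int[of 1] in \<open>auto intro: homogeneous.mult\<close>)

lemma homogeneous_swap_vars: "homogeneous d f \<Longrightarrow> homogeneous d (swap_vars i f)"
  by (induction rule: homogeneous.induct) (auto intro: homogeneous.intros)

text \<open>The first conjunct guards against truncated subtraction: when a factor has degree 0, its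
  Leibniz term has the right degree only because it vanishes.\<close>

lemma homogeneous_divided_diff:
  "homogeneous d f \<Longrightarrow> (d = 0 \<longrightarrow> divided_diff i f = 0) \<and> homogeneous (d - 1) (divided_diff i f)"
proof (induction rule: homogeneous.induct)
  case (Var j)
  show ?case
    using homogeneous.of_int[of 1] homogeneous.of_int[of "-1"]
    by (auto simp: divided_diff_Var intro: homogeneous.zero)
next
  case (mult d f d' g)
  have "homogeneous (d + d' - 1) (divided_diff i f * g)"
  proof (cases "d = 0")
    case False
    then show ?thesis using homogeneous.mult[of "d - 1" "divided_diff i f" d' g] mult by simp
  qed (use mult in \<open>auto intro: homogeneous.zero\<close>)
  moreover have "homogeneous (d + d' - 1) (swap_vars i f * divided_diff i g)"
  proof (cases "d' = 0")
    case False
    then show ?thesis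
      using homogeneous.mult[OF homogeneous_swap_vars, of d f "d' - 1" "divided_diff i g" i] mult
      by simp
  qed (use mult in \<open>auto intro: homogeneous.zero\<close>)
  ultimately show ?case
    using mult by (auto simp: divided_diff_leibniz intro: homogeneous.add)
qed (auto intro: homogeneous.intros)

definition const_term :: "zpoly \<Rightarrow> int" where
  "const_term = subst (\<lambda>_. 0)"

interpretation const_term: unital_hom const_term
  unfolding const_term_def by standard simp_all

lemma const_term_Var [simp]: "const_term (Var i) = 0"
  by (simp add: const_term_def)

lemma const_term_homogeneous: "homogeneous d f \<Longrightarrow> 0 < d \<Longrightarrow> const_term f = 0"
  by (induction rule: homogeneous.induct) auto

section \<open>Iterated divided differences and Newton quotients\<close>

interpretation poly_eval: unital_hom "\<lambda>p. poly p a" for a :: "'a::comm_ring_1"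
  by standard simp_all

definition univariate :: "nat \<Rightarrow> zpoly \<Rightarrow> zpoly poly" where
  "univariate n = subst (\<lambda>j. if j = n then [:0, 1:] else [:Var j:])"

interpretation univariate: unital_hom "univariate n"
  unfolding univariate_def by standard simp_all

lemma univariate_Var: "univariate n (Var j) = (if j = n then [:0, 1:] else [:Var j:])"
  by (simp add: univariate_def)

lemma poly_univariate [simp]: "poly (univariate n f) (Var n) = f"
  by (induction f rule: zpoly_induct) (simp_all add: univariate_Var)

lemma univariate_polys: "f \<in> polys m \<Longrightarrow> m < n \<Longrightarrow> univariate n f = [:f:]"
  by (induction rule: polys.induct) (auto simp: univariate_Var of_int_poly)

lemma coeff_univariate_polys:
  "f \<in> polys (Suc n) \<Longrightarrow> coeff (univariate (Suc n) f) k \<in> polys n"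
proof (induction arbitrary: k rule: polys.induct)
  case (of_int c)
  show ?case by (cases k) (simp_all add: of_int_poly)
next
  case (Var i)
  then show ?case
    by (cases k) (auto simp: univariate_Var coeff_pCons intro: polys.Var split: nat.split)
qed (auto simp: coeff_mult intro!: polys_sum)

lemma poly_in_polys:
  assumes "\<And>k. coeff p k \<in> polys n" "a \<in> polys n"
  shows "poly p a \<in> polys n"
  unfolding poly_altdef using assms by (intro polys_sum) auto

lemma coeff_synthetic_div_polys:
  "(\<And>k. coeff p k \<in> polys n) \<Longrightarrow> a \<in> polys n \<Longrightarrow> coeff (synthetic_div p a) k \<in> polys n"
proof (induction p arbitrary: k)
  case (pCons c p)
  have "coeff p k \<in> polys n" for k
    using pCons.prems(1)[of "Suc k"] by simp
  then show ?case
    using pCons by (auto simp: coeff_pCons intro: poly_in_polys split: nat.split)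
qed simp

section \<open>Synthetic division and Newton quotients\<close>

lemma coeff_synthetic_div:
  assumes "degree p \<le> Suc d"
  shows "coeff (synthetic_div p a) d = coeff p (Suc d)"
proof -
  have "coeff (synthetic_div p a) (Suc d) = 0"
    using assms by (intro coeff_eq_0) (simp add: degree_synthetic_div)
  then show ?thesis
    using arg_cong[OF synthetic_div_correct[of p a], of "\<lambda>q. coeff q (Suc d)"] by simp
qed

lemma synthetic_div_add: "synthetic_div (p + q) a = synthetic_div p a + synthetic_div q a"
proof -
  have "p + q + smult a (synthetic_div p a + synthetic_div q a) =
      (p + smult a (synthetic_div p a)) + (q + smult a (synthetic_div q a))"
    by (simp add: smult_add_right algebra_simps)
  also have "\<dots> = pCons (poly p a + poly q a) (synthetic_div p a + synthetic_div q a)"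
    by (simp add: synthetic_div_correct)
  finally show ?thesis
    using synthetic_div_unique by metis
qed

lemma synthetic_div_smult: "synthetic_div (smult c p) a = smult c (synthetic_div p a)"
  by (induction p) simp_all

lemma synthetic_div_cancel: "synthetic_div ([:- a, 1:] * p) a = p"
  for a :: "'a::comm_ring_1"
proof -
  have "[:- a, 1:] * p + smult a p = pCons 0 p"
    by simp
  then show ?thesis using synthetic_div_unique by metis
qed

text \<open>\<open>synthetic_div p a\<close> is (p(X) - p(a)) / (X - a), so this is the classical
  divided difference p[x_n, ..., x_{n+j-1}, X] as a polynomial in its last argument.\<close>

primrec newton :: "nat \<Rightarrow> nat \<Rightarrow> zpoly poly \<Rightarrow> zpoly poly" where
  "newton n 0 p = p"
| "newton n (Suc j) p = synthetic_div (newton n j p) (Var (n + j))"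

primrec divided_diffs :: "nat \<Rightarrow> nat \<Rightarrow> zpoly \<Rightarrow> zpoly" where
  "divided_diffs n 0 f = f"
| "divided_diffs n (Suc j) f = divided_diff (n + j) (divided_diffs n j f)"

lemma newton_add: "newton n j (p + q) = newton n j p + newton n j q"
  by (induction j) (simp_all add: synthetic_div_add)

lemma newton_smult: "newton n j (smult c p) = smult c (newton n j p)"
  by (induction j) (simp_all add: synthetic_div_smult)

lemma newton_0 [simp]: "newton n j 0 = 0"
  by (induction j) simp_all

lemma newton_sum: "newton n j (sum p A) = (\<Sum>a\<in>A. newton n j (p a))"
  by (induction A rule: infinite_finite_induct) (simp_all add: newton_add)

lemma newton_newton: "newton (n + i) j (newton n i p) = newton n (i + j) p"
  by (induction j) (simp_all add: add.assoc)

lemma newton_cancel: "newton n j ((\<Prod>i<j. [:- Var (n + i), 1:]) * p) = p"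
proof (induction j arbitrary: p)
  case (Suc j)
  have "(\<Prod>i<Suc j. [:- Var (n + i), 1:]) * p =
      (\<Prod>i<j. [:- Var (n + i), 1:]) * ([:- Var (n + j), 1:] * p)"
    by (simp only: prod.lessThan_Suc mult_ac)
  then show ?case
    by (simp only: newton.simps Suc.IH synthetic_div_cancel)
qed simp

lemma degree_newton: "degree (newton n j p) = degree p - j"
  by (induction j) (simp_all add: degree_synthetic_div)

lemma coeff_newton: "degree p \<le> j + d \<Longrightarrow> coeff (newton n j p) d = coeff p (j + d)"
  by (induction j arbitrary: d) (simp_all add: coeff_synthetic_div degree_newton)

lemma coeff_newton_polys:
  assumes "\<And>k. coeff p k \<in> polys n"
  shows "coeff (newton (Suc n) j p) k \<in> polys (n + j)"
proof (induction j arbitrary: k)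
  case (Suc j)
  have "coeff (newton (Suc n) j p) k \<in> polys (Suc (n + j))" for k
    by (rule polys_mono[OF _ Suc]) simp
  moreover have "Var (Suc n + j) \<in> polys (Suc (n + j))"
    by (rule polys.Var) simp_all
  ultimately show ?case by (simp add: coeff_synthetic_div_polys)
qed (simp add: assms)

text \<open>The coefficients of the j-th quotient Q involve only x_1, ..., x_{n+j}, so the next
  exchange acts on the evaluation point alone. The divided difference is then (Q(b) - Q(a)) / (b -
  a), the next quotient evaluated at b.\<close>

lemma divided_diffs_eq_newton:
  assumes "f \<in> polys (Suc n)"
  shows "divided_diffs (Suc n) j f = poly (newton (Suc n) j (univariate (Suc n) f)) (Var (Suc n + j))"
proof (induction j)
  case (Suc j)
  let ?Q = "newton (Suc n) j (univariate (Suc n) f)"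
  let ?a = "Var (Suc n + j)" and ?b = "Var (Suc (Suc n + j))"
  have "swap_vars (Suc n + j) (coeff ?Q k) = coeff ?Q k" for k
    using coeff_newton_polys[OF coeff_univariate_polys[OF assms]] by (rule swap_vars_polys) simp
  then have "swap_vars (Suc n + j) (poly ?Q ?a) = poly ?Q ?b"
    by (simp add: poly_altdef)
  moreover have "(?b - ?a) * poly (synthetic_div ?Q ?a) ?b + poly ?Q ?a = poly ?Q ?b"
    using arg_cong[OF synthetic_div_correct'[of ?a ?Q], of "\<lambda>q. poly q ?b"]
    by (simp add: algebra_simps)
  ultimately have "divided_diff (Suc n + j) (poly ?Q ?a) = poly (synthetic_div ?Q ?a) ?b"
    by (intro divided_diff_unique) (simp add: algebra_simps)
  then show ?case using Suc by simp
qed simp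

lemma univariate_poly:
  assumes "\<And>k. coeff p k \<in> polys n" "n < m"
  shows "univariate m (poly p (Var m)) = p"
proof -
  have "univariate m (poly p (Var m)) = (\<Sum>i\<le>degree p. [:coeff p i:] * [:0, 1:] ^ i)"
    by (simp add: poly_altdef univariate_polys[OF assms] univariate_Var)
  also have "\<dots> = p"
    using poly_as_sum_of_monoms[of p] by (simp add: monom_altdef)
  finally show ?thesis .
qed

text \<open>Evaluating at the fresh variable x_{n+k+2} loses nothing, so a vanishing value forces
  the Newton quotient itself to vanish; synthetic division yields 0 only on constants.\<close>

lemma degree_univariate_le:
  assumes "f \<in> polys (Suc n)" "divided_diffs (Suc n) (Suc k) f = 0"
  shows "degree (univariate (Suc n) f) \<le> k"
proof -
  let ?p = "univariate (Suc n) f"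
  have "newton (Suc n) (Suc k) ?p = univariate (Suc n + Suc k) (divided_diffs (Suc n) (Suc k) f)"
    unfolding divided_diffs_eq_newton[OF assms(1)]
    using coeff_newton_polys[OF coeff_univariate_polys[OF assms(1)]]
    by (rule univariate_poly[symmetric]) simp
  also have "\<dots> = 0" using assms(2) by simp
  finally have "degree (newton (Suc n) k ?p) = 0"
    by (simp add: synthetic_div_eq_0_iff)
  then show ?thesis by (simp add: degree_newton)
qed

text \<open>After k divisions only a constant is left, and synthetic division preserves the top
  coefficient.\<close>

lemma divided_diffs_top:
  assumes "f \<in> polys (Suc n)" "degree (univariate (Suc n) f) \<le> k"
  shows "divided_diffs (Suc n) k f = coeff (univariate (Suc n) f) k"
proof -
  let ?q = "newton (Suc n) k (univariate (Suc n) f)"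
  have "degree ?q = 0"
    using assms(2) by (simp add: degree_newton)
  then obtain c where c: "?q = [:c:]"
    by (rule degree_eq_zeroE)
  moreover have "coeff ?q 0 = coeff (univariate (Suc n) f) k"
    using coeff_newton[of "univariate (Suc n) f" k 0] assms(2) by simp
  ultimately show ?thesis
    by (simp add: divided_diffs_eq_newton[OF assms(1)])
qed

section \<open>Lehmer codes\<close>

text \<open>The code of \<open>w \<circ> adj i\<close> when \<open>w\<close> ascends at i: the two
  entries trade places and the inversion between i and i + 1 is added. \<open>code_down\<close> is
  the change at a descent.\<close>

definition code_up :: "nat \<Rightarrow> (nat \<Rightarrow> nat) \<Rightarrow> nat \<Rightarrow> nat" where
  "code_up i \<gamma> = \<gamma>(i := Suc (\<gamma> (Suc i)), Suc i := \<gamma> i)"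

definition code_down :: "nat \<Rightarrow> (nat \<Rightarrow> nat) \<Rightarrow> nat \<Rightarrow> nat" where
  "code_down i \<gamma> = \<gamma>(i := \<gamma> (Suc i), Suc i := \<gamma> i - 1)"

lemma code_up_down: "\<gamma> (Suc i) < \<gamma> i \<Longrightarrow> code_up i (code_down i \<gamma>) = \<gamma>"
  by (auto simp: code_up_def code_down_def)

lemma code_down_up: "code_down i (code_up i \<gamma>) = \<gamma>"
  by (auto simp: code_up_def code_down_def)

lemma finite_inversions: "inj w \<Longrightarrow> finite {j. j > i \<and> w j < (k::nat)}" for w :: "nat \<Rightarrow> nat"
  by (rule finite_subset[of _ "w -` {..<k}"]) (auto intro: finite_vimageI)

lemma comp_adj_adj: "w \<circ> adj i \<circ> adj i = w"
  by (simp add: fun_eq_iff)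

lemma inj_comp_adj: "inj w \<Longrightarrow> inj (w \<circ> adj i)"
  by (simp add: inj_compose)

lemma lehmer_code_ascent:
  assumes w: "inj w" and asc: "w i < w (Suc i)"
  shows "lehmer_code (w \<circ> adj i) = code_up i (lehmer_code w)"
proof
  fix l
  consider "l = i" | "l = Suc i" | "l \<noteq> i" "l \<noteq> Suc i" by blast
  then show "lehmer_code (w \<circ> adj i) l = code_up i (lehmer_code w) l"
  proof cases
    case 1
    have "{j. j > i \<and> (w \<circ> adj i) j < (w \<circ> adj i) i} =
        insert (Suc i) {j. j > Suc i \<and> w j < w (Suc i)}"
      using asc by (auto simp: Transposition.transpose_def split: if_splits)
    then show ?thesis
      using finite_inversions[OF w] by (simp add: 1 lehmer_code_def code_up_def)
  next
    case 2
    have "{j. j > Suc i \<and> (w \<circ> adj i) j < (w \<circ> adj i) (Suc i)} = {j. j > i \<and> w j < w i}"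
      using asc
      by (auto simp: Transposition.transpose_def split: if_splits)
    then show ?thesis by (simp add: 2 lehmer_code_def code_up_def)
  next
    case 3
    have "{j. j > l \<and> (w \<circ> adj i) j < (w \<circ> adj i) l} = adj i ` {j. j > l \<and> w j < w l}"
    proof (intro equalityI subsetI)
      fix j assume "j \<in> {j. j > l \<and> (w \<circ> adj i) j < (w \<circ> adj i) l}"
      then have "adj i j \<in> {j. j > l \<and> w j < w l}"
        using 3 by (auto simp: Transposition.transpose_def split: if_splits)
      then show "j \<in> adj i ` {j. j > l \<and> w j < w l}"
        by (metis image_eqI transpose_involutory)
    qed (use 3 in \<open>auto simp: Transposition.transpose_def split: if_splits\<close>)
    then show ?thesis
      using 3 by (simp add: lehmer_code_def code_up_def card_image)
  qed
qed

text \<open>At an ascent the inversions of i are among those of i + 1; at a descent the inclusion is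
  reversed and i + 1 itself is one more. Hence descents can be read from the code.\<close>

lemma ascent_iff:
  assumes w: "inj w"
  shows "w i < w (Suc i) \<longleftrightarrow> lehmer_code w i \<le> lehmer_code w (Suc i)"
proof
  assume asc: "w i < w (Suc i)"
  then have "{j. j > i \<and> w j < w i} \<subseteq> {j. j > Suc i \<and> w j < w (Suc i)}"
    by auto (metis Suc_lessI not_less_iff_gr_or_eq)
  then show "lehmer_code w i \<le> lehmer_code w (Suc i)"
    unfolding lehmer_code_def using finite_inversions[OF w] by (rule card_mono[rotated])
next
  assume le: "lehmer_code w i \<le> lehmer_code w (Suc i)"
  show "w i < w (Suc i)"
  proof (rule ccontr)
    assume "\<not> w i < w (Suc i)"
    then have desc: "w (Suc i) < w i"
      using w by (metis injD linorder_neqE_nat n_not_Suc_n)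
    have "Suc (lehmer_code w (Suc i)) = card (insert (Suc i) {j. j > Suc i \<and> w j < w (Suc i)})"
      using finite_inversions[OF w] by (simp add: lehmer_code_def)
    also have "\<dots> \<le> lehmer_code w i"
      unfolding lehmer_code_def using finite_inversions[OF w] desc by (intro card_mono) auto
    finally show False using le by simp
  qed
qed

lemma descent_iff:
  assumes w: "inj w"
  shows "w (Suc i) < w i \<longleftrightarrow> lehmer_code w (Suc i) < lehmer_code w i"
proof -
  have "w i \<noteq> w (Suc i)" using injD[OF w] by fastforce
  then show ?thesis using ascent_iff[OF w, of i] by linarith
qed

lemma lehmer_code_descent:
  assumes w: "inj w" and desc: "w (Suc i) < w i"
  shows "lehmer_code (w \<circ> adj i) = code_down i (lehmer_code w)"
proof -
  have "lehmer_code (w \<circ> adj i \<circ> adj i) = code_up i (lehmer_code (w \<circ> adj i))"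
    using desc by (intro lehmer_code_ascent inj_comp_adj w) simp
  then show ?thesis by (simp add: comp_adj_adj code_down_up)
qed

lemma permutes_comp_adj:
  "w permutes {1..m} \<Longrightarrow> 1 \<le> i \<Longrightarrow> i < m \<Longrightarrow> (w \<circ> adj i) permutes {1..m}"
  by (intro permutes_compose permutes_swap_id) auto

lemma descent_range:
  assumes w: "w permutes {1..m}" and desc: "w (Suc i) < w i"
  shows "1 \<le> i" "i < m"
proof -
  show "1 \<le> i"
    using desc permutes_not_in[OF w, of 0] by (cases i) auto
  show "i < m"
  proof (rule ccontr)
    assume "\<not> i < m"
    moreover from this have "w (Suc i) = Suc i"
      by (intro permutes_not_in[OF w]) simp
    moreover have "w i \<le> i"
      using permutes_not_in[OF w, of i] permutes_in_image[OF w, of i] \<open>\<not> i < m\<close>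
      by (cases "i \<in> {1..m}") auto
    ultimately show False using desc by simp
  qed
qed

lemma permutes_mono: "w permutes {1..m} \<Longrightarrow> m \<le> n \<Longrightarrow> w permutes {1..n}" for m n :: nat
  by (rule permutes_subset) auto

section \<open>Codes of bounded support and the bijection with permutations\<close>

definition codes :: "nat \<Rightarrow> (nat \<Rightarrow> nat) set" where
  "codes n = {\<gamma>. \<forall>i. \<gamma> i \<noteq> 0 \<longrightarrow> 1 \<le> i \<and> i \<le> n}"

text \<open>These are the codes of S_m, by \<open>lehmer_code_box\<close> and
  \<open>lehmer_code_surj\<close>. The additive form avoids truncated subtraction and makes entries
  beyond m vanish.\<close>

definition box :: "nat \<Rightarrow> (nat \<Rightarrow> nat) set" where
  "box m = {\<gamma>. \<forall>i. \<gamma> i \<noteq> 0 \<longrightarrow> 1 \<le> i \<and> \<gamma> i + i \<le> m}"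

text \<open>On \<open>box m\<close> this is the length of the permutation.\<close>

definition code_size :: "nat \<Rightarrow> (nat \<Rightarrow> nat) \<Rightarrow> nat" where
  "code_size m \<gamma> = (\<Sum>i=1..m. \<gamma> i)"

lemma codes_mono: "\<gamma> \<in> codes m \<Longrightarrow> m \<le> n \<Longrightarrow> \<gamma> \<in> codes n"
  by (auto simp: codes_def) (meson le_trans)

lemma box_subset_codes: "\<gamma> \<in> box m \<Longrightarrow> \<gamma> \<in> codes m"
  by (auto simp: codes_def box_def) (metis add_leD2)

lemma codes_box:
  assumes "\<gamma> \<in> codes n" shows "\<exists>m. \<gamma> \<in> box m"
proof
  have "\<gamma> i \<le> sum \<gamma> {..n}" if "i \<le> n" for i
    using that by (intro member_le_sum) auto
  then show "\<gamma> \<in> box (sum \<gamma> {..n} + n)"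
    using assms by (auto simp: codes_def box_def add_mono)
qed

lemma code_down_box: "\<gamma> \<in> box m \<Longrightarrow> 1 \<le> i \<Longrightarrow> \<gamma> (Suc i) < \<gamma> i \<Longrightarrow> code_down i \<gamma> \<in> box m"
  by (auto simp: box_def code_down_def) (metis Suc_leD add_Suc_right not_less_zero)+

lemma code_down_codes:
  assumes "\<gamma> \<in> codes n" "1 \<le> i" "i < n" shows "code_down i \<gamma> \<in> codes n"
  using assms by (auto simp: codes_def code_down_def)

lemma code_up_codes:
  assumes "\<gamma> \<in> codes n" "1 \<le> i" "i < n" shows "code_up i \<gamma> \<in> codes n"
  using assms by (auto simp: codes_def code_up_def)

lemma code_size_up:
  assumes "1 \<le> i" "i < m"
  shows "code_size m (code_up i \<gamma>) = Suc (code_size m \<gamma>)"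
proof -
  let ?A = "{1..m} - {i, Suc i}"
  have "{1..m} = insert i (insert (Suc i) ?A)" using assms by auto
  then have *: "code_size m g = g i + (g (Suc i) + sum g ?A)" for g
    unfolding code_size_def
    by (metis (no_types, lifting) DiffE finite_Diff finite_atLeastAtMost finite_insert insertCI
        insertE n_not_Suc_n sum.insert)
  have "sum (code_up i \<gamma>) ?A = sum \<gamma> ?A"
    by (rule sum.cong) (auto simp: code_up_def)
  then show ?thesis
    unfolding *[of "code_up i \<gamma>"] *[of \<gamma>] by (simp add: code_up_def)
qed

lemma code_size_down:
  "1 \<le> i \<Longrightarrow> i < m \<Longrightarrow> \<gamma> (Suc i) < \<gamma> i \<Longrightarrow> code_size m \<gamma> = Suc (code_size m (code_down i \<gamma>))"
  using code_size_up[of i m "code_down i \<gamma>"] by (simp add: code_up_down)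

lemma codes_eq_0: "\<gamma> \<in> codes n \<Longrightarrow> i \<notin> {1..n} \<Longrightarrow> \<gamma> i = 0"
  unfolding codes_def by (metis (mono_tags, lifting) atLeastAtMost_iff mem_Collect_eq)

lemma code_size_0_iff:
  assumes "\<gamma> \<in> codes m" shows "code_size m \<gamma> = 0 \<longleftrightarrow> \<gamma> = (\<lambda>_. 0)"
proof
  assume "code_size m \<gamma> = 0"
  then have *: "\<gamma> i = 0" if "i \<in> {1..m}" for i
    unfolding code_size_def using that by (metis finite_atLeastAtMost sum_eq_0_iff)
  show "\<gamma> = (\<lambda>_. 0)"
  proof
    fix i show "\<gamma> i = 0"
      using *[of i] codes_eq_0[OF assms, of i] by blast
  qed
qed (simp add: code_size_def)

lemma lehmer_code_box:
  assumes w: "w permutes {1..m}" shows "lehmer_code w \<in> box m"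
  unfolding box_def
proof (intro CollectI allI impI conjI)
  fix i assume nz: "lehmer_code w i \<noteq> 0"
  then obtain j where j: "j > i" "w j < w i"
    unfolding lehmer_code_def by (metis (mono_tags, lifting) card.empty empty_Collect_eq)
  show i: "1 \<le> i"
    using j permutes_not_in[OF w, of 0] by (cases i) auto
  have "w k \<le> m" if "k \<le> m" for k
    using that permutes_in_image[OF w, of k] permutes_not_in[OF w, of k]
    by (cases "k \<in> {1..m}") auto
  moreover have "w k = k" if "k > m" for k
    using that by (intro permutes_not_in[OF w]) auto
  ultimately have *: "k \<le> m" if "k > i" "w k < w i" for k
    using that by (metis leD leI le_trans less_imp_le_nat)
  then have "{j. j > i \<and> w j < w i} \<subseteq> {i<..m}" by auto
  then have "lehmer_code w i \<le> m - i"
    unfolding lehmer_code_def using card_mono[OF finite_greaterThanAtMost] by force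
  moreover have "i < m" using *[OF j] j by simp
  ultimately show "lehmer_code w i + i \<le> m" by simp
qed

text \<open>The last nonzero entry is followed by 0.\<close>

lemma code_descent_exists:
  assumes "\<gamma> \<in> box m" "\<gamma> \<noteq> (\<lambda>_. 0)"
  shows "\<exists>i. 1 \<le> i \<and> i < m \<and> \<gamma> (Suc i) < \<gamma> i"
proof -
  let ?A = "{i. \<gamma> i \<noteq> 0}"
  have "?A \<subseteq> {..m}" using assms by (auto simp: box_def) (metis add_leD2)
  then have fin: "finite ?A" by (rule finite_subset) simp
  moreover have "?A \<noteq> {}" using assms by auto
  ultimately have "\<gamma> (Max ?A) \<noteq> 0" using Max_in by blast
  moreover have "\<gamma> (Suc (Max ?A)) = 0"
    using Max_ge[OF fin, of "Suc (Max ?A)"] by auto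
  moreover have "1 \<le> Max ?A" "\<gamma> (Max ?A) + Max ?A \<le> m"
    using calculation(1) assms(1) by (auto simp: box_def)
  ultimately show ?thesis by (intro exI[of _ "Max ?A"]) auto
qed

lemma lehmer_code_id: "lehmer_code id = (\<lambda>_. 0)"
  by (auto simp: lehmer_code_def)

text \<open>Induction on the length: realise the code lowered at a descent, then exchange positions
  i and i + 1 there to restore the original.\<close>

lemma lehmer_code_surj:
  "\<gamma> \<in> box m \<Longrightarrow> \<exists>w. w permutes {1..m} \<and> lehmer_code w = \<gamma>"
proof (induction "code_size m \<gamma>" arbitrary: \<gamma>)
  case 0
  then show ?case
    by (metis box_subset_codes code_size_0_iff lehmer_code_id permutes_id)
next
  case (Suc k)
  then have "\<gamma> \<noteq> (\<lambda>_. 0)" by (auto simp: code_size_def)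
  then obtain i where i: "1 \<le> i" "i < m" "\<gamma> (Suc i) < \<gamma> i"
    using code_descent_exists Suc.prems by blast
  then have "k = code_size m (code_down i \<gamma>)"
    using Suc.hyps(2) code_size_down by simp
  with Suc.hyps(1) code_down_box[OF Suc.prems i(1,3)]
  obtain w where w: "w permutes {1..m}" "lehmer_code w = code_down i \<gamma>" by blast
  have "w i < w (Suc i)"
    using ascent_iff[OF permutes_inj[OF w(1)], of i] i w(2) by (simp add: code_down_def)
  then have "lehmer_code (w \<circ> adj i) = \<gamma>"
    using lehmer_code_ascent[OF permutes_inj[OF w(1)]] w(2) i by (simp add: code_up_down)
  then show ?case using permutes_comp_adj[OF w(1) i(1,2)] by blast
qed

text \<open>Without inversions both the permutation and its inverse increase strictly, so each is at
  least the identity.\<close>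

lemma lehmer_code_0_id:
  assumes w: "w permutes {1..m}" and 0: "lehmer_code w = (\<lambda>_. 0)"
  shows "w = id"
proof -
  have mono: "strict_mono w"
    unfolding strict_mono_Suc_iff using ascent_iff[OF permutes_inj[OF w]] 0 by simp
  then have "strict_mono (inv w)"
  proof (intro strict_monoI)
    fix i j :: nat assume "i < j"
    then have "w (inv w i) < w (inv w j)" by (simp add: permutes_inverses(1)[OF w])
    then show "inv w i < inv w j" using strict_mono_less[OF mono] by blast
  qed
  from strict_mono_imp_increasing[OF this] have "w i \<le> i" for i
    using permutes_inverses(2)[OF w, of i] by (metis (no_types))
  then show ?thesis
    using strict_mono_imp_increasing[OF mono] by (simp add: fun_eq_iff le_antisym)
qed

lemma lehmer_code_inj:
  assumes "w permutes {1..m}" "w' permutes {1..m}" "lehmer_code w = lehmer_code w'"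
  shows "w = w'"
  using assms
proof (induction "code_size m (lehmer_code w)" arbitrary: w w')
  case 0
  then have "lehmer_code w = (\<lambda>_. 0)"
    by (metis box_subset_codes code_size_0_iff lehmer_code_box)
  then show ?case using 0 lehmer_code_0_id by metis
next
  case (Suc k)
  then have "lehmer_code w \<noteq> (\<lambda>_. 0)" by (auto simp: code_size_def)
  then obtain i where i: "1 \<le> i" "i < m" "lehmer_code w (Suc i) < lehmer_code w i"
    using code_descent_exists Suc.prems lehmer_code_box by blast
  then have d: "w (Suc i) < w i" "w' (Suc i) < w' i"
    using Suc.prems descent_iff permutes_inj by metis+
  note c = lehmer_code_descent[OF permutes_inj[OF Suc.prems(1)] d(1)]
    lehmer_code_descent[OF permutes_inj[OF Suc.prems(2)] d(2)]
  have "w \<circ> adj i = w' \<circ> adj i"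
  proof (rule Suc.hyps(1))
    show "k = code_size m (lehmer_code (w \<circ> adj i))"
      using Suc.hyps(2) c i by (simp add: code_size_down)
  qed (use Suc.prems c i permutes_comp_adj in auto)
  then show ?case by (metis comp_adj_adj)
qed

lemma permsI: "w permutes {1..m} \<Longrightarrow> w \<in> perms"
  by (auto simp: perms_def)

lemma perms_inj: "w \<in> perms \<Longrightarrow> inj w"
  by (auto simp: perms_def intro: permutes_inj)

lemma perms_id [simp]: "id \<in> perms"
  using permutes_id[of "{1..0}"] by (auto simp: perms_def)

lemma perms_eqI:
  assumes "w \<in> perms" "w' \<in> perms" "lehmer_code w = lehmer_code w'"
  shows "w = w'"
proof -
  obtain m m' where "w permutes {1..m}" "w' permutes {1..m'}"
    using assms by (auto simp: perms_def)
  then have "w permutes {1..max m m'}" "w' permutes {1..max m m'}"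
    using permutes_mono max.cobounded1 max.cobounded2 by metis+
  then show ?thesis using assms(3) by (rule lehmer_code_inj)
qed

lemma code_inv_eq: "w \<in> perms \<Longrightarrow> lehmer_code w = \<gamma> \<Longrightarrow> code_inv \<gamma> = w"
  unfolding code_inv_def by (rule the_equality) (auto intro: perms_eqI)

lemma code_inv_box:
  assumes "\<gamma> \<in> box m"
  shows "code_inv \<gamma> permutes {1..m}" "lehmer_code (code_inv \<gamma>) = \<gamma>"
proof -
  obtain w where w: "w permutes {1..m}" "lehmer_code w = \<gamma>"
    using lehmer_code_surj[OF assms] by blast
  then have "code_inv \<gamma> = w" by (intro code_inv_eq permsI)
  with w show "code_inv \<gamma> permutes {1..m}" "lehmer_code (code_inv \<gamma>) = \<gamma>" by simp_all
qed

lemma code_inv_codes: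
  assumes "\<gamma> \<in> codes n"
  shows "code_inv \<gamma> \<in> perms" "lehmer_code (code_inv \<gamma>) = \<gamma>"
proof -
  obtain m where "\<gamma> \<in> box m" using codes_box[OF assms] ..
  then show "code_inv \<gamma> \<in> perms" "lehmer_code (code_inv \<gamma>) = \<gamma>"
    by (auto intro: permsI code_inv_box)
qed

lemma perms_code_exists:
  assumes "w \<in> perms"
  obtains n where "lehmer_code w \<in> codes n" "code_inv (lehmer_code w) = w"
proof -
  obtain m where "w permutes {1..m}" using assms by (auto simp: perms_def)
  then have "lehmer_code w \<in> codes m" by (intro box_subset_codes lehmer_code_box)
  then show thesis by (rule that) (rule code_inv_eq[OF assms refl])
qed

lemma perms_comp_adj:
  assumes "w \<in> perms" "1 \<le> i"
  shows "w \<circ> adj i \<in> perms"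
proof -
  obtain m where "w permutes {1..m}" using assms by (auto simp: perms_def)
  then have "w permutes {1..m + i + 1}" by (rule permutes_mono) simp
  then show ?thesis by (intro permsI[of _ "m + i + 1"] permutes_comp_adj assms) auto
qed

lemma perms_descent_pos: "w \<in> perms \<Longrightarrow> w (Suc i) < w i \<Longrightarrow> 1 \<le> i"
  using descent_range(1) by (auto simp: perms_def)

lemma code_inv_down:
  assumes "\<gamma> \<in> codes n" "\<gamma> (Suc i) < \<gamma> i"
  shows "code_inv (code_down i \<gamma>) = code_inv \<gamma> \<circ> adj i"
    and "code_inv \<gamma> (Suc i) < code_inv \<gamma> i"
proof -
  let ?w = "code_inv \<gamma>"
  have w: "?w \<in> perms" "lehmer_code ?w = \<gamma>"
    using code_inv_codes[OF assms(1)] by auto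
  then show d: "?w (Suc i) < ?w i"
    using assms(2) descent_iff[OF perms_inj] by simp
  show "code_inv (code_down i \<gamma>) = ?w \<circ> adj i"
    using w d perms_comp_adj perms_descent_pos lehmer_code_descent[OF perms_inj]
    by (intro code_inv_eq) auto
qed

section \<open>Schubert polynomials are well defined\<close>

text \<open>
  Schubert values reached inside a single group \<open>S\<^sub>m\<close>. Two ways into the same permutation are
  reconciled by going up to a common ancestor, using commutation or the braid relation.
\<close>

inductive chain :: "nat \<Rightarrow> (nat \<Rightarrow> nat) \<Rightarrow> zpoly \<Rightarrow> bool" for m where
  longest: "chain m (longest m) (\<Prod>i=1..m. Var i ^ (m - i))"
| descent: "chain m w f \<Longrightarrow> w (Suc i) < w i \<Longrightarrow> chain m (w \<circ> adj i) (divided_diff i f)"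

lemma longest_permutes: "longest m permutes {1..m}"
proof -
  have "longest m (longest m x) = x" for x
    by (auto simp: longest_def)
  then have "\<exists>!x. longest m x = y" for y by metis
  then show ?thesis
    unfolding permutes_def by (auto simp: longest_def)
qed

lemma longest_descent: "1 \<le> i \<Longrightarrow> i < m \<Longrightarrow> longest m (Suc i) < longest m i"
  by (auto simp: longest_def)

text \<open>Entries dropping strictly up to position m are at least m - i, and the box bounds them
  above by the same number.\<close>

lemma lehmer_code_decreasing:
  assumes w: "w permutes {1..m}" and desc: "\<And>i. 1 \<le> i \<Longrightarrow> i < m \<Longrightarrow> w (Suc i) < w i"
  shows "lehmer_code w = (\<lambda>i. if i \<in> {1..m} then m - i else 0)"
proof
  fix i
  note box = lehmer_code_box[OF w]
  show "lehmer_code w i = (if i \<in> {1..m} then m - i else 0)"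
  proof (cases "i \<in> {1..m}")
    case True
    then have i: "1 \<le> i" "i \<le> m" by auto
    have "m - i \<le> lehmer_code w i"
      using i(2) i(1)
    proof (induction i rule: inc_induct)
      case (step k)
      then have "lehmer_code w (Suc k) < lehmer_code w k"
        using desc[of k] descent_iff[OF permutes_inj[OF w]] by simp
      then show ?case using step by simp
    qed simp
    moreover have "lehmer_code w i \<noteq> 0 \<Longrightarrow> lehmer_code w i + i \<le> m"
      using box unfolding box_def by blast
    ultimately show ?thesis using i by (cases "lehmer_code w i = 0") auto
  next
    case False
    then have "lehmer_code w i = 0" by (rule codes_eq_0[OF box_subset_codes[OF box]])
    with False show ?thesis by auto
  qed
qed

lemma decreasing_eq_longest:
  assumes w: "w permutes {1..m}" and desc: "\<And>i. 1 \<le> i \<Longrightarrow> i < m \<Longrightarrow> w (Suc i) < w i"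
  shows "w = longest m"
proof (rule lehmer_code_inj[OF w longest_permutes])
  have "lehmer_code (longest m) = (\<lambda>i. if i \<in> {1..m} then m - i else 0)"
    using longest_descent by (intro lehmer_code_decreasing longest_permutes)
  then show "lehmer_code w = lehmer_code (longest m)"
    using lehmer_code_decreasing[OF assms] by simp
qed

lemma lehmer_code_longest:
  "lehmer_code (longest m) = (\<lambda>i. if i \<in> {1..m} then m - i else 0)"
  using longest_descent by (intro lehmer_code_decreasing longest_permutes)

lemma chain_permutes: "chain m w f \<Longrightarrow> w permutes {1..m}"
proof (induction rule: chain.induct)
  case (descent w f i)
  show ?case
    using descent.IH descent_range[OF descent.IH descent.hyps(2)] by (rule permutes_comp_adj)
qed (rule longest_permutes)

lemma chain_polys: "chain m w f \<Longrightarrow> f \<in> polys m"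
proof (induction rule: chain.induct)
  case longest
  show ?case by (intro polys_prod polys_power polys.Var) auto
next
  case (descent w f i)
  show ?case
    using descent.IH descent_range[OF chain_permutes[OF descent.hyps(1)] descent.hyps(2)]
    by (rule divided_diff_in_polys)
qed

lemma chain_homogeneous: "chain m w f \<Longrightarrow> homogeneous (code_size m (lehmer_code w)) f"
proof (induction rule: chain.induct)
  case longest
  have "homogeneous (\<Sum>i=1..m. (m - i) * Suc 0) (\<Prod>i=1..m. Var i ^ (m - i))"
    by (intro homogeneous_prod homogeneous_power homogeneous.Var) simp
  then show ?case by (simp add: code_size_def lehmer_code_longest)
next
  case (descent w f i)
  note w = chain_permutes[OF descent.hyps(1)]
  have "lehmer_code (w \<circ> adj i) = code_down i (lehmer_code w)"
    using descent.hyps(2) by (rule lehmer_code_descent[OF permutes_inj[OF w]])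
  moreover have "code_size m (lehmer_code w) = Suc (code_size m (code_down i (lehmer_code w)))"
    using descent_range[OF w descent.hyps(2)] descent.hyps(2)
    unfolding descent_iff[OF permutes_inj[OF w]] by (rule code_size_down)
  ultimately show ?case
    using homogeneous_divided_diff[OF descent.IH, of i] by (simp only: diff_Suc_1)
qed

lemma code_size_bound: "w permutes {1..m} \<Longrightarrow> code_size m (lehmer_code w) \<le> m * m"
proof -
  assume "w permutes {1..m}"
  then have box: "lehmer_code w \<in> box m" by (rule lehmer_code_box)
  have "lehmer_code w i \<le> m" for i
    using box unfolding box_def by (cases "lehmer_code w i = 0") (blast dest: add_leD1 | simp)+
  then have "code_size m (lehmer_code w) \<le> (\<Sum>i=1..m. m)"
    unfolding code_size_def by (intro sum_mono)
  then show ?thesis by simp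
qed

text \<open>The crude bound m * m on the length turns climbing towards \<open>longest m\<close> into
  a decreasing natural number, the measure of the inductions below.\<close>

lemma up_measure:
  assumes w: "w permutes {1..m}" and i: "1 \<le> i" "i < m" and asc: "w i < w (Suc i)"
  shows "m * m - code_size m (lehmer_code (w \<circ> adj i)) < m * m - code_size m (lehmer_code w)"
  using lehmer_code_ascent[OF permutes_inj[OF w] asc] code_size_up[OF i]
    code_size_bound[OF permutes_comp_adj[OF w i]] by simp

lemma longest_or_ascent:
  assumes w: "w permutes {1..m}"
  obtains "w = longest m" | i where "1 \<le> i" "i < m" "w i < w (Suc i)"
proof (cases "\<forall>i. 1 \<le> i \<and> i < m \<longrightarrow> w (Suc i) < w i")
  case False
  then obtain i where i: "1 \<le> i" "i < m" "\<not> w (Suc i) < w i" by blast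
  moreover have "w i \<noteq> w (Suc i)" using injD[OF permutes_inj[OF w]] by fastforce
  ultimately show thesis using that(2) by force
qed (use decreasing_eq_longest[OF w] that(1) in blast)

lemma chain_up:
  assumes "chain m (w \<circ> adj i) f" "w i < w (Suc i)"
  shows "chain m w (divided_diff i f)"
  using chain.descent[OF assms(1), of i] assms(2) by (simp add: comp_adj_adj)

lemma chain_exists: "w permutes {1..m} \<Longrightarrow> \<exists>f. chain m w f"
proof (induction "m * m - code_size m (lehmer_code w)" arbitrary: w rule: less_induct)
  case less
  from less.prems show ?case
  proof (cases rule: longest_or_ascent)
    case 1
    then show ?thesis using chain.longest by blast
  next
    case (2 i)
    then show ?thesis
      using less.hyps[OF up_measure permutes_comp_adj] less.prems chain_up by blast
  qed
qed

lemma chain_inv: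
  assumes "chain m w f"
  obtains "w = longest m" "f = (\<Prod>i=1..m. Var i ^ (m - i))"
  | i g where "1 \<le> i" "i < m" "w i < w (Suc i)" "chain m (w \<circ> adj i) g" "f = divided_diff i g"
  using assms
proof (cases rule: chain.cases)
  case (descent v g i)
  have "w \<circ> adj i = v" unfolding descent by (rule comp_adj_adj)
  then show thesis
    using descent descent_range[OF chain_permutes[OF descent(3)] descent(4)]
    by (intro that(2)[of i g]) auto
qed (rule that(1))

lemma chain_unique: "chain m w f \<Longrightarrow> chain m w g \<Longrightarrow> f = g"
proof (induction "m * m - code_size m (lehmer_code w)" arbitrary: w f g rule: less_induct)
  case less
  note w = chain_permutes[OF less.prems(1)]
  have IH: "h = h'" if "chain m (w \<circ> adj i) h" "chain m (w \<circ> adj i) h'"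
    "1 \<le> i" "i < m" "w i < w (Suc i)" for i h h'
    using less.hyps[OF up_measure that(1,2)] w that by blast
  have not_longest: "w \<noteq> longest m" if "1 \<le> i" "i < m" "w i < w (Suc i)" for i
    using longest_descent[OF that(1,2)] that(3) by auto
  \<comment> \<open>The common ancestor is w s_i s_j s_i for neighbouring i and j, and w s_i s_j
    otherwise. Its polynomial h exists by \<open>chain_exists\<close>, and the induction hypothesis
    one step above w expresses f' and g' through h.\<close>
  have diamond: "divided_diff i f' = divided_diff j g'"
    if i: "1 \<le> i" "i < m" "w i < w (Suc i)" "chain m (w \<circ> adj i) f'"
      and j: "1 \<le> j" "j < m" "w j < w (Suc j)" "chain m (w \<circ> adj j) g'"
      and ij: "i < j" for i j f' g'
  proof (cases "j = Suc i")
    case True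
    have w': "w i < w (Suc i)" "w (Suc i) < w (Suc (Suc i))"
      using i j True by auto
    have perm: "(w \<circ> adj i \<circ> adj j \<circ> adj i) permutes {1..m}"
      by (intro permutes_comp_adj w i j)
    then obtain h where h: "chain m (w \<circ> adj i \<circ> adj j \<circ> adj i) h"
      using chain_exists by blast
    have "chain m (w \<circ> adj i \<circ> adj j) (divided_diff i h)"
      by (rule chain_up[OF h]) (use w' True in \<open>auto simp: Transposition.transpose_def\<close>)
    then have "chain m (w \<circ> adj i) (divided_diff j (divided_diff i h))"
      by (rule chain_up) (use w' True in \<open>auto simp: Transposition.transpose_def\<close>)
    from IH[OF i(4) this i(1-3)] have f': "f' = divided_diff j (divided_diff i h)" .
    have "w \<circ> adj i \<circ> adj j \<circ> adj i = w \<circ> adj j \<circ> adj i \<circ> adj j"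
      using True by (auto simp: fun_eq_iff Transposition.transpose_def)
    with h have "chain m (w \<circ> adj j \<circ> adj i \<circ> adj j) h" by simp
    then have "chain m (w \<circ> adj j \<circ> adj i) (divided_diff j h)"
      by (rule chain_up) (use w' True in \<open>auto simp: Transposition.transpose_def\<close>)
    then have "chain m (w \<circ> adj j) (divided_diff i (divided_diff j h))"
      by (rule chain_up) (use w' True in \<open>auto simp: Transposition.transpose_def\<close>)
    from IH[OF j(4) this j(1-3)] have "g' = divided_diff i (divided_diff j h)" .
    then show ?thesis using f' True divided_diff_braid by simp
  next
    case False
    then have ij': "Suc i < j" using ij by simp
    have "(w \<circ> adj i \<circ> adj j) permutes {1..m}"
      by (intro permutes_comp_adj w i j)
    then obtain h where h: "chain m (w \<circ> adj i \<circ> adj j) h"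
      using chain_exists by blast
    then have "chain m (w \<circ> adj i) (divided_diff j h)"
      by (rule chain_up) (use i j ij' in \<open>auto simp: Transposition.transpose_def\<close>)
    from IH[OF i(4) this i(1-3)] have f': "f' = divided_diff j h" .
    have "w \<circ> adj i \<circ> adj j = w \<circ> adj j \<circ> adj i"
      using ij' by (auto simp: fun_eq_iff Transposition.transpose_def)
    with h have "chain m (w \<circ> adj j \<circ> adj i) h" by simp
    then have "chain m (w \<circ> adj j) (divided_diff i h)"
      by (rule chain_up) (use i j ij' in \<open>auto simp: Transposition.transpose_def\<close>)
    from IH[OF j(4) this j(1-3)] have "g' = divided_diff i h" .
    then show ?thesis using f' ij' divided_diff_commute[of i j h] by simp
  qed
  from less.prems(1) show ?case
  proof (cases rule: chain_inv)
    case 1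
    from less.prems(2) show ?thesis
      by (cases rule: chain_inv) (use 1 not_longest in auto)
  next
    case (2 i f')
    note i = this
    from less.prems(2) show ?thesis
    proof (cases rule: chain_inv)
      case 1
      then show ?thesis using i not_longest by auto
    next
      case (2 j g')
      note j = this
      consider "i < j" | "i = j" | "j < i" by linarith
      then show ?thesis
      proof cases
        case 1
        show ?thesis using diamond[OF i(1-4) j(1-4) 1] i j by simp
      next
        case 2
        show ?thesis using IH[OF i(4) _ i(1-3), of g'] i j 2 by simp
      next
        case 3
        show ?thesis using diamond[OF j(1-4) i(1-4) 3] i j by simp
      qed
    qed
  qed
qed

lemma divided_diff_equal_exponents:
  assumes f: "swap_vars i f = f"
  shows "divided_diff i (f * (Var i ^ Suc a * Var (Suc i) ^ a)) = f * (Var i ^ a * Var (Suc i) ^ a)"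
proof -
  let ?g = "f * (Var i ^ a * Var (Suc i) ^ a)"
  have "swap_vars i ?g = ?g" using f by (simp add: mult_ac)
  then have "divided_diff i (?g * Var i) = ?g * divided_diff i (Var i)"
    by (rule divided_diff_mult_symmetric_left)
  then show ?thesis by (simp add: divided_diff_Var mult_ac)
qed

text \<open>Climb to \<open>longest m\<close> through weakly decreasing codes. At the least ascent j
  the entries at j and j + 1 are equal; raising the former multiplies the monomial by x_j, and the
  divided difference takes that factor away again.\<close>

lemma chain_dominant:
  assumes "w permutes {1..m}"
    and "\<And>i. 1 \<le> i \<Longrightarrow> lehmer_code w (Suc i) \<le> lehmer_code w i"
  shows "chain m w (\<Prod>i=1..m. Var i ^ lehmer_code w i)"
  using assms
proof (induction "m * m - code_size m (lehmer_code w)" arbitrary: w rule: less_induct)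
  case less
  note w = less.prems(1)
  let ?c = "lehmer_code w"
  from w show ?case
  proof (cases rule: longest_or_ascent)
    case 1
    have "(\<Prod>i=1..m. Var i ^ ?c i) = (\<Prod>i=1..m. Var i ^ (m - i))"
      unfolding 1 lehmer_code_longest by (rule prod.cong) auto
    then show ?thesis using chain.longest[of m] 1 by simp
  next
    case 2
    define j where "j = (LEAST i. 1 \<le> i \<and> i < m \<and> w i < w (Suc i))"
    have "1 \<le> j \<and> j < m \<and> w j < w (Suc j)"
      unfolding j_def by (rule LeastI_ex) (use 2 in blast)
    then have j: "1 \<le> j" "j < m" "w j < w (Suc j)" by auto
    \<comment> \<open>Strict drops before j leave room to raise entry j without losing
      dominance.\<close>
    have before: "?c (Suc i) < ?c i" if "1 \<le> i" "i < j" for i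
      using not_less_Least[of i "\<lambda>i. 1 \<le> i \<and> i < m \<and> w i < w (Suc i)"] that j(2)
        ascent_iff[OF permutes_inj[OF w], of i] unfolding j_def[symmetric] by force
    have eq: "?c (Suc j) = ?c j"
      using less.prems(2)[OF j(1)] ascent_iff[OF permutes_inj[OF w]] j(3) by (simp add: le_antisym)
    have c': "lehmer_code (w \<circ> adj j) = ?c(j := Suc (?c j))"
      unfolding lehmer_code_ascent[OF permutes_inj[OF w] j(3)] code_up_def using eq by auto
    have "chain m (w \<circ> adj j) (\<Prod>i=1..m. Var i ^ lehmer_code (w \<circ> adj j) i)"
    proof (rule less.hyps[OF up_measure[OF w j] permutes_comp_adj[OF w j(1,2)]])
      fix i :: nat assume i: "1 \<le> i"
      consider "i = j" | "Suc i = j" | "i \<noteq> j" "Suc i \<noteq> j" by blast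
      then show "lehmer_code (w \<circ> adj j) (Suc i) \<le> lehmer_code (w \<circ> adj j) i"
      proof cases
        case 2
        then show ?thesis unfolding c' using before[OF i] by auto
      qed (use less.prems(2)[OF i] in \<open>auto simp: c'\<close>)
    qed
    note * = chain_up[OF this j(3)]
    let ?A = "{1..m} - {j, Suc j}"
    let ?f = "\<Prod>i\<in>?A. Var i ^ ?c i"
    have "{1..m} = insert j (insert (Suc j) ?A)" using j by auto
    then have split: "prod g {1..m} = prod g ?A * (g j * g (Suc j))" for g :: "nat \<Rightarrow> zpoly"
      by (metis (no_types, lifting) DiffE finite_Diff finite_atLeastAtMost finite_insert insertCI
        insertE n_not_Suc_n prod.insert mult.assoc mult.commute)
    have "(\<Prod>i\<in>?A. Var i ^ lehmer_code (w \<circ> adj j) i) = ?f"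
      by (rule prod.cong) (auto simp: c')
    then have up: "(\<Prod>i=1..m. Var i ^ lehmer_code (w \<circ> adj j) i) =
        ?f * (Var j ^ Suc (?c j) * Var (Suc j) ^ ?c j)"
      unfolding split by (simp add: c' eq)
    have "(\<Prod>i=1..m. Var i ^ ?c i) = ?f * (Var j ^ ?c j * Var (Suc j) ^ ?c j)"
      unfolding split by (simp add: eq)
    moreover have "swap_vars j ?f = ?f"
      by (auto intro!: prod.cong simp: Transposition.transpose_def)
    ultimately show ?thesis
      using * unfolding up by (simp only: divided_diff_equal_exponents)
  qed
qed

text \<open>Only the starting point matters: \<open>longest m\<close> has a weakly decreasing code,
  so inside S_{m+1} it carries the same monomial.\<close>

lemma chain_Suc:
  assumes "chain m w f" shows "chain (Suc m) w f"
  using assms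
proof (induction rule: chain.induct)
  case longest
  have "chain (Suc m) (longest m) (\<Prod>i=1..Suc m. Var i ^ lehmer_code (longest m) i)"
    using permutes_mono[OF longest_permutes[of m], of "Suc m"]
    by (intro chain_dominant) (auto simp: lehmer_code_longest)
  also have "(\<Prod>i=1..Suc m. Var i ^ lehmer_code (longest m) i) = (\<Prod>i=1..m. Var i ^ (m - i))"
    by (auto simp: lehmer_code_longest intro: prod.cong)
  finally show ?case .
qed (rule chain.descent)

lemma chain_mono: "m \<le> n \<Longrightarrow> chain m w f \<Longrightarrow> chain n w f"
  by (induction n rule: dec_induct) (auto intro: chain_Suc)

lemma schubert_value_iff: "schubert_value w f \<longleftrightarrow> (\<exists>m. chain m w f)"
proof
  show "schubert_value w f \<Longrightarrow> \<exists>m. chain m w f"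
  proof (induction rule: schubert_value.induct)
    case (longest m)
    show ?case using chain.longest by (rule exI)
  next
    case (descent w f i)
    then show ?case unfolding Suc_eq_plus1[symmetric] using chain.descent by blast
  qed
  show "\<exists>m. chain m w f \<Longrightarrow> schubert_value w f"
  proof (elim exE)
    fix m assume "chain m w f"
    then show "schubert_value w f"
    proof (induction rule: chain.induct)
      case (descent w f i)
      then show ?case using schubert_value.descent[of w f i] unfolding Suc_eq_plus1 by blast
    qed (rule schubert_value.longest)
  qed
qed

lemma schubert_eq: "chain m w f \<Longrightarrow> schubert w = f"
  unfolding schubert_def schubert_value_iff
proof (rule the_equality)
  fix g assume f: "chain m w f" and "\<exists>n. chain n w g"
  then obtain n where g: "chain n w g" by blast
  show "g = f"
    using chain_unique[OF chain_mono[OF _ g] chain_mono[OF _ f], of "max m n"] by simp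
qed blast

lemma chain_schubert: "w permutes {1..m} \<Longrightarrow> chain m w (schubert w)"
  using chain_exists schubert_eq by blast

section \<open>Descents, symmetry and variables of Schubert polynomials\<close>

lemma schubert_descent:
  assumes "w \<in> perms" "w (Suc i) < w i"
  shows "schubert (w \<circ> adj i) = divided_diff i (schubert w)"
proof -
  obtain m where "w permutes {1..m}" using assms by (auto simp: perms_def)
  then show ?thesis by (intro schubert_eq[of m] chain.descent chain_schubert assms)
qed

lemma schubert_ascent:
  assumes "w \<in> perms" "1 \<le> i" "w i < w (Suc i)"
  shows "schubert w = divided_diff i (schubert (w \<circ> adj i))"
  using schubert_descent[OF perms_comp_adj[OF assms(1,2)], of i] assms(3)
  by (simp add: comp_adj_adj)

lemma swap_vars_schubert:
  "w \<in> perms \<Longrightarrow> 1 \<le> i \<Longrightarrow> w i < w (Suc i) \<Longrightarrow> swap_vars i (schubert w) = schubert w"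
  using schubert_ascent by (metis swap_vars_divided_diff)

lemma schubert_dominant:
  assumes "w \<in> perms" "\<And>i. 1 \<le> i \<Longrightarrow> lehmer_code w (Suc i) \<le> lehmer_code w i"
    and "lehmer_code w \<in> codes n"
  shows "schubert w = (\<Prod>i=1..n. Var i ^ lehmer_code w i)"
proof -
  obtain m where m: "w permutes {1..m}" using assms by (auto simp: perms_def)
  have "schubert w = (\<Prod>i=1..max m n. Var i ^ lehmer_code w i)"
    using assms(2) by (intro schubert_eq[of "max m n"] chain_dominant permutes_mono[OF m]) auto
  also have "\<dots> = (\<Prod>i=1..n. Var i ^ lehmer_code w i)"
    using codes_eq_0[OF assms(3)] by (intro prod.mono_neutral_right) auto
  finally show ?thesis .
qed

lemma schubert_id [simp]: "schubert id = 1"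
  using schubert_dominant[of id 0] by (simp add: lehmer_code_id codes_def)

text \<open>The polynomial is homogeneous of degree the length of w, and only the identity has
  length 0.\<close>

lemma const_term_schubert:
  assumes "w \<in> perms"
  shows "const_term (schubert w) = (if w = id then 1 else 0)"
proof (cases "w = id")
  case False
  obtain m where m: "w permutes {1..m}" using assms by (auto simp: perms_def)
  have "code_size m (lehmer_code w) \<noteq> 0"
    using False lehmer_code_0_id[OF m] code_size_0_iff[OF box_subset_codes[OF lehmer_code_box[OF m]]]
    by blast
  then show ?thesis
    using False const_term_homogeneous[OF chain_homogeneous[OF chain_schubert[OF m]]] by simp
qed simp

text \<open>Beyond n the code vanishes, so there are no descents and the polynomial is symmetric in
  x_{k+1} and x_{k+2} for k >= n. Variables are dropped one at a time from the top.\<close>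

lemma schubert_in_polys:
  assumes w: "w \<in> perms" and c: "lehmer_code w \<in> codes n"
  shows "schubert w \<in> polys n"
proof -
  obtain m where m: "w permutes {1..m}" using w by (auto simp: perms_def)
  have "schubert w \<in> polys (max m n)"
    using chain_polys[OF chain_schubert[OF m]] by (rule polys_mono[rotated]) simp
  then show ?thesis
  proof (rule inc_induct[of n "max m n" "\<lambda>k. schubert w \<in> polys k", rotated])
    fix k assume k: "n \<le> k" "schubert w \<in> polys (Suc k)"
    have "lehmer_code w (Suc k) = 0" "lehmer_code w (Suc (Suc k)) = 0"
      using k(1) by (auto intro: codes_eq_0[OF c])
    then have "swap_vars (Suc k) (schubert w) = schubert w"
      using ascent_iff[OF perms_inj[OF w]] by (intro swap_vars_schubert w) auto
    with k(2) show "schubert w \<in> polys k" by (rule polys_drop_variable)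
  qed simp
qed

section \<open>The Schubert basis and its dual functionals\<close>

text \<open>Constant terms of iterated divided differences along a reduced word. This is a relation
  because reduced words are not unique; agreement of the values on polynomials is
  \<open>schubert_coeff_eq\<close>.\<close>

inductive dual :: "(nat \<Rightarrow> nat) \<Rightarrow> (zpoly \<Rightarrow> int) \<Rightarrow> bool" where
  id: "dual id const_term"
| ascent: "dual w L \<Longrightarrow> 1 \<le> i \<Longrightarrow> w i < w (Suc i) \<Longrightarrow>
    dual (w \<circ> adj i) (\<lambda>f. L (divided_diff i f))"

lemma dual_perms: "dual w L \<Longrightarrow> w \<in> perms"
proof (induction rule: dual.induct)
  case id
  show ?case by (rule perms_id)
next
  case (ascent w L i)
  show ?case using ascent.IH ascent.hyps(2) by (rule perms_comp_adj)
qed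

lemma dual_add: "dual w L \<Longrightarrow> L (f + g) = L f + L g"
  by (induction arbitrary: f g rule: dual.induct) auto

lemma dual_0: "dual w L \<Longrightarrow> L 0 = 0"
  using dual_add[of w L 0 0] by simp

lemma dual_scale: "dual w L \<Longrightarrow> L (of_int c * f) = c * L f"
  by (induction arbitrary: f rule: dual.induct) (auto simp: divided_diff_mult_symmetric_left)

lemma dual_sum: "dual w L \<Longrightarrow> L (sum f A) = (\<Sum>a\<in>A. L (f a))"
  by (induction A rule: infinite_finite_induct) (auto simp: dual_0 dual_add)

text \<open>If v descends at i, the divided difference passes to v s_i and the shorter word decides.
  If v ascends there, its polynomial is symmetric and killed, while w s_i descends and so differs
  from v.\<close>

lemma dual_schubert:
  "dual w L \<Longrightarrow> v \<in> perms \<Longrightarrow> L (schubert v) = (if v = w then 1 else 0)"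
proof (induction arbitrary: v rule: dual.induct)
  case id
  then show ?case by (rule const_term_schubert)
next
  case (ascent w L i)
  have "v i \<noteq> v (Suc i)"
    using injD[OF perms_inj[OF ascent.prems]] by fastforce
  then consider "v (Suc i) < v i" | "v i < v (Suc i)" by linarith
  then show ?case
  proof cases
    case 1
    have "v \<circ> adj i = w \<longleftrightarrow> v = w \<circ> adj i"
      by (metis comp_adj_adj)
    then show ?thesis
      using ascent.IH[OF perms_comp_adj[OF ascent.prems ascent.hyps(2)]]
      by (simp only: schubert_descent[OF ascent.prems 1])
  next
    case 2
    then have "v \<noteq> w \<circ> adj i" using ascent.hyps(3) by auto
    moreover have "divided_diff i (schubert v) = 0"
      using swap_vars_schubert[OF ascent.prems ascent.hyps(2) 2] by (rule divided_diff_eq_0)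
    ultimately show ?thesis
      using dual_0[OF ascent.hyps(1)] by (simp del: o_apply)
  qed
qed

text \<open>For a permutation of S_m some reduced word uses only s_i with i < m. A factor symmetric
  under all of these passes through every divided difference and finally contributes its constant
  term.\<close>

lemma dual_exists:
  assumes "w permutes {1..m}"
  shows "\<exists>L. dual w L \<and>
    (\<forall>f s. (\<forall>i. 1 \<le> i \<longrightarrow> i < m \<longrightarrow> swap_vars i s = s) \<longrightarrow> L (f * s) = L f * const_term s)"
  using assms
proof (induction "code_size m (lehmer_code w)" arbitrary: w)
  case 0
  then have "w = id"
    using lehmer_code_0_id code_size_0_iff[OF box_subset_codes[OF lehmer_code_box]] by metis
  then have "dual w const_term" using dual.id by (simp only:)
  then show ?case by (intro exI[of _ const_term]) simp
next
  case (Suc k)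
  note inj = permutes_inj[OF Suc.prems]
  have "lehmer_code w \<noteq> (\<lambda>_. 0)"
    using Suc.hyps(2) by (auto simp: code_size_def)
  then obtain i where i: "1 \<le> i" "i < m" "lehmer_code w (Suc i) < lehmer_code w i"
    using code_descent_exists[OF lehmer_code_box[OF Suc.prems]] by blast
  have desc: "w (Suc i) < w i"
    using i(3) descent_iff[OF inj] by blast
  have "k = code_size m (lehmer_code (w \<circ> adj i))"
    using Suc.hyps(2) code_size_down[OF i] unfolding lehmer_code_descent[OF inj desc] by linarith
  from Suc.hyps(1)[OF this permutes_comp_adj[OF Suc.prems i(1,2)]]
  obtain L where L: "dual (w \<circ> adj i) L"
    "\<And>f s. (\<forall>i. 1 \<le> i \<longrightarrow> i < m \<longrightarrow> swap_vars i s = s) \<Longrightarrow> L (f * s) = L f * const_term s"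
    by blast
  have "dual (w \<circ> adj i \<circ> adj i) (\<lambda>f. L (divided_diff i f))"
    using L(1) i(1) by (rule dual.ascent) (use desc in simp)
  then have "dual w (\<lambda>f. L (divided_diff i f))"
    unfolding comp_adj_adj .
  moreover have "L (divided_diff i (f * s)) = L (divided_diff i f) * const_term s"
    if s: "\<forall>i. 1 \<le> i \<longrightarrow> i < m \<longrightarrow> swap_vars i s = s" for f s
  proof -
    have "divided_diff i (f * s) = divided_diff i f * s"
      using s i(1,2) by (intro divided_diff_mult_symmetric_right) blast
    then show ?thesis using L(2)[OF s] by simp
  qed
  ultimately show ?case by (intro exI[of _ "\<lambda>f. L (divided_diff i f)"]) blast
qed

section \<open>Schubert polynomials indexed by codes\<close>

abbreviation Sch :: "(nat \<Rightarrow> nat) \<Rightarrow> zpoly" where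
  "Sch \<gamma> \<equiv> schubert (code_inv \<gamma>)"

lemma Sch_down:
  assumes "\<gamma> \<in> codes n" "\<gamma> (Suc i) < \<gamma> i"
  shows "divided_diff i (Sch \<gamma>) = Sch (code_down i \<gamma>)"
  unfolding code_inv_down(1)[OF assms]
  using schubert_descent[OF code_inv_codes(1)[OF assms(1)] code_inv_down(2)[OF assms]] by simp

lemma swap_vars_Sch:
  assumes "\<gamma> \<in> codes n" "1 \<le> i" "\<gamma> i \<le> \<gamma> (Suc i)"
  shows "swap_vars i (Sch \<gamma>) = Sch \<gamma>"
  using assms ascent_iff[OF perms_inj] code_inv_codes[OF assms(1)]
  by (intro swap_vars_schubert) auto

lemma Sch_polys: "\<gamma> \<in> codes n \<Longrightarrow> Sch \<gamma> \<in> polys n"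
  using code_inv_codes by (intro schubert_in_polys) auto

lemma Sch_dominant:
  assumes "\<gamma> \<in> codes n" "\<And>i. 1 \<le> i \<Longrightarrow> i < n \<Longrightarrow> \<gamma> (Suc i) \<le> \<gamma> i"
  shows "Sch \<gamma> = (\<Prod>i=1..n. Var i ^ \<gamma> i)"
proof -
  have dec: "\<gamma> (Suc i) \<le> \<gamma> i" if "1 \<le> i" for i
    using assms(2)[OF that] codes_eq_0[OF assms(1), of "Suc i"] by (cases "i < n") auto
  note w = code_inv_codes[OF assms(1)]
  show ?thesis
    using schubert_dominant[OF w(1), of n] w(2) assms(1) dec by simp
qed

lemma code_inv_0: "code_inv (\<lambda>_. 0) = id"
  by (rule code_inv_eq) (auto simp: lehmer_code_id)

lemma codes_0 [simp]: "(\<lambda>_. 0) \<in> codes n"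
  by (simp add: codes_def)

lemma codes_upd: "\<gamma> \<in> codes n \<Longrightarrow> \<gamma>(Suc n + j := k) \<in> codes (Suc n + j)"
  unfolding codes_def by auto (metis le_SucI trans_le_add1)+

lemma code_down_upd:
  assumes "\<gamma> \<in> codes n"
  shows "code_down (Suc n + j) (\<gamma>(Suc n + j := k)) = \<gamma>(Suc n + Suc j := k - 1)"
proof -
  have "\<gamma> (Suc n + j) = 0" "\<gamma> (Suc n + Suc j) = 0"
    by (auto intro: codes_eq_0[OF assms])
  then show ?thesis by (auto simp: code_down_def fun_eq_iff)
qed

lemma codes_upd_0: "\<gamma> \<in> codes n \<Longrightarrow> \<gamma>(Suc n + j := 0) = \<gamma>"
  using codes_eq_0[of \<gamma> n "Suc n + j"] by (simp add: fun_upd_idem_iff)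

lemma code_upd_descent:
  assumes "\<gamma> \<in> codes n" "0 < k"
  shows "(\<gamma>(Suc n + j := k)) (Suc (Suc n + j)) < (\<gamma>(Suc n + j := k)) (Suc n + j)"
  using codes_eq_0[OF assms(1), of "Suc (Suc n + j)"] assms(2) by simp

text \<open>Only zeroes follow the last entry, so while it is positive each step moves it one
  position to the right and lowers it by one.\<close>

lemma divided_diffs_Sch:
  assumes "\<gamma> \<in> codes n"
  shows "j \<le> k \<Longrightarrow> divided_diffs (Suc n) j (Sch (\<gamma>(Suc n := k))) = Sch (\<gamma>(Suc n + j := k - j))"
proof (induction j)
  case (Suc j)
  then have "divided_diffs (Suc n) (Suc j) (Sch (\<gamma>(Suc n := k))) =
      divided_diff (Suc n + j) (Sch (\<gamma>(Suc n + j := k - j)))"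
    by (simp only: divided_diffs.simps Suc_leD)
  also have "\<dots> = Sch (code_down (Suc n + j) (\<gamma>(Suc n + j := k - j)))"
    using codes_upd[OF assms] code_upd_descent[OF assms] by (rule Sch_down) (use Suc.prems in simp)
  finally show ?case unfolding code_down_upd[OF assms] by (simp del: fun_upd_apply)
qed simp

text \<open>After k steps the last entry is used up, and what remains is symmetric at the next
  position.\<close>

lemma divided_diffs_Sch_0:
  assumes "\<gamma> \<in> codes n"
  shows "divided_diffs (Suc n) (Suc k) (Sch (\<gamma>(Suc n := k))) = 0"
proof -
  have "divided_diffs (Suc n) k (Sch (\<gamma>(Suc n := k))) = Sch \<gamma>"
    using divided_diffs_Sch[OF assms order_refl] codes_upd_0[OF assms] by simp
  moreover have "\<gamma> (Suc n + k) = 0"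
    by (rule codes_eq_0[OF assms]) simp
  then have "divided_diff (Suc n + k) (Sch \<gamma>) = 0"
    by (intro divided_diff_eq_0 swap_vars_Sch[OF assms]) simp_all
  ultimately show ?thesis by simp
qed

text \<open>Newton quotients translate the two preceding lemmas into a degree bound and a leading
  coefficient in x_{n+1}. This triangularity yields the spanning property.\<close>

lemma Sch_leading:
  assumes \<gamma>: "\<gamma> \<in> codes n"
  shows "degree (univariate (Suc n) (Sch (\<gamma>(Suc n := k)))) \<le> k"
    and "coeff (univariate (Suc n) (Sch (\<gamma>(Suc n := k)))) k = Sch \<gamma>"
proof -
  have pol: "Sch (\<gamma>(Suc n := k)) \<in> polys (Suc n)"
    using codes_upd[OF \<gamma>, of 0] by (intro Sch_polys) simp
  show deg: "degree (univariate (Suc n) (Sch (\<gamma>(Suc n := k)))) \<le> k"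
    using pol divided_diffs_Sch_0[OF \<gamma>] by (rule degree_univariate_le)
  show "coeff (univariate (Suc n) (Sch (\<gamma>(Suc n := k)))) k = Sch \<gamma>"
    using divided_diffs_top[OF pol deg] divided_diffs_Sch[OF \<gamma> order_refl] codes_upd_0[OF \<gamma>] by simp
qed

section \<open>Expansion in the Schubert basis\<close>

inductive_set schubert_span :: "nat \<Rightarrow> zpoly set" for n where
  zero: "0 \<in> schubert_span n"
| step: "f \<in> schubert_span n \<Longrightarrow> \<gamma> \<in> codes n \<Longrightarrow> f + of_int c * Sch \<gamma> \<in> schubert_span n"

lemma schubert_span_add: "g \<in> schubert_span n \<Longrightarrow> f \<in> schubert_span n \<Longrightarrow> f + g \<in> schubert_span n"
proof (induction rule: schubert_span.induct)
  case (step g \<gamma> c)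
  then show ?case using schubert_span.step[of "f + g" n \<gamma> c] by (simp add: add.assoc)
qed simp

lemma schubert_span_lift:
  "a \<in> schubert_span n \<Longrightarrow> \<exists>g \<in> schubert_span (Suc n). g \<in> polys (Suc n) \<and>
    degree (univariate (Suc n) g) \<le> k \<and> coeff (univariate (Suc n) g) k = a"
proof (induction rule: schubert_span.induct)
  case zero
  show ?case by (rule bexI[of _ 0]) (auto intro: schubert_span.zero)
next
  case (step f \<gamma> c)
  then obtain g where g: "g \<in> schubert_span (Suc n)" "g \<in> polys (Suc n)"
    "degree (univariate (Suc n) g) \<le> k" "coeff (univariate (Suc n) g) k = f" by blast
  let ?S = "Sch (\<gamma>(Suc n := k))"
  note \<gamma> = step(2)
  have c: "\<gamma>(Suc n := k) \<in> codes (Suc n)"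
    using codes_upd[OF \<gamma>, of 0] by simp
  have u: "univariate (Suc n) (of_int c * ?S) = smult (of_int c) (univariate (Suc n) ?S)"
    by (simp add: of_int_poly)
  have "degree (univariate (Suc n) (g + of_int c * ?S)) \<le> k"
    unfolding univariate.add u
    using g(3) Sch_leading(1)[OF \<gamma>] degree_smult_le le_trans by (intro degree_add_le) blast+
  moreover have "coeff (univariate (Suc n) (g + of_int c * ?S)) k = f + of_int c * Sch \<gamma>"
    unfolding univariate.add u using g(4) Sch_leading(2)[OF \<gamma>] by simp
  ultimately show ?case
    using g(1,2) schubert_span.step[OF g(1) c] Sch_polys[OF c]
    by (intro bexI[of _ "g + of_int c * ?S"]) auto
qed

text \<open>The top coefficient in x_{n+1} is spanned by induction on n, and its lift has the same
  top coefficient, so subtraction lowers the degree. The inner parameter d is a strict degree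
  bound.\<close>

lemma schubert_spanning: "f \<in> polys n \<Longrightarrow> f \<in> schubert_span n"
proof (induction n arbitrary: f)
  case 0
  then obtain c where "f = of_int c" using polys_zero_variables by blast
  then show ?case
    using schubert_span.step[OF schubert_span.zero codes_0, where c = c] by (simp add: code_inv_0)
next
  case (Suc n)
  have "f \<in> schubert_span (Suc n)"
    if "\<forall>k\<ge>d. coeff (univariate (Suc n) f) k = 0" "f \<in> polys (Suc n)" for d f
    using that
  proof (induction d arbitrary: f)
    case 0
    then have "univariate (Suc n) f = 0" by (simp add: poly_eq_iff)
    then have "f = 0" using poly_univariate[of "Suc n" f] by simp
    then show ?case by (simp add: schubert_span.zero)
  next
    case (Suc d)
    have "coeff (univariate (Suc n) f) d \<in> schubert_span n"
      using Suc.prems(2) by (intro \<open>\<And>f. f \<in> polys n \<Longrightarrow> f \<in> schubert_span n\<close> coeff_univariate_polys)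
    then obtain g where g: "g \<in> schubert_span (Suc n)" "g \<in> polys (Suc n)"
      "degree (univariate (Suc n) g) \<le> d"
      "coeff (univariate (Suc n) g) d = coeff (univariate (Suc n) f) d"
      using schubert_span_lift by metis
    have "coeff (univariate (Suc n) (f - g)) k = 0" if "d \<le> k" for k
      using that g(3,4) Suc.prems(1) coeff_eq_0[of "univariate (Suc n) g" k]
      by (cases "k = d") auto
    then have "f - g \<in> schubert_span (Suc n)"
      using Suc.prems(2) g(2) by (intro Suc.IH) auto
    from schubert_span_add[OF g(1) this] show ?case by simp
  qed
  moreover have "\<forall>k\<ge>Suc (degree (univariate (Suc n) f)). coeff (univariate (Suc n) f) k = 0"
    by (simp add: coeff_eq_0)
  ultimately show ?case using Suc.prems by blast
qed

definition is_expansion :: "zpoly \<Rightarrow> ((nat \<Rightarrow> nat) \<Rightarrow> int) \<Rightarrow> bool" where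
  "is_expansion f c \<longleftrightarrow> finite {w. c w \<noteq> 0} \<and> {w. c w \<noteq> 0} \<subseteq> perms \<and>
    f = (\<Sum>w | c w \<noteq> 0. of_int (c w) * schubert w)"

lemma expansion_exists:
  assumes "f \<in> polys n" shows "\<exists>c. is_expansion f c"
  using schubert_spanning[OF assms]
proof (induction rule: schubert_span.induct)
  case zero
  show ?case by (rule exI[of _ "\<lambda>_. 0"]) (simp add: is_expansion_def)
next
  case (step f \<gamma> z)
  then obtain c where c: "finite {w. c w \<noteq> 0}" "{w. c w \<noteq> 0} \<subseteq> perms"
    "f = (\<Sum>w | c w \<noteq> 0. of_int (c w) * schubert w)" by (auto simp: is_expansion_def)
  let ?v = "code_inv \<gamma>"
  let ?A = "insert ?v {w. c w \<noteq> 0}"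
  let ?c = "c(?v := c ?v + z)"
  have sub: "{w. ?c w \<noteq> 0} \<subseteq> ?A" by auto
  have fin: "finite ?A" using c(1) by simp
  have f: "f = (\<Sum>w\<in>?A. of_int (c w) * schubert w)"
    unfolding c(3) using fin by (intro sum.mono_neutral_left) auto
  have "(\<Sum>w | ?c w \<noteq> 0. of_int (?c w) * schubert w) = (\<Sum>w\<in>?A. of_int (?c w) * schubert w)"
    using fin sub by (intro sum.mono_neutral_left) auto
  also have "\<dots> = (\<Sum>w\<in>?A. of_int (c w) * schubert w +
      (if w = ?v then of_int z * schubert ?v else 0))"
    by (rule sum.cong) (auto simp: distrib_right)
  also have "\<dots> = f + of_int z * schubert ?v"
    unfolding f sum.distrib using fin by simp
  finally have expansion: "is_expansion (f + of_int z * schubert ?v) ?c"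
    unfolding is_expansion_def
    using finite_subset[OF sub fin] sub c(2) code_inv_codes(1)[OF step(2)] by auto
  show ?case by (rule exI[of _ ?c]) (rule expansion)
qed

lemma dual_expansion:
  assumes "is_expansion f c" "dual w L"
  shows "L f = c w"
proof -
  have "L f = (\<Sum>v | c v \<noteq> 0. c v * (if v = w then 1 else 0))"
    using assms unfolding is_expansion_def
    by (auto simp: dual_sum[OF assms(2)] dual_scale[OF assms(2)] dual_schubert[OF assms(2)]
        intro!: sum.cong)
  also have "\<dots> = (\<Sum>v | c v \<noteq> 0. if v = w then c v else 0)"
    by (rule sum.cong) auto
  also have "\<dots> = c w"
    using assms(1) unfolding is_expansion_def by (simp add: sum.delta)
  finally show ?thesis .
qed

text \<open>The choice of reduced word does not affect values on polynomials in x_1, ..., x_n: every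
  dual functional reads off the same expansion coefficient.\<close>

definition schubert_coeff :: "(nat \<Rightarrow> nat) \<Rightarrow> zpoly \<Rightarrow> int" where
  "schubert_coeff w = (SOME L. dual w L)"

lemma dual_schubert_coeff: "w \<in> perms \<Longrightarrow> dual w (schubert_coeff w)"
proof -
  assume "w \<in> perms"
  then obtain m where "w permutes {1..m}" by (auto simp: perms_def)
  then have "\<exists>L. dual w L" using dual_exists by blast
  then show ?thesis unfolding schubert_coeff_def by (rule someI_ex)
qed

lemma schubert_coeff_eq:
  assumes "f \<in> polys n" "dual w L"
  shows "schubert_coeff w f = L f"
  using expansion_exists[OF assms(1)] dual_expansion assms(2)
    dual_schubert_coeff[OF dual_perms[OF assms(2)]] by metis

text \<open>Dual functionals determine the coefficients at permutations, and elsewhere an expansion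
  vanishes, so the expansion is unique.\<close>

lemma schubert_const_eq:
  assumes "u \<in> perms" "v \<in> perms" "w \<in> perms"
  shows "schubert_const u v w = schubert_coeff w (schubert u * schubert v)"
proof -
  obtain m n where "lehmer_code u \<in> codes m" "lehmer_code v \<in> codes n"
    using assms perms_code_exists by metis
  then have "lehmer_code u \<in> codes (max m n)" "lehmer_code v \<in> codes (max m n)"
    by (auto elim!: codes_mono)
  then have "schubert u \<in> polys (max m n)" "schubert v \<in> polys (max m n)"
    using assms schubert_in_polys by blast+
  then obtain c where c: "is_expansion (schubert u * schubert v) c"
    using expansion_exists polys.mult by blast
  have "c' = c" if c': "is_expansion (schubert u * schubert v) c'" for c'
  proof
    fix x show "c' x = c x"
    proof (cases "x \<in> perms")
      case True
      then show ?thesis using dual_expansion[OF _ dual_schubert_coeff] c c' by metis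
    next
      case False
      then have "d x = 0" if "is_expansion (schubert u * schubert v) d" for d
        using that unfolding is_expansion_def by auto
      from this[OF c] this[OF c'] show ?thesis by simp
    qed
  qed
  then have "schubert_const u v = c"
    unfolding schubert_const_def is_expansion_def[symmetric] using c by (intro the_equality)
  then show ?thesis using dual_expansion[OF c dual_schubert_coeff[OF assms(3)]] by simp
qed

section \<open>Recursion for the coefficient functionals\<close>

lemma schubert_coeff_down:
  assumes "\<gamma> \<in> codes n" "\<gamma> (Suc i) < \<gamma> i" "f \<in> polys N"
  shows "schubert_coeff (code_inv \<gamma>) f = schubert_coeff (code_inv (code_down i \<gamma>)) (divided_diff i f)"
proof -
  let ?w = "code_inv \<gamma>"
  have w: "?w \<in> perms" by (rule code_inv_codes[OF assms(1)])
  note d = code_inv_down[OF assms(1,2)]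
  note i = perms_descent_pos[OF w d(2)]
  have "dual (?w \<circ> adj i) (schubert_coeff (?w \<circ> adj i))"
    by (intro dual_schubert_coeff perms_comp_adj w i)
  from dual.ascent[OF this i]
  have "dual ?w (\<lambda>f. schubert_coeff (?w \<circ> adj i) (divided_diff i f))"
    using d(2) unfolding comp_adj_adj by simp
  from schubert_coeff_eq[OF assms(3) this] show ?thesis unfolding d(1) .
qed

lemma divided_diffs_polys: "f \<in> polys (Suc n) \<Longrightarrow> divided_diffs (Suc n) j f \<in> polys (Suc n + j)"
proof (induction j)
  case (Suc j)
  have "divided_diffs (Suc n) j f \<in> polys (Suc n + Suc j)"
    by (rule polys_mono[OF _ Suc.IH[OF Suc.prems]]) simp
  then have "divided_diff (Suc n + j) (divided_diffs (Suc n) j f) \<in> polys (Suc n + Suc j)"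
    by (rule divided_diff_in_polys) simp_all
  then show ?case by simp
qed simp

text \<open>Dual counterpart of \<open>divided_diffs_Sch\<close>: the entry travels right while the
  divided differences pass to the argument.\<close>

lemma schubert_coeff_divided_diffs:
  assumes \<gamma>: "\<gamma> \<in> codes n" and f: "f \<in> polys (Suc n)"
  shows "j \<le> k \<Longrightarrow> schubert_coeff (code_inv (\<gamma>(Suc n := k))) f =
    schubert_coeff (code_inv (\<gamma>(Suc n + j := k - j))) (divided_diffs (Suc n) j f)"
proof (induction j)
  case (Suc j)
  have "schubert_coeff (code_inv (\<gamma>(Suc n := k))) f =
      schubert_coeff (code_inv (\<gamma>(Suc n + j := k - j))) (divided_diffs (Suc n) j f)"
    by (rule Suc.IH) (use Suc.prems in simp)
  also have "\<dots> = schubert_coeff (code_inv (code_down (Suc n + j) (\<gamma>(Suc n + j := k - j))))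
      (divided_diff (Suc n + j) (divided_diffs (Suc n) j f))"
    using codes_upd[OF \<gamma>] code_upd_descent[OF \<gamma>] divided_diffs_polys[OF f]
    by (rule schubert_coeff_down) (use Suc.prems in simp)
  finally show ?case unfolding code_down_upd[OF \<gamma>] by (simp del: fun_upd_apply)
qed simp

lemma divided_diffs_0 [simp]: "divided_diffs n j 0 = 0"
  by (induction j) simp_all

lemma divided_diffs_add: "divided_diffs n (i + j) f = divided_diffs (n + i) j (divided_diffs n i f)"
  by (induction j) (simp_all add: add.assoc)

text \<open>For j <= b this is the complete homogeneous symmetric polynomial of degree b - j in x_1,
  ..., x_{j+1}. Recognising it as a Schubert polynomial supplies its symmetry and its constant
  term.\<close>

lemma divided_diffs_Var_power:
  "divided_diffs (Suc 0) j (Var (Suc 0) ^ b) =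
    (if j \<le> b then Sch ((\<lambda>_. 0)(Suc j := b - j)) else 0)"
proof -
  have base: "Sch ((\<lambda>_. 0)(Suc 0 := b)) = Var (Suc 0) ^ b"
    by (subst Sch_dominant[where n = 1]) (auto simp: codes_def)
  show ?thesis
  proof (cases "j \<le> b")
    case True
    then show ?thesis using divided_diffs_Sch[of "\<lambda>_. 0" 0 j b] base by simp
  next
    case False
    then have "j = Suc b + (j - Suc b)" by simp
    then have "divided_diffs (Suc 0) j (Var (Suc 0) ^ b) =
        divided_diffs (Suc 0 + Suc b) (j - Suc b) (divided_diffs (Suc 0) (Suc b) (Var (Suc 0) ^ b))"
      by (metis divided_diffs_add)
    then show ?thesis
      using False divided_diffs_Sch_0[of "\<lambda>_. 0" 0 b] base by simp
  qed
qed

lemma coeff_mult_polys: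
  "(\<And>k. coeff p k \<in> polys n) \<Longrightarrow> (\<And>k. coeff q k \<in> polys n) \<Longrightarrow> coeff (p * q) k \<in> polys n"
  unfolding coeff_mult by (intro polys_sum polys.mult)

lemma coeff_prod_linear_polys:
  "j \<le> n \<Longrightarrow> coeff (\<Prod>i<j. [:- Var (Suc i), 1:]) k \<in> polys n"
proof (induction j arbitrary: k)
  case (Suc j)
  have "Var (Suc j) \<in> polys n" using Suc.prems by (intro polys.Var) auto
  then have "coeff [:- Var (Suc j), 1:] k \<in> polys n" for k
    by (auto simp: coeff_pCons intro: polys_uminus split: nat.split)
  then show ?case
    using Suc unfolding prod.lessThan_Suc by (intro coeff_mult_polys) auto
qed (auto simp: coeff_1)

text \<open>
  The iterated divided difference is a Newton quotient of \<open>f\<close>, viewed as a polynomial in its last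
  variable, at the nodes \<open>x\<^sub>n\<^sub>+\<^sub>1, x\<^sub>n\<^sub>+\<^sub>2, \<dots>\<close>. Multiplying by \<open>X - x\<^sub>1, \<dots>, X - x\<^sub>n\<close> adds the missing
  nodes, after which the quotients \<open>H b\<close> of the powers \<open>X\<^sup>b\<close> are symmetric; a functional dual to
  a permutation in the same symmetric group sees only their constant terms.
\<close>

lemma schubert_coeff_last:
  assumes \<gamma>: "\<gamma> \<in> codes n" and box: "\<gamma> \<in> box (Suc n + k)" and f: "f \<in> polys (Suc n)"
  shows "schubert_coeff (code_inv (\<gamma>(Suc n := k))) f =
    schubert_coeff (code_inv \<gamma>)
      (coeff (univariate (Suc n) f * (\<Prod>i<n. [:- Var (Suc i), 1:])) (n + k))"
proof -
  define q where "q = (\<Prod>i<n. [:- Var (Suc i), 1:]) * univariate (Suc n) f"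
  define H where "H b = divided_diffs (Suc 0) (n + k) (Var (Suc 0) ^ b)" for b
  have q_polys: "coeff q b \<in> polys n" for b
    unfolding q_def using coeff_univariate_polys[OF f]
    by (intro coeff_mult_polys coeff_prod_linear_polys) auto
  \<comment> \<open>The first n quotients, at the nodes x_1, ..., x_n, cancel exactly the inserted
    linear factors.\<close>
  have newton_q: "newton (Suc n) k (univariate (Suc n) f) = newton (Suc 0) (n + k) q"
    using newton_cancel[of "Suc 0" n "univariate (Suc n) f"] newton_newton[of "Suc 0" n k q]
    by (simp add: q_def)
  have H: "poly (newton (Suc 0) (n + k) (monom 1 b)) (Var (Suc n + k)) = H b" for b
  proof -
    have "Var (Suc 0) ^ b \<in> polys (Suc 0)" by (intro polys_power polys.Var) auto
    from divided_diffs_eq_newton[OF this, of "n + k"] show ?thesis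
      by (simp add: H_def univariate_Var monom_altdef)
  qed
  have "divided_diffs (Suc n) k f = poly (newton (Suc 0) (n + k) q) (Var (Suc n + k))"
    unfolding divided_diffs_eq_newton[OF f] newton_q ..
  also have "\<dots> = poly (newton (Suc 0) (n + k) (\<Sum>b\<le>degree q. smult (coeff q b) (monom 1 b))) (Var (Suc n + k))"
    using poly_as_sum_of_monoms[of q] by (simp add: smult_monom)
  also have "\<dots> = (\<Sum>b\<le>degree q. coeff q b * H b)"
    by (simp add: newton_sum newton_smult flip: H)
  finally have dd: "divided_diffs (Suc n) k f = (\<Sum>b\<le>degree q. coeff q b * H b)" .
  have sym: "swap_vars i (H b) = H b" if "1 \<le> i" "i < Suc n + k" for i b
    unfolding H_def divided_diffs_Var_power
    using that swap_vars_Sch[of "(\<lambda>_. 0)(Suc (n + k) := b - (n + k))" "Suc (n + k)" i]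
    by (auto simp: codes_def)
  have const: "const_term (H b) = (if b = n + k then 1 else 0)" for b
  proof -
    let ?c = "(\<lambda>_. 0)(Suc (n + k) := b - (n + k))"
    have c: "?c \<in> codes (Suc (n + k))" by (simp add: codes_def)
    have "code_inv ?c = id \<longleftrightarrow> ?c = (\<lambda>_. 0)"
      using code_inv_codes(2)[OF c] code_inv_0 lehmer_code_id by metis
    also have "\<dots> \<longleftrightarrow> b \<le> n + k"
      by (metis (no_types, lifting) diff_is_0_eq fun_upd_apply fun_upd_triv)
    finally show ?thesis
      unfolding H_def divided_diffs_Var_power
      using const_term_schubert[OF code_inv_codes(1)[OF c]] by auto
  qed
  obtain L where L: "dual (code_inv \<gamma>) L" and
    loc: "\<And>f s. (\<forall>i. 1 \<le> i \<longrightarrow> i < Suc n + k \<longrightarrow> swap_vars i s = s) \<Longrightarrow> L (f * s) = L f * const_term s"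
    using dual_exists[OF code_inv_box(1)[OF box]] by blast
  have "schubert_coeff (code_inv (\<gamma>(Suc n := k))) f =
      schubert_coeff (code_inv \<gamma>) (divided_diffs (Suc n) k f)"
    using schubert_coeff_divided_diffs[OF \<gamma> f order_refl] codes_upd_0[OF \<gamma>] by simp
  also have "\<dots> = L (divided_diffs (Suc n) k f)"
    by (rule schubert_coeff_eq[OF divided_diffs_polys[OF f] L])
  also have "\<dots> = (\<Sum>b\<le>degree q. L (coeff q b) * (if b = n + k then 1 else 0))"
    unfolding dd dual_sum[OF L] using loc sym const by (intro sum.cong) auto
  also have "\<dots> = (\<Sum>b\<le>degree q. if b = n + k then L (coeff q b) else 0)"
    by (rule sum.cong) auto
  \<comment> \<open>If n + k exceeds the degree, the sum has no such index, and the coefficient is 0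
    too; \<open>dual_0\<close> covers this case.\<close>
  also have "\<dots> = L (coeff q (n + k))"
    using dual_0[OF L] by (auto simp: sum.delta coeff_eq_0)
  also have "\<dots> = schubert_coeff (code_inv \<gamma>) (coeff q (n + k))"
    using schubert_coeff_eq[OF q_polys L] by simp
  finally show ?thesis unfolding q_def by (simp add: mult.commute)
qed

section \<open>Eventually polynomial and eventually affine sequences\<close>

text \<open>Rational coefficients allow integer-valued polynomials with denominators, and make
  \<open>ev_poly_divide\<close> possible.\<close>

definition ev_poly :: "(nat \<Rightarrow> int) \<Rightarrow> bool" where
  "ev_poly a \<longleftrightarrow> (\<exists>P :: rat poly. \<forall>\<^sub>F N in sequentially. of_int (a N) = poly P (of_nat N))"

lemma ev_polyI: "(\<And>N. of_int (a N) = poly P (of_nat N :: rat)) \<Longrightarrow> ev_poly a"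
  unfolding ev_poly_def by (intro exI[of _ P] always_eventually) simp

lemma ev_poly_const: "ev_poly (\<lambda>_. c)"
  by (rule ev_polyI[of _ "[:of_int c:]"]) simp

lemma ev_poly_add: "ev_poly a \<Longrightarrow> ev_poly b \<Longrightarrow> ev_poly (\<lambda>N. a N + b N)"
  unfolding ev_poly_def
proof (elim exE)
  fix P Q :: "rat poly"
  assume "\<forall>\<^sub>F N in sequentially. of_int (a N) = poly P (of_nat N)"
    and "\<forall>\<^sub>F N in sequentially. of_int (b N) = poly Q (of_nat N)"
  then show "\<exists>P :: rat poly. \<forall>\<^sub>F N in sequentially. of_int (a N + b N) = poly P (of_nat N)"
    by (intro exI[of _ "P + Q"]) (elim eventually_rev_mp, simp)
qed

lemma ev_poly_mult: "ev_poly a \<Longrightarrow> ev_poly b \<Longrightarrow> ev_poly (\<lambda>N. a N * b N)"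
  unfolding ev_poly_def
proof (elim exE)
  fix P Q :: "rat poly"
  assume "\<forall>\<^sub>F N in sequentially. of_int (a N) = poly P (of_nat N)"
    and "\<forall>\<^sub>F N in sequentially. of_int (b N) = poly Q (of_nat N)"
  then show "\<exists>P :: rat poly. \<forall>\<^sub>F N in sequentially. of_int (a N * b N) = poly P (of_nat N)"
    by (intro exI[of _ "P * Q"]) (elim eventually_rev_mp, simp)
qed

lemma ev_poly_divide:
  assumes "ev_poly a" "c \<noteq> 0" "\<forall>\<^sub>F N in sequentially. c * g N = a N"
  shows "ev_poly g"
proof -
  obtain P :: "rat poly" where P: "\<forall>\<^sub>F N in sequentially. of_int (a N) = poly P (of_nat N)"
    using assms(1) unfolding ev_poly_def by blast
  have "\<forall>\<^sub>F N in sequentially. of_int (g N) = poly (smult (inverse (of_int c)) P) (of_nat N)"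
    using P assms(3)
  proof eventually_elim
    case (elim N)
    have "of_int c * of_int (g N) = poly P (of_nat N)"
      using elim by (metis of_int_mult)
    then show ?case using assms(2) by (simp add: field_simps)
  qed
  then show ?thesis unfolding ev_poly_def by blast
qed

text \<open>The slope is natural because the values are; the intercept may be negative because
  \<open>code_down\<close> lowers entries.\<close>

definition affine :: "(nat \<Rightarrow> nat) \<Rightarrow> bool" where
  "affine k \<longleftrightarrow> (\<exists>(a::nat) (b::int). \<forall>\<^sub>F N in sequentially. int (k N) = int a * int N + b)"

lemma affineI: "\<forall>\<^sub>F N in sequentially. int (k N) = int a * int N + b \<Longrightarrow> affine k"
  unfolding affine_def by blast

lemma affine_linear: "affine (\<lambda>N. a * N + b)"
  by (rule affineI[of _ a "int b"]) simp

lemma affine_const: "affine (\<lambda>_. b)"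
  using affine_linear[of 0 b] by simp

lemma affine_id: "affine (\<lambda>N. N)"
  using affine_linear[of 1 0] by simp

lemma affine_add:
  assumes "affine j" "affine k" shows "affine (\<lambda>N. j N + k N)"
proof -
  obtain a b a' b' where
    "\<forall>\<^sub>F N in sequentially. int (j N) = int a * int N + b"
    "\<forall>\<^sub>F N in sequentially. int (k N) = int a' * int N + b'"
    using assms unfolding affine_def by blast
  then have "\<forall>\<^sub>F N in sequentially. int (j N + k N) = int (a + a') * int N + (b + b')"
    by eventually_elim (simp add: algebra_simps)
  then show ?thesis by (rule affineI)
qed

lemma affine_Suc: "affine k \<Longrightarrow> affine (\<lambda>N. Suc (k N))"
  using affine_add[OF _ affine_const[of 1]] by simp

lemma eventually_linear_sign:
  fixes a b :: int
  shows "(\<forall>\<^sub>F N in sequentially. 0 < a * int N + b) \<or> (\<forall>\<^sub>F N in sequentially. a * int N + b \<le> 0)"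
proof (cases "0 < a")
  case True
  have "\<forall>\<^sub>F N in sequentially. nat (1 - b) \<le> N" by (rule eventually_ge_at_top)
  then have "\<forall>\<^sub>F N in sequentially. 0 < a * int N + b"
  proof eventually_elim
    case (elim N)
    have "1 - b \<le> int N" using elim by simp
    also have "\<dots> \<le> a * int N" using True by (simp add: mult_le_cancel_right1)
    finally show ?case by simp
  qed
  then show ?thesis ..
next
  case False
  show ?thesis
  proof (cases "a = 0")
    case True
    then show ?thesis by (cases "0 < b") auto
  next
    case False
    have "\<forall>\<^sub>F N in sequentially. nat b \<le> N" by (rule eventually_ge_at_top)
    then have "\<forall>\<^sub>F N in sequentially. a * int N + b \<le> 0"
    proof eventually_elim
      case (elim N)
      have "b \<le> int N" using elim by simp
      also have "int N = 1 * int N" by simp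
      also have "\<dots> \<le> (- a) * int N"
        using False \<open>\<not> 0 < a\<close> by (intro mult_right_mono) auto
      finally show ?case by simp
    qed
    then show ?thesis ..
  qed
qed

text \<open>This dichotomy lets a case distinction be made once for a whole family instead of
  separately for each N.\<close>

lemma affine_less_cases:
  assumes "affine j" "affine k"
  shows "(\<forall>\<^sub>F N in sequentially. j N < k N) \<or> (\<forall>\<^sub>F N in sequentially. k N \<le> j N)"
proof -
  obtain a b a' b' where *:
    "\<forall>\<^sub>F N in sequentially. int (j N) = int a * int N + b"
    "\<forall>\<^sub>F N in sequentially. int (k N) = int a' * int N + b'"
    using assms unfolding affine_def by blast
  from eventually_linear_sign[of "int a' - int a" "b' - b"] show ?thesis
  proof
    assume "\<forall>\<^sub>F N in sequentially. 0 < (int a' - int a) * int N + (b' - b)"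
    with * have "\<forall>\<^sub>F N in sequentially. j N < k N"
      by eventually_elim (simp add: algebra_simps)
    then show ?thesis ..
  next
    assume "\<forall>\<^sub>F N in sequentially. (int a' - int a) * int N + (b' - b) \<le> 0"
    with * have "\<forall>\<^sub>F N in sequentially. k N \<le> j N"
      by eventually_elim (simp add: algebra_simps)
    then show ?thesis ..
  qed
qed

text \<open>Truncation matters only if the sequence is eventually 0, and then so is the
  result.\<close>

lemma affine_diff_1:
  assumes "affine k" shows "affine (\<lambda>N. k N - 1)"
  using affine_less_cases[OF affine_const[of 0] assms]
proof
  assume "\<forall>\<^sub>F N in sequentially. 0 < k N"
  moreover obtain a b where "\<forall>\<^sub>F N in sequentially. int (k N) = int a * int N + b"
    using assms unfolding affine_def by blast
  ultimately have "\<forall>\<^sub>F N in sequentially. int (k N - 1) = int a * int N + (b - 1)"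
    by eventually_elim (simp add: of_nat_diff)
  then show ?thesis by (rule affineI)
next
  assume "\<forall>\<^sub>F N in sequentially. k N \<le> 0"
  then have "\<forall>\<^sub>F N in sequentially. int (k N - 1) = int 0 * int N + 0"
    by eventually_elim simp
  then show ?thesis by (rule affineI)
qed

lemma affine_ev_poly:
  assumes "affine k" shows "ev_poly (\<lambda>N. int (k N))"
proof -
  obtain a b where "\<forall>\<^sub>F N in sequentially. int (k N) = int a * int N + b"
    using assms unfolding affine_def by blast
  then have "\<forall>\<^sub>F N in sequentially. of_int (int (k N)) = poly [:of_int b, of_nat a :: rat:] (of_nat N)"
  proof eventually_elim
    case (elim N)
    show ?case unfolding elim by simp
  qed
  then show ?thesis unfolding ev_poly_def by blast
qed

section \<open>Tame families\<close>

inductive expo :: "'a::comm_ring_1 set \<Rightarrow> (nat \<Rightarrow> 'a) \<Rightarrow> bool" for S where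
  scalar: "ev_poly a \<Longrightarrow> expo S (\<lambda>N. of_int (a N))"
| var: "x \<in> S \<Longrightarrow> expo S (\<lambda>N. x)"
| pow: "x \<in> S \<Longrightarrow> expo S (\<lambda>N. x ^ N)"
| add: "expo S F \<Longrightarrow> expo S G \<Longrightarrow> expo S (\<lambda>N. F N + G N)"
| mult: "expo S F \<Longrightarrow> expo S G \<Longrightarrow> expo S (\<lambda>N. F N * G N)"

text \<open>Products are not included since \<open>tame\<close> divides by one factor at a time. The
  powers x and x^N together account for negative affine exponents.\<close>

inductive denominator :: "'a::comm_ring_1 set \<Rightarrow> (nat \<Rightarrow> 'a) \<Rightarrow> bool" for S where
  const: "c \<noteq> 0 \<Longrightarrow> denominator S (\<lambda>N. of_int c)"
| var: "x \<in> S \<Longrightarrow> denominator S (\<lambda>N. x)"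
| pow: "x \<in> S \<Longrightarrow> denominator S (\<lambda>N. x ^ N)"
| diff: "x \<in> S \<Longrightarrow> y \<in> S \<Longrightarrow> x \<noteq> y \<Longrightarrow> denominator S (\<lambda>N. x - y)"

text \<open>A fraction is recorded by a chain of equations q F = H inside the ring, so homomorphisms
  can be applied to it directly.\<close>

inductive tame :: "'a::comm_ring_1 set \<Rightarrow> (nat \<Rightarrow> 'a) \<Rightarrow> bool" for S where
  expo: "expo S F \<Longrightarrow> tame S F"
| quotient: "denominator S q \<Longrightarrow> tame S H \<Longrightarrow> \<forall>\<^sub>F N in sequentially. q N * F N = H N \<Longrightarrow> tame S F"

lemma expo_const: "expo S (\<lambda>N. of_int c)"
  using expo.scalar[OF ev_poly_const] .

lemma expo_denominator: "denominator S q \<Longrightarrow> expo S q"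
proof (induction rule: denominator.induct)
  case (diff x y)
  have "expo S (\<lambda>N. x + of_int (-1) * y)"
    using diff by (intro expo.add expo.mult expo_const expo.var)
  then show ?case by simp
qed (auto intro: expo.intros expo_const)

lemma tame_of_int: "tame S (\<lambda>N. of_int c)"
  by (intro tame.expo expo_const)

lemma tame_0: "tame S (\<lambda>N. 0)" and tame_1: "tame S (\<lambda>N. 1)"
  using tame_of_int[of S 0] tame_of_int[of S 1] by simp_all

lemma tame_cong:
  assumes "tame S F" "\<forall>\<^sub>F N in sequentially. G N = F N" shows "tame S G"
proof (rule tame.quotient[of S "\<lambda>N. of_int 1" F])
  show "denominator S (\<lambda>N. of_int 1)" by (rule denominator.const) simp
  show "\<forall>\<^sub>F N in sequentially. of_int 1 * G N = F N" using assms(2) by simp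
qed (rule assms)

lemma tame_mult:
  assumes "tame S F" "tame S G"
  shows "tame S (\<lambda>N. F N * G N)"
  using assms(1)
proof (induction rule: tame.induct)
  case (expo F)
  from assms(2) show ?case
  proof (induction rule: tame.induct)
    case (expo G)
    then show ?case by (intro tame.expo expo.mult \<open>expo S F\<close>)
  next
    case (quotient q H G)
    from quotient.hyps(3) have "\<forall>\<^sub>F N in sequentially. q N * (F N * G N) = F N * H N"
      by eventually_elim (simp add: mult.left_commute)
    with quotient.hyps(1) quotient.IH show ?case by (rule tame.quotient)
  qed
next
  case (quotient q H F)
  from quotient.hyps(3) have "\<forall>\<^sub>F N in sequentially. q N * (F N * G N) = H N * G N"
    by eventually_elim (simp flip: mult.assoc)
  with quotient.hyps(1) quotient.IH show ?case by (rule tame.quotient)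
qed

lemma tame_add:
  assumes "tame S F" "tame S G"
  shows "tame S (\<lambda>N. F N + G N)"
  using assms
proof (induction arbitrary: G rule: tame.induct)
  case (expo F)
  from expo.prems expo.hyps show ?case
  proof (induction arbitrary: F rule: tame.induct)
    case (expo G)
    then show ?case by (intro tame.expo expo.add)
  next
    case (quotient q H G)
    have "tame S (\<lambda>N. q N * F N + H N)"
      using quotient.prems expo_denominator[OF quotient.hyps(1)] by (intro quotient.IH expo.mult)
    moreover from quotient.hyps(3) have "\<forall>\<^sub>F N in sequentially. q N * (F N + G N) = q N * F N + H N"
      by eventually_elim (simp add: distrib_left)
    ultimately show ?case by (rule tame.quotient[OF quotient.hyps(1)])
  qed
next
  case (quotient q H F)
  have "tame S (\<lambda>N. H N + q N * G N)"
    using quotient.prems expo_denominator[OF quotient.hyps(1)]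
    by (intro quotient.IH tame_mult[OF tame.expo])
  moreover from quotient.hyps(3) have "\<forall>\<^sub>F N in sequentially. q N * (F N + G N) = H N + q N * G N"
    by eventually_elim (simp add: distrib_left)
  ultimately show ?case by (rule tame.quotient[OF quotient.hyps(1)])
qed

lemma tame_uminus: "tame S F \<Longrightarrow> tame S (\<lambda>N. - F N)"
  using tame_mult[OF tame_of_int[of S "-1"], of F] by simp

lemma tame_diff: "tame S F \<Longrightarrow> tame S G \<Longrightarrow> tame S (\<lambda>N. F N - G N)"
  using tame_add[OF _ tame_uminus, of S F G] by simp

lemma tame_power: "tame S F \<Longrightarrow> tame S (\<lambda>N. F N ^ m)"
  by (induction m) (auto intro: tame_1 tame_mult)

lemma tame_prod:
  "(\<And>i. i \<in> A \<Longrightarrow> tame S (F i)) \<Longrightarrow> tame S (\<lambda>N. \<Prod>i\<in>A. F i N)"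
  by (induction A rule: infinite_finite_induct) (auto intro: tame_1 tame_mult)

lemma tame_var: "x \<in> S \<Longrightarrow> tame S (\<lambda>N. x)"
  by (intro tame.expo expo.var)

lemma tame_quotient_exact:
  "denominator S q \<Longrightarrow> tame S (\<lambda>N. q N * F N) \<Longrightarrow> tame S F"
  by (erule (1) tame.quotient) simp

lemma tame_quotient_power:
  "denominator S q \<Longrightarrow> tame S (\<lambda>N. q N ^ m * F N) \<Longrightarrow> tame S F"
proof (induction m)
  case (Suc m)
  have "tame S (\<lambda>N. q N ^ m * F N)"
    using Suc.prems by (rule tame.quotient) (simp add: mult.assoc)
  with Suc show ?case by blast
qed simp

text \<open>A negative intercept b is moved to the left: m is the negative part of b and n its
  positive part.\<close>

lemma affine_power_eq:
  fixes x :: "'a::comm_ring_1"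
  assumes "affine k"
  obtains a m n where "\<forall>\<^sub>F N in sequentially. x ^ m * x ^ k N = (x ^ N) ^ a * x ^ n"
proof -
  obtain a b where ab: "\<forall>\<^sub>F N in sequentially. int (k N) = int a * int N + b"
    using assms unfolding affine_def by blast
  have "\<forall>\<^sub>F N in sequentially. x ^ nat (- b) * x ^ k N = (x ^ N) ^ a * x ^ nat b"
    using ab
  proof eventually_elim
    case (elim N)
    then have "int (nat (- b) + k N) = int (N * a + nat b)" by (simp add: algebra_simps)
    then have "nat (- b) + k N = N * a + nat b" by (simp only: of_nat_eq_iff)
    then show ?case by (simp flip: power_add power_mult)
  qed
  then show thesis by (rule that)
qed

lemma tame_power_affine:
  assumes x: "x \<in> S" and k: "affine k"
  shows "tame S (\<lambda>N. x ^ k N)"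
proof -
  obtain a m n where *: "\<forall>\<^sub>F N in sequentially. x ^ m * x ^ k N = (x ^ N) ^ a * x ^ n"
    using affine_power_eq[OF k] .
  have "tame S (\<lambda>N. (x ^ N) ^ a * x ^ n)"
    by (intro tame_mult tame_power tame_var[OF x] tame.expo[OF expo.pow[OF x]])
  then have "tame S (\<lambda>N. x ^ m * x ^ k N)" using * by (rule tame_cong)
  then show ?thesis by (rule tame_quotient_power[OF denominator.var[OF x]])
qed

lemma tame_quotient_power_affine:
  assumes x: "x \<in> S" and k: "affine k" and F: "tame S (\<lambda>N. x ^ k N * F N)"
  shows "tame S F"
proof -
  obtain a m n where *: "\<forall>\<^sub>F N in sequentially. x ^ m * x ^ k N = (x ^ N) ^ a * x ^ n"
    using affine_power_eq[OF k] .
  have "tame S (\<lambda>N. x ^ m * (x ^ k N * F N))"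
    by (intro tame_mult tame_power tame_var[OF x] F)
  moreover have "\<forall>\<^sub>F N in sequentially. x ^ n * ((x ^ N) ^ a * F N) = x ^ m * (x ^ k N * F N)"
    using *
  proof eventually_elim
    case (elim N)
    have "x ^ n * ((x ^ N) ^ a * F N) = (x ^ N) ^ a * x ^ n * F N" by (simp only: mult_ac)
    also have "\<dots> = x ^ m * (x ^ k N * F N)" unfolding elim[symmetric] by (simp only: mult_ac)
    finally show ?case .
  qed
  ultimately have "tame S (\<lambda>N. x ^ n * ((x ^ N) ^ a * F N))" by (rule tame_cong)
  then have "tame S (\<lambda>N. (x ^ N) ^ a * F N)"
    by (rule tame_quotient_power[OF denominator.var[OF x]])
  then show ?thesis by (rule tame_quotient_power[OF denominator.pow[OF x]])
qed

text \<open>Injectivity on S keeps the two variables of a difference denominator distinct.\<close>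

lemma (in unital_hom) tame_image:
  assumes "h ` S \<subseteq> S'" "inj_on h S" "tame S F"
  shows "tame S' (\<lambda>N. h (F N))"
  using assms(3)
proof (induction rule: tame.induct)
  case (expo F)
  then have "expo S' (\<lambda>N. h (F N))"
    by (induction rule: expo.induct) (use assms(1) in \<open>auto intro: expo.intros\<close>)
  then show ?case by (rule tame.expo)
next
  case (quotient q H F)
  from quotient.hyps(1) have "denominator S' (\<lambda>N. h (q N))"
  proof cases
    case (diff x y)
    then show ?thesis
      using assms(1) inj_onD[OF assms(2), of x y] by (auto intro!: denominator.diff)
  qed (use assms(1) in \<open>auto intro: denominator.intros\<close>)
  moreover from quotient.hyps(3) have "\<forall>\<^sub>F N in sequentially. h (q N) * h (F N) = h (H N)"
    by eventually_elim (metis mult)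
  ultimately show ?case by (rule tame.quotient[OF _ quotient.IH])
qed

text \<open>Only constant denominators remain, and c is their product.\<close>

lemma tame_no_vars:
  fixes F :: "nat \<Rightarrow> 'a::{idom,ring_char_0}"
  assumes "tame {} F"
  shows "\<exists>c a. c \<noteq> 0 \<and> ev_poly a \<and> (\<forall>\<^sub>F N in sequentially. of_int c * F N = of_int (a N))"
  using assms
proof (induction rule: tame.induct)
  case (expo F)
  then have "\<exists>a. ev_poly a \<and> F = (\<lambda>N. of_int (a N))"
  proof (induction rule: expo.induct)
    case (add F G)
    then obtain a b where "ev_poly a" "F = (\<lambda>N. of_int (a N))" "ev_poly b" "G = (\<lambda>N. of_int (b N))"
      by blast
    then show ?case by (intro exI[of _ "\<lambda>N. a N + b N"]) (simp add: ev_poly_add)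
  next
    case (mult F G)
    then obtain a b where "ev_poly a" "F = (\<lambda>N. of_int (a N))" "ev_poly b" "G = (\<lambda>N. of_int (b N))"
      by blast
    then show ?case by (intro exI[of _ "\<lambda>N. a N * b N"]) (simp add: ev_poly_mult)
  qed auto
  then obtain a where "ev_poly a" "F = (\<lambda>N. of_int (a N))" by blast
  then show ?case by (intro exI[of _ 1] exI[of _ a]) simp
next
  case (quotient q H F)
  then obtain c a where ca: "c \<noteq> 0" "ev_poly a" "\<forall>\<^sub>F N in sequentially. of_int c * H N = of_int (a N)"
    by blast
  from quotient.hyps(1) obtain d where d: "d \<noteq> 0" "q = (\<lambda>N. of_int d)"
    by cases auto
  from ca(3) quotient.hyps(3) have "\<forall>\<^sub>F N in sequentially. of_int (c * d) * F N = of_int (a N)"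
    by eventually_elim (simp add: d(2) mult.assoc)
  then show ?case using ca(1,2) d(1) by (intro exI[of _ "c * d"] exI[of _ a]) simp
qed

lemma tame_no_vars_ev_poly:
  assumes "tame {} (\<lambda>N. of_int (g N) :: 'a::{idom,ring_char_0})"
  shows "ev_poly g"
proof -
  obtain c a where ca: "c \<noteq> 0" "ev_poly a"
    "\<forall>\<^sub>F N in sequentially. of_int c * of_int (g N) = (of_int (a N) :: 'a)"
    using tame_no_vars[OF assms] by blast
  from ca(3) have "\<forall>\<^sub>F N in sequentially. c * g N = a N"
  proof eventually_elim
    case (elim N)
    then have "of_int (c * g N) = (of_int (a N) :: 'a)" by simp
    then show ?case by (simp only: of_int_eq_iff)
  qed
  with ca(2,1) show ?thesis by (rule ev_poly_divide)
qed

section \<open>Evaluation and coefficients of tame families of polynomials\<close>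

text \<open>The variables for families of univariate polynomials: the indeterminate X and the old
  variables as constants.\<close>

definition lift_vars :: "'a::comm_ring_1 set \<Rightarrow> 'a poly set" where
  "lift_vars S = insert [:0, 1:] ((\<lambda>c. [:c:]) ` S)"

lemma lift_varsI: "[:0, 1:] \<in> lift_vars S" "x \<in> S \<Longrightarrow> [:x:] \<in> lift_vars S"
  by (auto simp: lift_vars_def)

lemma lift_varsE:
  assumes "x \<in> lift_vars S"
  obtains "x = [:0, 1:]" | a where "a \<in> S" "x = [:a:]"
  using assms unfolding lift_vars_def by blast

lemma X_power_eq_monom: "[:0, 1:] ^ k = monom 1 k"
  by (simp add: monom_altdef)

lemma tame_const_poly: "tame S F \<Longrightarrow> tame (lift_vars S) (\<lambda>N. [:F N:])"
proof -
  have "unital_hom (\<lambda>c::'a. [:c:])" by standard simp_all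
  then show "tame S F \<Longrightarrow> ?thesis"
    by (rule unital_hom.tame_image) (auto simp: lift_vars_def inj_on_def)
qed

text \<open>
  Division by \<open>X - s\<close> loses information under the substitution \<open>X = s\<close>, so the derivatives at
  \<open>s\<close> have to be controlled as well.
\<close>

primrec jet_tame :: "'a::{idom,ring_char_0} set \<Rightarrow> 'a \<Rightarrow> nat \<Rightarrow> (nat \<Rightarrow> 'a poly) \<Rightarrow> bool" where
  "jet_tame S s 0 F \<longleftrightarrow> tame S (\<lambda>N. poly (F N) s)"
| "jet_tame S s (Suc r) F \<longleftrightarrow> tame S (\<lambda>N. poly (F N) s) \<and> jet_tame S s r (\<lambda>N. pderiv (F N))"

lemma jet_tame_eval: "jet_tame S s r F \<Longrightarrow> tame S (\<lambda>N. poly (F N) s)"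
  by (cases r) auto

lemma jet_tame_weaken: "jet_tame S s (Suc r) F \<Longrightarrow> jet_tame S s r F"
  by (induction r arbitrary: F) auto

lemma jet_tame_iff:
  "jet_tame S s r F \<longleftrightarrow> (\<forall>j\<le>r. tame S (\<lambda>N. poly ((pderiv ^^ j) (F N)) s))"
proof (induction r arbitrary: F)
  case (Suc r)
  have split: "(\<forall>j\<le>Suc r. P j) \<longleftrightarrow> P 0 \<and> (\<forall>j\<le>r. P (Suc j))" for P :: "nat \<Rightarrow> bool"
  proof (intro iffI allI impI)
    fix j assume "P 0 \<and> (\<forall>j\<le>r. P (Suc j))" "j \<le> Suc r"
    then show "P j" by (cases j) auto
  qed auto
  show ?case unfolding split jet_tame.simps Suc by (simp add: funpow_swap1)
qed simp

lemma jet_tame_cong: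
  assumes "jet_tame S s r F" "\<forall>\<^sub>F N in sequentially. G N = F N"
  shows "jet_tame S s r G"
  unfolding jet_tame_iff
proof (intro allI impI)
  fix j assume "j \<le> r"
  then have "tame S (\<lambda>N. poly ((pderiv ^^ j) (F N)) s)"
    using assms(1) unfolding jet_tame_iff by blast
  then show "tame S (\<lambda>N. poly ((pderiv ^^ j) (G N)) s)"
    by (rule tame_cong) (use assms(2) in \<open>eventually_elim, simp\<close>)
qed

lemma jet_tame_add:
  "jet_tame S s r F \<Longrightarrow> jet_tame S s r G \<Longrightarrow> jet_tame S s r (\<lambda>N. F N + G N)"
  by (induction r arbitrary: F G) (auto simp: pderiv_add intro: tame_add)

lemma jet_tame_mult:
  "jet_tame S s r F \<Longrightarrow> jet_tame S s r G \<Longrightarrow> jet_tame S s r (\<lambda>N. F N * G N)"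
proof (induction r arbitrary: F G)
  case (Suc r)
  have "jet_tame S s r (\<lambda>N. F N * pderiv (G N))" "jet_tame S s r (\<lambda>N. G N * pderiv (F N))"
    using Suc.prems jet_tame_weaken[OF Suc.prems(1)] jet_tame_weaken[OF Suc.prems(2)]
    by (auto intro: Suc.IH)
  then show ?case
    using Suc.prems by (auto simp: pderiv_mult intro: tame_mult jet_tame_add)
qed (auto intro: tame_mult)

lemma jet_tame_const: "tame S G \<Longrightarrow> jet_tame S s r (\<lambda>N. [:G N:])"
proof (induction r arbitrary: G)
  case (Suc r)
  then show ?case using Suc.IH[OF tame_0] by (simp add: pderiv_pCons)
qed simp

lemma jet_tame_uminus: "jet_tame S s r F \<Longrightarrow> jet_tame S s r (\<lambda>N. - F N)"
  using jet_tame_mult[OF jet_tame_const[OF tame_of_int[of S "-1"]], of s r F] by simp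

lemma jet_tame_diff:
  "jet_tame S s r F \<Longrightarrow> jet_tame S s r G \<Longrightarrow> jet_tame S s r (\<lambda>N. F N - G N)"
  using jet_tame_add[OF _ jet_tame_uminus, of S s r F G] by simp

lemma tame_of_nat_affine:
  assumes "affine k" shows "tame S (\<lambda>N. of_nat (k N))"
  using tame.expo[OF expo.scalar[OF affine_ev_poly[OF assms]], of S] by simp

lemma pderiv_X_power: "pderiv ([:0, 1:] ^ k) = [:of_nat k:] * [:0, 1:] ^ (k - 1)"
  by (simp only: X_power_eq_monom pderiv_monom mult_pCons_left mult_zero_left smult_monom
      mult_1_right pCons_0_0 add_0_right)

lemma jet_tame_X_power:
  assumes "s \<in> S" "affine k" shows "jet_tame S s r (\<lambda>N. [:0, 1:] ^ k N)"
  using assms(2)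
proof (induction r arbitrary: k)
  case 0
  then show ?case using tame_power_affine[OF assms(1)] by simp
next
  case (Suc r)
  have "jet_tame S s r (\<lambda>N. [:of_nat (k N):] * [:0, 1:] ^ (k N - 1))"
    by (intro jet_tame_mult jet_tame_const tame_of_nat_affine Suc.prems Suc.IH affine_diff_1)
  then have "jet_tame S s r (\<lambda>N. pderiv ([:0, 1:] ^ k N))"
    unfolding pderiv_X_power .
  then show ?case using tame_power_affine[OF assms(1) Suc.prems] by simp
qed

lemma jet_tame_X: "s \<in> S \<Longrightarrow> jet_tame S s r (\<lambda>N. [:0, 1:])"
  using jet_tame_X_power[OF _ affine_const[of 1]] by simp

lemma jet_tame_expo:
  assumes "s \<in> S" "expo (lift_vars S) F"
  shows "jet_tame S s r F"
  using assms(2)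
proof (induction rule: expo.induct)
  case (scalar a)
  then show ?case
    using jet_tame_const[OF tame.expo[OF expo.scalar], of a S s r] by (simp only: of_int_poly)
next
  case (var x)
  then show ?case
  proof (cases rule: lift_varsE)
    case 1
    show ?thesis unfolding 1 by (rule jet_tame_X[OF assms(1)])
  next
    case (2 a)
    show ?thesis unfolding 2 by (intro jet_tame_const tame_var 2)
  qed
next
  case (pow x)
  then show ?case
  proof (cases rule: lift_varsE)
    case 1
    show ?thesis unfolding 1 by (rule jet_tame_X_power[OF assms(1) affine_id])
  next
    case (2 a)
    show ?thesis unfolding 2 poly_const_pow by (intro jet_tame_const tame.expo expo.pow 2)
  qed
qed (auto intro: jet_tame_add jet_tame_mult)

text \<open>By q F' = (q F)' - F q' the derivatives of F are solved for successively, each time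
  dividing by q(s).\<close>

lemma jet_tame_quotient:
  assumes "denominator S (\<lambda>N. poly (q N) s)" "\<And>r. jet_tame S s r q"
  shows "jet_tame S s r (\<lambda>N. q N * F N) \<Longrightarrow> jet_tame S s r F"
proof (induction r arbitrary: F)
  case 0
  then have "tame S (\<lambda>N. poly (q N) s * poly (F N) s)" by simp
  then have "tame S (\<lambda>N. poly (F N) s)"
    by (rule tame.quotient[OF assms(1)]) simp
  then show ?case by simp
next
  case (Suc r)
  have F: "jet_tame S s r F"
    using Suc.IH jet_tame_weaken[OF Suc.prems] by blast
  have "jet_tame S s r (\<lambda>N. pderiv (q N * F N) - F N * pderiv (q N))"
    using Suc.prems assms(2)[of "Suc r"] F by (intro jet_tame_diff jet_tame_mult) simp_all
  then have "jet_tame S s r (\<lambda>N. q N * pderiv (F N))" by (simp add: pderiv_mult)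
  then have "jet_tame S s r (\<lambda>N. pderiv (F N))" by (rule Suc.IH)
  with F show ?case by (simp add: jet_tame_eval)
qed

lemma funpow_pderiv_linear_mult:
  fixes p :: "'a::{idom,ring_char_0} poly"
  shows "(pderiv ^^ Suc j) ([:- s, 1:] * p) =
    [:- s, 1:] * (pderiv ^^ Suc j) p + of_nat (Suc j) * (pderiv ^^ j) p"
proof (induction j)
  case 0
  show ?case by (simp add: pderiv_mult pderiv_pCons del: mult_pCons_left)
next
  case (Suc j)
  have "(pderiv ^^ Suc (Suc j)) ([:- s, 1:] * p) =
      pderiv ([:- s, 1:] * (pderiv ^^ Suc j) p + of_nat (Suc j) * (pderiv ^^ j) p)"
    using Suc by simp
  also have "\<dots> = [:- s, 1:] * (pderiv ^^ Suc (Suc j)) p + of_nat (Suc (Suc j)) * (pderiv ^^ Suc j) p"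
    by (simp add: pderiv_add pderiv_mult pderiv_pCons distrib_right del: mult_pCons_left)
  finally show ?case .
qed

text \<open>At s the derivative of order j + 1 of (X - s) F is j + 1 times the j-th derivative of F.
  One order is lost, hence the hypothesis for all r; j + 1 becomes a constant denominator.\<close>

lemma jet_tame_quotient_linear:
  assumes "\<And>r. jet_tame S s r (\<lambda>N. [:- s, 1:] * F N)"
  shows "jet_tame S s r F"
  unfolding jet_tame_iff
proof (intro allI impI)
  fix j
  have "tame S (\<lambda>N. poly ((pderiv ^^ Suc j) ([:- s, 1:] * F N)) s)"
    using assms[of "Suc j"] unfolding jet_tame_iff by blast
  then have "tame S (\<lambda>N. of_int (int (Suc j)) * poly ((pderiv ^^ j) (F N)) s)"
    unfolding funpow_pderiv_linear_mult by simp
  then show "tame S (\<lambda>N. poly ((pderiv ^^ j) (F N)) s)"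
    by (rule tame.quotient[OF denominator.const[of "int (Suc j)"], rotated]) simp_all
qed

lemma jet_tame_tame:
  assumes s: "s \<in> S" and F: "tame (lift_vars S) F"
  shows "jet_tame S s r F"
  using F
proof (induction arbitrary: r rule: tame.induct)
  case (expo F)
  then show ?case by (rule jet_tame_expo[OF s])
next
  case (quotient q H F)
  have qF: "jet_tame S s r (\<lambda>N. q N * F N)" for r
    using quotient.IH quotient.hyps(3) by (rule jet_tame_cong)
  have q: "jet_tame S s r q" for r
    using expo_denominator[OF quotient.hyps(1)] by (rule jet_tame_expo[OF s])
  \<comment> \<open>This covers every denominator whose value at s is again a denominator; X - s and
    s - X are the exceptions.\<close>
  have nondegenerate: "jet_tame S s r F" if "denominator S d" "\<And>N. poly (q N) s = d N" for d
  proof -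
    have "(\<lambda>N. poly (q N) s) = d" using that(2) by (rule ext)
    with that(1) have "denominator S (\<lambda>N. poly (q N) s)" by (simp only:)
    then show ?thesis using q qF by (rule jet_tame_quotient)
  qed
  from quotient.hyps(1) show ?case
  proof cases
    case (const c)
    show ?thesis by (rule nondegenerate[OF denominator.const[OF const(2)]]) (simp add: const(1))
  next
    case (var x)
    from var(2) show ?thesis
    proof (cases rule: lift_varsE)
      case 1
      show ?thesis by (rule nondegenerate[OF denominator.var[OF s]]) (simp add: var(1) 1)
    next
      case (2 a)
      show ?thesis by (rule nondegenerate[OF denominator.var[OF 2(1)]]) (simp add: var(1) 2(2))
    qed
  next
    case (pow x)
    from pow(2) show ?thesis
    proof (cases rule: lift_varsE)
      case 1
      show ?thesis by (rule nondegenerate[OF denominator.pow[OF s]]) (simp add: pow(1) 1)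
    next
      case (2 a)
      show ?thesis by (rule nondegenerate[OF denominator.pow[OF 2(1)]]) (simp add: pow(1) 2(2))
    qed
  next
    case (diff x y)
    from diff(2) show ?thesis
    proof (cases rule: lift_varsE)
      case x: 1
      from diff(3) show ?thesis
      proof (cases rule: lift_varsE)
        case 1
        then show ?thesis using x diff(4) by simp
      next
        case (2 a)
        show ?thesis
        proof (cases "a = s")
          case True
          have "q N = [:- s, 1:]" for N by (simp add: diff(1) x 2(2) True)
          then have "jet_tame S s r (\<lambda>N. [:- s, 1:] * F N)" for r
            using qF[of r] by (simp only:)
          then show ?thesis by (rule jet_tame_quotient_linear)
        next
          case False
          show ?thesis
            by (rule nondegenerate[OF denominator.diff[OF s 2(1) False[symmetric]]])
              (simp add: diff(1) x 2(2))
        qed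
      qed
    next
      case x: (2 a)
      from diff(3) show ?thesis
      proof (cases rule: lift_varsE)
        case 1
        show ?thesis
        proof (cases "a = s")
          case True
          have minus_q: "- q N = [:- s, 1:]" for N by (simp add: diff(1) x(2) 1 True)
          have "- (q N * F N) = [:- s, 1:] * F N" for N
            by (rule trans[OF minus_mult_left]) (rule arg_cong[OF minus_q, of "\<lambda>p. p * F N"])
          then have "jet_tame S s r (\<lambda>N. [:- s, 1:] * F N)" for r
            using jet_tame_uminus[OF qF[of r]] by (simp only:)
          then show ?thesis by (rule jet_tame_quotient_linear)
        next
          case False
          show ?thesis
            by (rule nondegenerate[OF denominator.diff[OF x(1) s False]]) (simp add: diff(1) x(2) 1)
        qed
      next
        case (2 b)
        have neq: "a \<noteq> b" using diff(4) unfolding x(2) 2(2) by simp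
        show ?thesis
          by (rule nondegenerate[OF denominator.diff[OF x(1) 2(1) neq]]) (simp add: diff(1) x(2) 2(2))
      qed
    qed
  qed
qed

lemma tame_eval: "s \<in> S \<Longrightarrow> tame (lift_vars S) F \<Longrightarrow> tame S (\<lambda>N. poly (F N) s)"
  for S :: "'a::{idom,ring_char_0} set"
  using jet_tame_tame jet_tame_eval by blast

text \<open>Normal form of \<open>expo\<close> families in X. Coefficients and truncations are read
  off by comparing affine exponents.\<close>

inductive monom_sum :: "'a::comm_ring_1 set \<Rightarrow> (nat \<Rightarrow> 'a poly) \<Rightarrow> bool" for S where
  monom: "expo S G \<Longrightarrow> affine k \<Longrightarrow> monom_sum S (\<lambda>N. monom (G N) (k N))"
| add: "monom_sum S F \<Longrightarrow> monom_sum S G \<Longrightarrow> monom_sum S (\<lambda>N. F N + G N)"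

lemma monom_sum_mult:
  assumes "monom_sum S F" "monom_sum S G" shows "monom_sum S (\<lambda>N. F N * G N)"
  using assms(1)
proof (induction rule: monom_sum.induct)
  case (monom c k)
  from assms(2) show ?case
  proof (induction rule: monom_sum.induct)
    case (monom d l)
    have "monom_sum S (\<lambda>N. monom (c N * d N) (k N + l N))"
      using monom \<open>expo S c\<close> \<open>affine k\<close> by (intro monom_sum.monom expo.mult affine_add)
    then show ?case by (simp add: mult_monom)
  qed (auto simp: distrib_left intro: monom_sum.add)
qed (auto simp: distrib_right intro: monom_sum.add)

lemma expo_monom_sum:
  assumes "expo (lift_vars S) F" shows "monom_sum S F"
proof -
  have const: "monom_sum S (\<lambda>N. [:G N:])" if "expo S G" for G
    using monom_sum.monom[OF that affine_const[of 0]] by (simp add: monom_0)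
  have X: "monom_sum S (\<lambda>N. [:0, 1:] ^ k N)" if "affine k" for k
    using monom_sum.monom[OF expo_const[of S 1] that] by (simp only: X_power_eq_monom of_int_1)
  from assms show ?thesis
  proof (induction rule: expo.induct)
    case (scalar a)
    show ?case using const[OF expo.scalar[OF scalar]] by (simp only: of_int_poly)
  next
    case (var x)
    then show ?case
    proof (cases rule: lift_varsE)
      case 1
      show ?thesis using X[OF affine_const[of 1]] unfolding 1 power_one_right .
    next
      case (2 a)
      show ?thesis unfolding 2 by (intro const expo.var 2)
    qed
  next
    case (pow x)
    then show ?case
    proof (cases rule: lift_varsE)
      case 1
      show ?thesis unfolding 1 by (rule X[OF affine_id])
    next
      case (2 a)
      show ?thesis unfolding 2 poly_const_pow by (intro const expo.pow 2)
    qed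
  qed (auto intro: monom_sum.add monom_sum_mult)
qed

lemma tame_monom:
  assumes "tame S G" "affine k"
  shows "tame (lift_vars S) (\<lambda>N. monom (G N) (k N))"
proof -
  have "tame (lift_vars S) (\<lambda>N. [:G N:] * [:0, 1:] ^ k N)"
    by (intro tame_mult tame_const_poly tame_power_affine lift_varsI assms)
  then show ?thesis by (simp add: monom_altdef)
qed

section \<open>Truncations and coefficients at affine indices\<close>

lemma poly_cutoff_add: "poly_cutoff k (p + q) = poly_cutoff k p + poly_cutoff k q"
  by (simp add: poly_eq_iff coeff_poly_cutoff)

lemma poly_cutoff_uminus: "poly_cutoff k (- p) = - poly_cutoff k p"
  for p :: "'a::comm_ring_1 poly"
  by (simp add: poly_eq_iff coeff_poly_cutoff)

lemma poly_cutoff_const_mult: "poly_cutoff k ([:c:] * p) = [:c:] * poly_cutoff k p"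
  by (simp add: poly_eq_iff coeff_poly_cutoff)

lemma poly_cutoff_X_mult: "poly_cutoff (k + m) ([:0, 1:] ^ m * p) = [:0, 1:] ^ m * poly_cutoff k p"
  for p :: "'a::comm_ring_1 poly"
  unfolding X_power_eq_monom
  by (auto simp: poly_eq_iff coeff_poly_cutoff coeff_monom_mult)

lemma poly_cutoff_Suc: "poly_cutoff (Suc k) p = poly_cutoff k p + monom (coeff p k) k"
  by (auto simp: poly_eq_iff coeff_poly_cutoff less_Suc_eq)

text \<open>Only the boundary term of degree k + 1 is cut off. At X = a the first summand vanishes,
  which isolates the coefficient of X^k.\<close>

lemma poly_cutoff_linear_mult:
  "poly_cutoff (Suc k) ([:- a, 1:] * p) =
    [:- a, 1:] * poly_cutoff (Suc k) p - monom (coeff p k) (Suc k)"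
  for p :: "'a::comm_ring_1 poly"
  by (auto simp: poly_eq_iff coeff_poly_cutoff coeff_pCons split: nat.split)

text \<open>The two properties are carried together: division by X - a gets a coefficient from a
  truncation of the product, and then the truncation of the quotient from that coefficient.\<close>

definition coeffs_tame :: "'a::comm_ring_1 set \<Rightarrow> (nat \<Rightarrow> 'a poly) \<Rightarrow> bool" where
  "coeffs_tame S F \<longleftrightarrow> (\<forall>k. affine k \<longrightarrow>
    tame S (\<lambda>N. coeff (F N) (k N)) \<and> tame (lift_vars S) (\<lambda>N. poly_cutoff (k N) (F N)))"

lemma coeffs_tameI:
  assumes "\<And>k. affine k \<Longrightarrow> tame S (\<lambda>N. coeff (F N) (k N))"
    and "\<And>k. affine k \<Longrightarrow> tame (lift_vars S) (\<lambda>N. poly_cutoff (k N) (F N))"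
  shows "coeffs_tame S F"
  unfolding coeffs_tame_def using assms by blast

lemma coeffs_tameD:
  assumes "coeffs_tame S F" "affine k"
  shows "tame S (\<lambda>N. coeff (F N) (k N))"
    and "tame (lift_vars S) (\<lambda>N. poly_cutoff (k N) (F N))"
  using assms unfolding coeffs_tame_def by blast+

lemma coeffs_tame_monom_sum: "monom_sum S F \<Longrightarrow> coeffs_tame S F"
proof (induction rule: monom_sum.induct)
  case (monom G k)
  show ?case
  proof (rule coeffs_tameI)
    fix j assume j: "affine j"
    have G: "tame S G" using monom(1) by (rule tame.expo)
    show "tame S (\<lambda>N. coeff (monom (G N) (k N)) (j N))"
      using affine_less_cases[OF j monom(2)]
    proof
      assume "\<forall>\<^sub>F N in sequentially. j N < k N"
      then show ?thesis
        by (rule tame_cong[OF tame_0, OF eventually_mono]) (simp)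
    next
      assume le: "\<forall>\<^sub>F N in sequentially. k N \<le> j N"
      from affine_less_cases[OF monom(2) j] show ?thesis
      proof
        assume "\<forall>\<^sub>F N in sequentially. k N < j N"
        then show ?thesis
          by (rule tame_cong[OF tame_0, OF eventually_mono]) (simp)
      next
        assume "\<forall>\<^sub>F N in sequentially. j N \<le> k N"
        with le have "\<forall>\<^sub>F N in sequentially. coeff (monom (G N) (k N)) (j N) = G N"
          by eventually_elim simp
        then show ?thesis by (rule tame_cong[OF G])
      qed
    qed
    have cutoff: "poly_cutoff j (monom c k) = (if k < j then monom c k else 0)"
      for j k and c :: 'a
      by (auto simp: poly_eq_iff coeff_poly_cutoff)
    show "tame (lift_vars S) (\<lambda>N. poly_cutoff (j N) (monom (G N) (k N)))"
      using affine_less_cases[OF monom(2) j]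
    proof
      assume "\<forall>\<^sub>F N in sequentially. k N < j N"
      then show ?thesis
        by (rule tame_cong[OF tame_monom[OF G monom(2)], OF eventually_mono]) (simp add: cutoff)
    next
      assume "\<forall>\<^sub>F N in sequentially. j N \<le> k N"
      then show ?thesis
        by (rule tame_cong[OF tame_0, OF eventually_mono]) (simp add: cutoff)
    qed
  qed
next
  case (add F G)
  note tame = tame_add[OF coeffs_tameD(1)[OF add.IH(1)] coeffs_tameD(1)[OF add.IH(2)]]
    tame_add[OF coeffs_tameD(2)[OF add.IH(1)] coeffs_tameD(2)[OF add.IH(2)]]
  show ?case
    by (rule coeffs_tameI; unfold coeff_add poly_cutoff_add) (rule tame; assumption)+
qed

lemma coeffs_tame_uminus: "coeffs_tame S F \<Longrightarrow> coeffs_tame S (\<lambda>N. - F N)"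
  by (rule coeffs_tameI; unfold coeff_minus poly_cutoff_uminus)
    (rule tame_uminus, erule (1) coeffs_tameD)+

lemma coeffs_tame_cong:
  assumes "coeffs_tame S F" "\<forall>\<^sub>F N in sequentially. G N = F N"
  shows "coeffs_tame S G"
  proof (rule coeffs_tameI)
  fix k :: "nat \<Rightarrow> nat" assume k: "affine k"
  show "tame S (\<lambda>N. coeff (G N) (k N))"
    using coeffs_tameD(1)[OF assms(1) k]
    by (rule tame_cong) (use assms(2) in \<open>eventually_elim, simp\<close>)
  show "tame (lift_vars S) (\<lambda>N. poly_cutoff (k N) (G N))"
    using coeffs_tameD(2)[OF assms(1) k]
    by (rule tame_cong) (use assms(2) in \<open>eventually_elim, simp\<close>)
qed

lemma coeffs_tame_quotient_const:
  assumes "denominator S d" "coeffs_tame S (\<lambda>N. [:d N:] * F N)"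
    and "denominator (lift_vars S) (\<lambda>N. [:d N:])"
  shows "coeffs_tame S F"
  proof (rule coeffs_tameI)
  fix k :: "nat \<Rightarrow> nat" assume k: "affine k"
  note coeffs = coeffs_tameD[OF assms(2) k]
  have "coeff ([:d N:] * F N) (k N) = d N * coeff (F N) (k N)" for N by simp
  with coeffs(1) have "tame S (\<lambda>N. d N * coeff (F N) (k N))" by (simp only:)
  with assms(1) show "tame S (\<lambda>N. coeff (F N) (k N))"
    by (rule tame_quotient_exact)
  from assms(3) coeffs(2)[unfolded poly_cutoff_const_mult]
  show "tame (lift_vars S) (\<lambda>N. poly_cutoff (k N) (F N))"
    by (rule tame_quotient_exact)
qed

lemma coeffs_tame_quotient_X_power:
  assumes m: "affine m" and F: "coeffs_tame S (\<lambda>N. [:0, 1:] ^ m N * F N)"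
  shows "coeffs_tame S F"
  proof (rule coeffs_tameI)
  fix k :: "nat \<Rightarrow> nat" assume k: "affine k"
  note coeffs = coeffs_tameD[OF F affine_add[OF k m]]
  have "coeff ([:0, 1:] ^ m N * F N) (k N + m N) = coeff (F N) (k N)" for N
    unfolding X_power_eq_monom coeff_monom_mult by simp
  with coeffs(1) show "tame S (\<lambda>N. coeff (F N) (k N))" by (simp only:)
  from coeffs(2) show "tame (lift_vars S) (\<lambda>N. poly_cutoff (k N) (F N))"
    unfolding poly_cutoff_X_mult by (rule tame_quotient_power_affine[OF lift_varsI(1) m])
qed

lemma coeffs_tame_quotient_linear:
  fixes S :: "'a::{idom,ring_char_0} set"
  assumes a: "a \<in> S" and F: "coeffs_tame S (\<lambda>N. [:- a, 1:] * F N)"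
  shows "coeffs_tame S F"
proof -
  have main: "tame S (\<lambda>N. coeff (F N) (k N)) \<and>
      tame (lift_vars S) (\<lambda>N. poly_cutoff (Suc (k N)) (F N))" if k: "affine k" for k
  proof
    have T: "tame (lift_vars S) (\<lambda>N. poly_cutoff (Suc (k N)) ([:- a, 1:] * F N))"
      by (rule coeffs_tameD[OF F affine_Suc[OF k]])
    have "- poly (poly_cutoff (Suc (k N)) ([:- a, 1:] * F N)) a = a ^ Suc (k N) * coeff (F N) (k N)" for N
      unfolding poly_cutoff_linear_mult poly_diff poly_mult by (simp add: poly_monom)
    then have "tame S (\<lambda>N. a ^ Suc (k N) * coeff (F N) (k N))"
      using tame_uminus[OF tame_eval[OF a T]] by (simp only:)
    then show c: "tame S (\<lambda>N. coeff (F N) (k N))"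
      by (rule tame_quotient_power_affine[OF a affine_Suc[OF k]])
    have "tame (lift_vars S) (\<lambda>N. poly_cutoff (Suc (k N)) ([:- a, 1:] * F N) +
        monom (coeff (F N) (k N)) (Suc (k N)))"
      by (intro tame_add T tame_monom c affine_Suc k)
    then have H: "tame (lift_vars S) (\<lambda>N. [:- a, 1:] * poly_cutoff (Suc (k N)) (F N))"
      unfolding poly_cutoff_linear_mult by (simp only: diff_add_cancel)
    have "denominator (lift_vars S) (\<lambda>N. [:0, 1:] - [:a:])"
      using a by (intro denominator.diff lift_varsI) auto
    moreover have "[:0, 1:] - [:a:] = [:- a, 1:]" by simp
    ultimately have "denominator (lift_vars S) (\<lambda>N. [:- a, 1:])" by (simp only:)
    then show "tame (lift_vars S) (\<lambda>N. poly_cutoff (Suc (k N)) (F N))"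
      using H by (rule tame_quotient_exact)
  qed
  show ?thesis
  proof (rule coeffs_tameI)
    fix k :: "nat \<Rightarrow> nat" assume k: "affine k"
    show "tame S (\<lambda>N. coeff (F N) (k N))" using main[OF k] ..
    \<comment> \<open>Truncation below k is obtained from the one below k + 1 by removing the top
      term, which also works where k is 0.\<close>
    have "tame (lift_vars S) (\<lambda>N. poly_cutoff (Suc (k N)) (F N) - monom (coeff (F N) (k N)) (k N))"
      using main[OF k] by (intro tame_diff tame_monom k) auto
    then show "tame (lift_vars S) (\<lambda>N. poly_cutoff (k N) (F N))"
      by (simp add: poly_cutoff_Suc)
  qed
qed

text \<open>A denominator is constant in X, a power of X, or X - a up to sign; each kind has its
  quotient lemma.\<close>

lemma coeffs_tame_tame:
  fixes S :: "'a::{idom,ring_char_0} set"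
  assumes "tame (lift_vars S) F"
  shows "coeffs_tame S F"
  using assms
proof (induction rule: tame.induct)
  case (expo F)
  then show ?case by (intro coeffs_tame_monom_sum expo_monom_sum)
next
  case (quotient q H F)
  have qF: "coeffs_tame S (\<lambda>N. q N * F N)"
    using quotient.IH quotient.hyps(3) by (rule coeffs_tame_cong)
  have const_quotient: "coeffs_tame S F" if "denominator S d" "\<And>N. q N = [:d N:]" for d
  proof -
    have q: "q = (\<lambda>N. [:d N:])" using that(2) by (rule ext)
    show ?thesis
      using that(1) qF[unfolded q] quotient.hyps(1)[unfolded q] by (rule coeffs_tame_quotient_const)
  qed
  have X_quotient: "coeffs_tame S F" if "affine m" "\<And>N. q N = [:0, 1:] ^ m N" for m
    using that(1) qF unfolding that(2) by (rule coeffs_tame_quotient_X_power)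
  from quotient.hyps(1) show ?case
  proof cases
    case (const c)
    show ?thesis
      by (rule const_quotient[OF denominator.const[OF const(2)]]) (simp add: const(1) of_int_poly)
  next
    case (var x)
    from var(2) show ?thesis
    proof (cases rule: lift_varsE)
      case 1
      show ?thesis by (rule X_quotient[OF affine_const[of 1]]) (simp add: var(1) 1)
    next
      case (2 a)
      show ?thesis by (rule const_quotient[OF denominator.var[OF 2(1)]]) (simp add: var(1) 2(2))
    qed
  next
    case (pow x)
    from pow(2) show ?thesis
    proof (cases rule: lift_varsE)
      case 1
      show ?thesis by (rule X_quotient[OF affine_id]) (simp add: pow(1) 1)
    next
      case (2 a)
      show ?thesis
        by (rule const_quotient[OF denominator.pow[OF 2(1)]]) (simp add: pow(1) 2(2) poly_const_pow)
    qed
  next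
    case (diff x y)
    from diff(2) show ?thesis
    proof (cases rule: lift_varsE)
      case x: 1
      from diff(3) show ?thesis
      proof (cases rule: lift_varsE)
        case 1
        then show ?thesis using x diff(4) by simp
      next
        case (2 a)
        have "q N = [:- a, 1:]" for N by (simp add: diff(1) x 2(2))
        then have "coeffs_tame S (\<lambda>N. [:- a, 1:] * F N)"
          using qF by (simp only:)
        then show ?thesis by (rule coeffs_tame_quotient_linear[OF 2(1)])
      qed
    next
      case x: (2 a)
      from diff(3) show ?thesis
      proof (cases rule: lift_varsE)
        case 1
        have minus_q: "- q N = [:- a, 1:]" for N by (simp add: diff(1) x(2) 1)
        have "- (q N * F N) = [:- a, 1:] * F N" for N
            by (rule trans[OF minus_mult_left]) (rule arg_cong[OF minus_q, of "\<lambda>p. p * F N"])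
          then have "coeffs_tame S (\<lambda>N. [:- a, 1:] * F N)"
          using coeffs_tame_uminus[OF qF] by (simp only:)
        then show ?thesis by (rule coeffs_tame_quotient_linear[OF x(1)])
      next
        case (2 b)
        have neq: "a \<noteq> b" using diff(4) unfolding x(2) 2(2) by simp
        show ?thesis
          by (rule const_quotient[OF denominator.diff[OF x(1) 2(1) neq]]) (simp add: diff(1) x(2) 2(2))
      qed
    qed
  qed
qed

lemma tame_coeff:
  fixes S :: "'a::{idom,ring_char_0} set"
  assumes "tame (lift_vars S) F" "affine k"
  shows "tame S (\<lambda>N. coeff (F N) (k N))"
  by (rule coeffs_tameD[OF coeffs_tame_tame[OF assms(1)] assms(2)])

section \<open>Schubert polynomials and coefficients along affine families of codes\<close>

definition vars :: "nat \<Rightarrow> zpoly set" where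
  "vars n = Var ` {1..n}"

lemma Var_in_vars: "1 \<le> i \<Longrightarrow> i \<le> n \<Longrightarrow> Var i \<in> vars n"
  by (auto simp: vars_def)

lemma tame_univariate:
  assumes "tame (vars (Suc n)) F"
  shows "tame (lift_vars (vars n)) (\<lambda>N. univariate (Suc n) (F N))"
proof (rule univariate.tame_image[OF _ _ assms])
  show "univariate (Suc n) ` vars (Suc n) \<subseteq> lift_vars (vars n)"
  proof (rule image_subsetI)
    fix x assume "x \<in> vars (Suc n)"
    then obtain j where j: "x = Var j" "1 \<le> j" "j \<le> Suc n" by (auto simp: vars_def)
    show "univariate (Suc n) x \<in> lift_vars (vars n)"
    proof (cases "j = Suc n")
      case True
      then show ?thesis unfolding j(1) univariate_Var by (simp only: if_True lift_varsI simp_thms)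
    next
      case False
      then have "Var j \<in> vars n" using j by (intro Var_in_vars) auto
      with False show ?thesis unfolding j(1) univariate_Var by (simp only: if_False lift_varsI)
    qed
  qed
  show "inj_on (univariate (Suc n)) (vars (Suc n))"
    by (rule inj_on_inverseI[of _ "\<lambda>p. poly p (Var (Suc n))"]) simp
qed

lemma tame_swap_vars:
  assumes "1 \<le> i" "i < n" "tame (vars n) F"
  shows "tame (vars n) (\<lambda>N. swap_vars i (F N))"
proof (rule swap_vars.tame_image[OF _ _ assms(3)])
  show "swap_vars i ` vars n \<subseteq> vars n"
    using assms(1,2) by (auto simp: vars_def Transposition.transpose_def)
  show "inj_on (swap_vars i) (vars n)"
    by (rule inj_on_inverseI[of _ "swap_vars i"]) simp
qed

lemma tame_divided_diff:
  assumes "1 \<le> i" "i < n" "tame (vars n) F"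
  shows "tame (vars n) (\<lambda>N. divided_diff i (F N))"
proof (rule tame_quotient_exact)
  show "denominator (vars n) (\<lambda>N. Var i - Var (Suc i))"
    using assms by (intro denominator.diff Var_in_vars) auto
  have "(Var i - Var (Suc i)) * divided_diff i f = f - swap_vars i f" for f
    using divided_diff_mult[of i f] by (simp add: mult.commute)
  then show "tame (vars n) (\<lambda>N. (Var i - Var (Suc i)) * divided_diff i (F N))"
    using assms by (simp only:) (intro tame_diff tame_swap_vars)
qed

text \<open>Restricting to the first n positions keeps the count below n * n for every N, unlike the
  length of the permutation.\<close>

definition noninversions :: "nat \<Rightarrow> (nat \<Rightarrow> nat) \<Rightarrow> (nat \<times> nat) set" where
  "noninversions n w = {(a, b). 1 \<le> a \<and> a < b \<and> b \<le> n \<and> w a < w b}"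

lemma noninversions_subset: "noninversions n w \<subseteq> {1..n} \<times> {1..n}"
  by (auto simp: noninversions_def)

lemma finite_noninversions: "finite (noninversions n w)"
  using noninversions_subset by (rule finite_subset) simp

lemma card_noninversions_le: "card (noninversions n w) \<le> n * n"
  using card_mono[OF _ noninversions_subset] by (simp add: card_cartesian_product)

text \<open>Exchanging i and i + 1 in both components embeds the new noninversions into the old
  ones, and the pair (i, i + 1) is missed.\<close>

lemma card_noninversions_ascent:
  assumes i: "1 \<le> i" "i < n" and asc: "w i < w (Suc i)"
  shows "card (noninversions n (w \<circ> adj i)) < card (noninversions n w)"
proof -
  let ?g = "map_prod (adj i) (adj i)"
  have "?g ` noninversions n (w \<circ> adj i) \<subseteq> noninversions n w - {(i, Suc i)}"
  proof (rule image_subsetI)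
    fix x assume "x \<in> noninversions n (w \<circ> adj i)"
    then obtain a b where x: "x = (a, b)" and ab: "1 \<le> a" "a < b" "b \<le> n" "w (adj i a) < w (adj i b)"
      by (auto simp: noninversions_def)
    then have "\<not> (a = i \<and> b = Suc i)" using asc by auto
    then have "1 \<le> adj i a \<and> adj i a < adj i b \<and> adj i b \<le> n \<and> (adj i a, adj i b) \<noteq> (i, Suc i)"
      using ab(1-3) i by (auto simp: Transposition.transpose_def)
    then show "?g x \<in> noninversions n w - {(i, Suc i)}"
      using ab(4) by (simp add: x noninversions_def)
  qed
  then have "card (?g ` noninversions n (w \<circ> adj i)) \<le> card (noninversions n w - {(i, Suc i)})"
    by (rule card_mono[rotated]) (rule finite_Diff[OF finite_noninversions])
  also have "\<dots> < card (noninversions n w)"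
    using finite_noninversions
    by (rule card_Diff1_less) (use i asc in \<open>simp add: noninversions_def\<close>)
  finally have "card (?g ` noninversions n (w \<circ> adj i)) < card (noninversions n w)" .
  moreover have "inj_on ?g (noninversions n (w \<circ> adj i))"
    by (rule inj_on_inverseI[of _ ?g]) (simp add: prod.map_comp comp_def prod.map_ident)
  ultimately show ?thesis by (simp only: card_image)
qed

lemma card_noninversions_down:
  assumes "\<gamma> \<in> codes n" "1 \<le> i" "i < n" "\<gamma> (Suc i) < \<gamma> i"
  shows "card (noninversions n (code_inv \<gamma>)) < card (noninversions n (code_inv (code_down i \<gamma>)))"
proof -
  note d = code_inv_down[OF assms(1,4)]
  have "(code_inv \<gamma> \<circ> adj i) i < (code_inv \<gamma> \<circ> adj i) (Suc i)"
    using d(2) by simp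
  from card_noninversions_ascent[OF assms(2,3) this] show ?thesis
    unfolding d(1) comp_adj_adj .
qed

lemma card_noninversions_up:
  assumes "\<gamma> \<in> codes n" "1 \<le> i" "i < n" "\<gamma> i \<le> \<gamma> (Suc i)"
  shows "card (noninversions n (code_inv (code_up i \<gamma>))) < card (noninversions n (code_inv \<gamma>))"
proof -
  have "(code_up i \<gamma>) (Suc i) < (code_up i \<gamma>) i"
    using assms(4) by (simp add: code_up_def)
  from card_noninversions_down[OF code_up_codes[OF assms(1-3)] assms(2,3) this]
  show ?thesis unfolding code_down_up .
qed

lemma Sch_up:
  assumes "\<gamma> \<in> codes n" "1 \<le> i" "i < n" "\<gamma> i \<le> \<gamma> (Suc i)"
  shows "Sch \<gamma> = divided_diff i (Sch (code_up i \<gamma>))"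
proof -
  have "(code_up i \<gamma>) (Suc i) < (code_up i \<gamma>) i"
    using assms(4) by (simp add: code_up_def)
  from Sch_down[OF code_up_codes[OF assms(1-3)] this] show ?thesis
    unfolding code_down_up by simp
qed

lemma affine_code_up:
  assumes "\<And>j. affine (\<lambda>N. \<gamma> N j)" shows "affine (\<lambda>N. code_up i (\<gamma> N) j)"
  using assms affine_Suc[OF assms]
  by (cases "j = Suc i"; cases "j = i") (simp_all add: code_up_def)

lemma affine_code_down:
  assumes "\<And>j. affine (\<lambda>N. \<gamma> N j)" shows "affine (\<lambda>N. code_down i (\<gamma> N) j)"
  using assms affine_diff_1[OF assms]
  by (cases "j = Suc i"; cases "j = i") (simp_all add: code_down_def)

text \<open>
  The bound \<open>k\<close>, uniform in \<open>N\<close>, limits the number of sorting steps among the first \<open>n\<close> values.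
\<close>

lemma tame_Sch_aux:
  assumes "\<And>N. \<gamma> N \<in> codes n" "\<And>i. affine (\<lambda>N. \<gamma> N i)"
    and "\<forall>\<^sub>F N in sequentially. card (noninversions n (code_inv (\<gamma> N))) < k"
  shows "tame (vars n) (\<lambda>N. Sch (\<gamma> N))"
  using assms
proof (induction k arbitrary: \<gamma>)
  case 0
  \<comment> \<open>No count is below 0, so the hypothesis makes any equation hold
    eventually.\<close>
  then have "\<forall>\<^sub>F N in sequentially. Sch (\<gamma> N) = 0" by simp
  then show ?case by (rule tame_cong[OF tame_0])
next
  case (Suc k)
  note codes = Suc.prems(1) and aff = Suc.prems(2)
  show ?case
  \<comment> \<open>One index must serve all large N. If there is none,
    \<open>affine_less_cases\<close> gives strict descents throughout, and the code is
    dominant.\<close>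
  proof (cases "\<exists>i. 1 \<le> i \<and> i < n \<and> (\<forall>\<^sub>F N in sequentially. \<gamma> N i \<le> \<gamma> N (Suc i))")
    case True
    then obtain i where i: "1 \<le> i" "i < n" "\<forall>\<^sub>F N in sequentially. \<gamma> N i \<le> \<gamma> N (Suc i)"
      by blast
    have "\<forall>\<^sub>F N in sequentially. card (noninversions n (code_inv (code_up i (\<gamma> N)))) < k"
      using Suc.prems(3) i(3)
    proof eventually_elim
      case (elim N)
      then show ?case using card_noninversions_up[OF codes i(1,2), of N] by simp
    qed
    then have "tame (vars n) (\<lambda>N. Sch (code_up i (\<gamma> N)))"
      by (intro Suc.IH code_up_codes codes affine_code_up aff i)
    then have "tame (vars n) (\<lambda>N. divided_diff i (Sch (code_up i (\<gamma> N))))"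
      by (rule tame_divided_diff[OF i(1,2)])
    moreover have "\<forall>\<^sub>F N in sequentially. Sch (\<gamma> N) = divided_diff i (Sch (code_up i (\<gamma> N)))"
      using i(3) by eventually_elim (rule Sch_up[OF codes i(1,2)])
    ultimately show ?thesis by (rule tame_cong)
  next
    case False
    have "\<forall>\<^sub>F N in sequentially. \<gamma> N (Suc i) < \<gamma> N i" if "1 \<le> i" "i < n" for i
      using affine_less_cases[OF aff[of "Suc i"] aff[of i]] False that by blast
    then have "\<forall>\<^sub>F N in sequentially. \<forall>i\<in>{1..<n}. \<gamma> N (Suc i) < \<gamma> N i"
      by (intro eventually_ball_finite) auto
    then have "\<forall>\<^sub>F N in sequentially. Sch (\<gamma> N) = (\<Prod>i=1..n. Var i ^ \<gamma> N i)"
      by eventually_elim (intro Sch_dominant codes, simp add: less_imp_le)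
    moreover have "tame (vars n) (\<lambda>N. \<Prod>i=1..n. Var i ^ \<gamma> N i)"
      by (intro tame_prod tame_power_affine[OF Var_in_vars aff]) auto
    ultimately show ?thesis by (rule tame_cong[rotated])
  qed
qed

lemma tame_Sch:
  assumes "\<And>N. \<gamma> N \<in> codes n" "\<And>i. affine (\<lambda>N. \<gamma> N i)"
  shows "tame (vars n) (\<lambda>N. Sch (\<gamma> N))"
  using assms
proof (rule tame_Sch_aux)
  show "\<forall>\<^sub>F N in sequentially. card (noninversions n (code_inv (\<gamma> N))) < Suc (n * n)"
    using card_noninversions_le by (simp add: less_Suc_eq_le)
qed

section \<open>Coefficient functionals along affine families\<close>

lemma ev_poly_cong:
  assumes "ev_poly a" "\<forall>\<^sub>F N in sequentially. b N = a N" shows "ev_poly b"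
  using ev_poly_divide[OF assms(1), of 1 b] assms(2) by simp

text \<open>The last variable X is eliminated repeatedly. The coefficient of X^(n+k) after
  multiplying by all X - x_i is that of X^k after multiplying by all 1 - x_i / X.\<close>

lemma ev_poly_coeff_increasing:
  assumes "\<And>N. \<gamma> N \<in> codes n" "\<And>i. affine (\<lambda>N. \<gamma> N i)"
    and "\<forall>\<^sub>F N in sequentially. \<forall>i\<in>{1..<n}. \<gamma> N i \<le> \<gamma> N (Suc i)"
    and "\<And>N. F N \<in> polys n" "tame (vars n) F"
  shows "ev_poly (\<lambda>N. schubert_coeff (code_inv (\<gamma> N)) (F N))"
  using assms
proof (induction n arbitrary: \<gamma> F)
  case 0
  have "\<exists>c. F N = of_int c" for N
    using 0(4) by (rule polys_zero_variables)
  then obtain g where g: "F N = of_int (g N)" for N by metis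
  have "\<gamma> N = (\<lambda>_. 0)" for N
    using codes_eq_0[OF 0(1)] by auto
  then have "schubert_coeff (code_inv (\<gamma> N)) (F N) = g N" for N
    using schubert_coeff_eq[OF 0(4) dual.id, of N] by (simp only: code_inv_0 g const_term.of_int)
      simp
  moreover have "ev_poly g"
    using 0(5) by (intro tame_no_vars_ev_poly[where 'a = zpoly]) (simp add: vars_def g)
  ultimately show ?case by simp
next
  case (Suc n)
  let ?\<gamma> = "\<lambda>N. (\<gamma> N)(Suc n := 0)"
  let ?G = "\<lambda>N. coeff (univariate (Suc n) (F N) * (\<Prod>i<n. [:- Var (Suc i), 1:])) (n + \<gamma> N (Suc n))"
  note codes = Suc.prems(1) and aff = Suc.prems(2)
  have codes': "?\<gamma> N \<in> codes n" for N
    using codes[of N] unfolding codes_def by (auto simp: le_Suc_eq)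
  have "ev_poly (\<lambda>N. schubert_coeff (code_inv (?\<gamma> N)) (?G N))"
  proof (rule Suc.IH)
    show "?\<gamma> N \<in> codes n" for N by (rule codes')
    show "affine (\<lambda>N. ?\<gamma> N i)" for i
      using aff affine_const by (cases "i = Suc n") auto
    show "\<forall>\<^sub>F N in sequentially. \<forall>i\<in>{1..<n}. ?\<gamma> N i \<le> ?\<gamma> N (Suc i)"
      using Suc.prems(3) by eventually_elim auto
    show "?G N \<in> polys n" for N
      by (intro coeff_mult_polys coeff_univariate_polys Suc.prems coeff_prod_linear_polys order_refl)
    have "tame (lift_vars (vars n)) (\<lambda>N. [:0, 1:] - [:Var (Suc i):])" if "i < n" for i
      using that by (intro tame_diff tame_var lift_varsI Var_in_vars) auto
    then have "tame (lift_vars (vars n)) (\<lambda>N. \<Prod>i<n. [:- Var (Suc i), 1:])"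
      by (intro tame_prod) simp
    then show "tame (vars n) ?G"
      by (intro tame_coeff tame_mult tame_univariate Suc.prems affine_add affine_const)
  qed
  moreover have "\<forall>\<^sub>F N in sequentially.
      schubert_coeff (code_inv (\<gamma> N)) (F N) = schubert_coeff (code_inv (?\<gamma> N)) (?G N)"
    using Suc.prems(3)
  proof eventually_elim
    case (elim N)
    \<comment> \<open>Monotonicity makes the last entry the largest, so the remaining code lies in
      the box that \<open>schubert_coeff_last\<close> requires.\<close>
    have le: "\<gamma> N i \<le> \<gamma> N (Suc n)" if "1 \<le> i" "i \<le> Suc n" for i
      using that(2,1)
    proof (induction i rule: inc_induct)
      case (step i)
      then have "\<gamma> N i \<le> \<gamma> N (Suc i)" using elim by auto
      then show ?case using step by simp
    qed simp
    have "?\<gamma> N \<in> box (Suc n + \<gamma> N (Suc n))"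
      unfolding box_def
    proof (intro CollectI allI impI)
      fix i assume "?\<gamma> N i \<noteq> 0"
      then have "i \<in> {1..n}"
        by (rule contrapos_np) (rule codes_eq_0[OF codes'])
      then have i: "1 \<le> i" "i \<le> n" by auto
      then have "?\<gamma> N i \<le> \<gamma> N (Suc n)" using le[of i] by simp
      then show "1 \<le> i \<and> ?\<gamma> N i + i \<le> Suc n + \<gamma> N (Suc n)" using i by linarith
    qed
    from schubert_coeff_last[OF codes' this Suc.prems(4)] show ?case
      unfolding fun_upd_upd fun_upd_triv .
  qed
  ultimately show ?case by (rule ev_poly_cong)
qed

text \<open>Steps now remove descents, so noninversions increase, and the measure is their deficit
  from n * n.\<close>

lemma ev_poly_coeff_aux:
  assumes "\<And>N. \<gamma> N \<in> codes n" "\<And>i. affine (\<lambda>N. \<gamma> N i)"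
    and "\<And>N. F N \<in> polys n" "tame (vars n) F"
    and "\<forall>\<^sub>F N in sequentially. n * n - card (noninversions n (code_inv (\<gamma> N))) < k"
  shows "ev_poly (\<lambda>N. schubert_coeff (code_inv (\<gamma> N)) (F N))"
  using assms
proof (induction k arbitrary: \<gamma> F)
  case 0
  then have "\<forall>\<^sub>F N in sequentially. schubert_coeff (code_inv (\<gamma> N)) (F N) = 0" by simp
  then show ?case by (rule ev_poly_cong[OF ev_poly_const])
next
  case (Suc k)
  note codes = Suc.prems(1) and aff = Suc.prems(2)
  show ?case
  proof (cases "\<exists>i. 1 \<le> i \<and> i < n \<and> (\<forall>\<^sub>F N in sequentially. \<gamma> N (Suc i) < \<gamma> N i)")
    case True
    then obtain i where i: "1 \<le> i" "i < n" "\<forall>\<^sub>F N in sequentially. \<gamma> N (Suc i) < \<gamma> N i"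
      by blast
    have "\<forall>\<^sub>F N in sequentially. n * n - card (noninversions n (code_inv (code_down i (\<gamma> N)))) < k"
      using Suc.prems(5) i(3)
    proof eventually_elim
      case (elim N)
      then show ?case
        using card_noninversions_down[OF codes i(1,2), of N]
          card_noninversions_le[of n "code_inv (code_down i (\<gamma> N))"] by linarith
    qed
    then have "ev_poly (\<lambda>N. schubert_coeff (code_inv (code_down i (\<gamma> N))) (divided_diff i (F N)))"
      by (intro Suc.IH code_down_codes codes affine_code_down aff i divided_diff_in_polys
          tame_divided_diff Suc.prems)
    moreover have "\<forall>\<^sub>F N in sequentially. schubert_coeff (code_inv (\<gamma> N)) (F N) =
        schubert_coeff (code_inv (code_down i (\<gamma> N))) (divided_diff i (F N))"
      using i(3) by eventually_elim (rule schubert_coeff_down[OF codes _ Suc.prems(3)])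
    ultimately show ?thesis by (rule ev_poly_cong)
  next
    case False
    have "\<forall>\<^sub>F N in sequentially. \<gamma> N i \<le> \<gamma> N (Suc i)" if "1 \<le> i" "i < n" for i
      using affine_less_cases[OF aff[of "Suc i"] aff[of i]] False that by blast
    then have "\<forall>\<^sub>F N in sequentially. \<forall>i\<in>{1..<n}. \<gamma> N i \<le> \<gamma> N (Suc i)"
      by (intro eventually_ball_finite) auto
    then show ?thesis
      using Suc.prems(3,4) by (intro ev_poly_coeff_increasing[OF codes aff])
  qed
qed

lemma ev_poly_coeff:
  assumes "\<And>N. \<gamma> N \<in> codes n" "\<And>i. affine (\<lambda>N. \<gamma> N i)"
    and "\<And>N. F N \<in> polys n" "tame (vars n) F"
  shows "ev_poly (\<lambda>N. schubert_coeff (code_inv (\<gamma> N)) (F N))"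
  using assms
proof (rule ev_poly_coeff_aux)
  show "\<forall>\<^sub>F N in sequentially. n * n - card (noninversions n (code_inv (\<gamma> N))) < Suc (n * n)"
    by (simp add: less_Suc_eq_le)
qed

theorem corollary6p3:
  fixes u v w :: "nat \<Rightarrow> nat"
  assumes "u \<in> perms" and "v \<in> perms" and "w \<in> perms"
  shows "\<exists>P :: rat poly. \<forall>\<^sub>F N in sequentially.
    of_int (schubert_const (N \<^bold>* u) (N \<^bold>* v) (N \<^bold>* w)) = poly P (of_nat N)"
proof -
  obtain a b c where abc:
    "lehmer_code u \<in> codes a" "lehmer_code v \<in> codes b" "lehmer_code w \<in> codes c"
    using assms perms_code_exists by metis
  \<comment> \<open>Stretching does not enlarge the support of a code, so this number of variables
    serves every N.\<close>
  define n where "n = a + b + c"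
  have n: "lehmer_code u \<in> codes n" "lehmer_code v \<in> codes n" "lehmer_code w \<in> codes n"
    unfolding n_def by (rule codes_mono[OF abc(1)] codes_mono[OF abc(2)] codes_mono[OF abc(3)]; simp)+
  define \<gamma> where "\<gamma> x N i = N * lehmer_code x i" for x N i
  have codes: "\<gamma> x N \<in> codes n" if "lehmer_code x \<in> codes n" for x N
  proof -
    have "1 \<le> i \<and> i \<le> n" if "\<gamma> x N i \<noteq> 0" for i
      using that \<open>lehmer_code x \<in> codes n\<close> unfolding \<gamma>_def codes_def by simp
    then show ?thesis unfolding codes_def by blast
  qed
  have aff: "affine (\<lambda>N. \<gamma> x N i)" for x i
    using affine_linear[of "lehmer_code x i" 0] by (simp add: \<gamma>_def mult.commute)
  have stretch: "N \<^bold>* x = code_inv (\<gamma> x N)" for N x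
    unfolding stretch_def \<gamma>_def ..
  have "ev_poly (\<lambda>N. schubert_coeff (code_inv (\<gamma> w N)) (Sch (\<gamma> u N) * Sch (\<gamma> v N)))"
    by (intro ev_poly_coeff[where n = n] aff polys.mult Sch_polys tame_mult tame_Sch codes n)
  moreover have "N \<^bold>* x \<in> perms" if "lehmer_code x \<in> codes n" for N x
    unfolding stretch by (rule code_inv_codes(1)[OF codes[OF that]])
  then have "schubert_const (N \<^bold>* u) (N \<^bold>* v) (N \<^bold>* w) =
      schubert_coeff (N \<^bold>* w) (schubert (N \<^bold>* u) * schubert (N \<^bold>* v))" for N
    using n by (intro schubert_const_eq)
  ultimately have "ev_poly (\<lambda>N. schubert_const (N \<^bold>* u) (N \<^bold>* v) (N \<^bold>* w))"
    by (simp only: stretch)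
  then show ?thesis unfolding ev_poly_def .
qed

end
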